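(* Let $\mathfrak{H}$ be a separable complex Hilbert space, let $\alpha>0$ be non-integer, and let $B$ be a compact operator on $\mathfrak{H}$ such that $B\in\mathfrak{S}^{\star}_{\alpha}(\mathfrak{H})$, $\Theta(B)\subset\mathfrak{L}_0(\theta)$ with $\theta<\pi/(2\alpha)$, and $$s_n(B)=o(n^{-1/\alpha}),\quad n\to\infty.$$ Then a sequence of natural numbers $\{N_\nu\}_{0}^{\infty}$ can be chosen so that for every $f\in\mathfrak{H}$ and $t>0$ $$\frac{1}{2\pi i}\int_{\vartheta(B)}e^{-\lambda^{\alpha}t}B(I-\lambda B)^{-1}f\,d\lambda=\sum_{\nu=0}^{\infty}\mathcal{A}_{\nu}(\lambda^{\alpha},t)f,$$ and moreover $$\sum_{\nu=0}^{\infty}\left\|\mathcal{A}_{\nu}(\lambda^{\alpha},t)f\right\|<\infty .$$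
   Context: $\mathfrak{S}_p(\mathfrak{H})$, $0<p<\infty$, is the Schatten-von Neumann class: compact operators with $\sum_n s_n(T)^p<\infty$, where $s_n(T)$ are the singular numbers in non-increasing order. $\mathfrak{S}^{\star}_{\rho}(\mathfrak{H}):=\{T:\ T\in\mathfrak{S}_{\rho+\varepsilon}\ \forall\varepsilon>0,\ T\notin\mathfrak{S}_{\rho}\}$. $\Theta(B)=\{(Bf,f)_{\mathfrak{H}}:\|f\|_{\mathfrak{H}}=1\}$ is the numerical range, and $\mathfrak{L}_0(\theta)=\{\zeta\in\mathbb{C}:|\arg\zeta|\le\theta\}$ (containing the vertex $0$) with $0\le\theta<\pi/2$. Contour: $\vartheta(B):=\{|\lambda|=r,\ |\arg\lambda|\le\theta+\varepsilon\}\cup\{|\lambda|>r,\ |\arg\lambda|=\theta+\varepsilon\}$, where $r>0$ is such that the closed disc $|\lambda|\le r$ contains no characteristic numbers (reciprocals of non-zero eigenvalues) of $B$, and $\varepsilon>0$ is small enough that $\theta+\varepsilon<\min\{\pi/2,\pi/(2\alpha)\}$. It is traversed from infinity along the ray $\arg\lambda=-(\theta+\varepsilon)$, then along the arc with increasing argument, then to infinity along the ray $\arg\lambda=\theta+\varepsilon$. The power $\lambda^\alpha$ is the principal branch. Root vectors: let $\mu_q$, $q=1,2,\dots$, be the distinct non-zero eigenvalues of $B$, with $|\mu_q|$ non-increasing, and $\lambda_q=1/\mu_q$. In each finite-dimensional root subspace of $\mu_q$ choose a Jordan basis consisting of chains $e_{q_\xi},e_{q_\xi+1},\dots,e_{q_\xi+k(q_\xi)}$,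 $\xi=1,\dots,m(q)$, where $m(q)$ is the geometric multiplicity of $\mu_q$, $Be_{q_\xi}=\mu_q e_{q_\xi}$ and $Be_{q_\xi+i}=\mu_q e_{q_\xi+i}+e_{q_\xi+i-1}$ for $1\le i\le k(q_\xi)$. Let $\{g_n\}$ be the system biorthogonal to $\{e_n\}$, consisting of corresponding Jordan chains $g_{q_\xi},\dots,g_{q_\xi+k(q_\xi)}$ of $B^*$ for the eigenvalues $\overline{\mu_q}$, numbered so that $e_{q_\xi+i}$ is paired with $g_{q_\xi+k(q_\xi)-i}$: the inner product $(e_{q_\xi+i},g_{q_\xi+k(q_\xi)-i})$ is non-zero, and $e_{q_\xi+i}$ is orthogonal to all the other vectors $g_n$. For $\varphi$ analytic (here $\varphi(\lambda)=\lambda^\alpha$) and a sequence $0=N_0<N_1<N_2<\dots$ of integers, put $$\mathcal{A}_\nu(\varphi,t)f:=\sum_{q=N_\nu+1}^{N_{\nu+1}}\sum_{\xi=1}^{m(q)}\sum_{i=0}^{k(q_\xi)}e_{q_\xi+i}\,c_{q_\xi+i}(t),\qquad c_{q_\xi+i}(t)=e^{-\varphi(\lambda_q)t}\sum_{m=0}^{k(q_\xi)-i}H_m(\varphi,\lambda_q,t)\,c_{q_\xi+i+m},$$ where $$c_{q_\xi+i}=\frac{(f,g_{q_\xi+k(q_\xi)-i})}{(e_{q_\xi+i},g_{q_\xi+k(q_\xi)-i})},\qquad H_m(\varphi,z,t)=\frac{e^{\varphi(z)t}}{m!}\lim_{\zeta\to1/z}\frac{d^m}{d\zeta^m}\left\{e^{-\varphi(\zeta^{-1})t}\right\}.$$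 $\mathcal{A}_\nu(\lambda^\alpha,t)$ denotes $\mathcal{A}_\nu(\varphi,t)$ with $\varphi(\lambda)=\lambda^\alpha$. *)

theory Defs
  imports "HOL-Complex_Analysis.Complex_Analysis"
begin

section \<open>Complex Hilbert spaces\<close>

class complex_vector = real_vector +
  fixes scaleC :: "complex \<Rightarrow> 'a \<Rightarrow> 'a"  (infixr "*\<^sub>C" 75)
  assumes scaleC_add_right: "a *\<^sub>C (x + y) = a *\<^sub>C x + a *\<^sub>C y"
    and scaleC_add_left: "(a + b) *\<^sub>C x = a *\<^sub>C x + b *\<^sub>C x"
    and scaleC_scaleC: "a *\<^sub>C b *\<^sub>C x = (a * b) *\<^sub>C x"
    and scaleC_one: "1 *\<^sub>C x = x"
    and scaleR_eq_scaleC: "r *\<^sub>R x = of_real r *\<^sub>C x"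

global_interpretation complex_vector: vector_space
  "scaleC :: complex \<Rightarrow> 'a \<Rightarrow> 'a::complex_vector"
  by unfold_locales
    (simp_all add: scaleC_add_right scaleC_add_left scaleC_scaleC scaleC_one)

text \<open>
  The inner product is linear in its first argument. Positive definiteness and
  the compatibility with the norm are inherited from the real inner product,
  which is its real part.
\<close>

class complex_inner = complex_vector + real_inner +
  fixes cinner :: "'a \<Rightarrow> 'a \<Rightarrow> complex"
  assumes cinner_commute: "cinner x y = cnj (cinner y x)"
    and cinner_add_left: "cinner (x + y) z = cinner x z + cinner y z"
    and cinner_scaleC_left: "cinner (a *\<^sub>C x) y = a * cinner x y"
    and inner_eq_Re_cinner: "inner x y = Re (cinner x y)"

class chilbert_space = complex_inner + complete_space


section \<open>Operators\<close>

definition compact_operator :: "('a::chilbert_space \<Rightarrow> 'a) \<Rightarrow> bool" where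
  "compact_operator T \<longleftrightarrow>
     Vector_Spaces.linear scaleC scaleC T \<and> (\<forall>S. bounded S \<longrightarrow> compact (closure (T ` S)))"

definition cadjoint :: "('a::chilbert_space \<Rightarrow> 'a) \<Rightarrow> 'a \<Rightarrow> 'a" where
  "cadjoint T = (SOME S. \<forall>x y. cinner (T x) y = cinner x (S y))"

definition positive_operator :: "('a::chilbert_space \<Rightarrow> 'a) \<Rightarrow> bool" where
  "positive_operator P \<longleftrightarrow>
     Vector_Spaces.linear scaleC scaleC P \<and> bounded_linear P \<and>
     (\<forall>x. cinner (P x) x \<in> \<real> \<and> 0 \<le> Re (cinner (P x) x))"

definition abs_operator :: "('a::chilbert_space \<Rightarrow> 'a) \<Rightarrow> 'a \<Rightarrow> 'a" where
  "abs_operator T = (THE P. positive_operator P \<and> P \<circ> P = cadjoint T \<circ> T)"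

definition eigenspace :: "('a::chilbert_space \<Rightarrow> 'a) \<Rightarrow> complex \<Rightarrow> 'a set" where
  "eigenspace T z = {x. T x = z *\<^sub>C x}"

definition eigenvalues :: "('a::chilbert_space \<Rightarrow> 'a) \<Rightarrow> complex set" where
  "eigenvalues T = {z. \<exists>x. x \<noteq> 0 \<and> T x = z *\<^sub>C x}"

definition root_subspace :: "('a::chilbert_space \<Rightarrow> 'a) \<Rightarrow> complex \<Rightarrow> 'a set" where
  "root_subspace T z = {x. \<exists>n. ((\<lambda>y. T y - z *\<^sub>C y) ^^ n) x = 0}"

definition characteristic_numbers :: "('a::chilbert_space \<Rightarrow> 'a) \<Rightarrow> complex set" where
  "characteristic_numbers T = {1 / z | z. z \<in> eigenvalues T \<and> z \<noteq> 0}"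

definition numerical_range :: "('a::chilbert_space \<Rightarrow> 'a) \<Rightarrow> complex set" where
  "numerical_range T = {cinner (T f) f | f. norm f = 1}"

text \<open>The vertex belongs to the sector because \<open>Arg 0 = 0\<close>.\<close>

definition sector :: "real \<Rightarrow> complex set" where
  "sector \<theta> = {z. \<bar>Arg z\<bar> \<le> \<theta>}"


section \<open>Singular numbers and Schatten classes\<close>

text \<open>
  The singular numbers of a compact operator are the eigenvalues of
  \<open>\<bar>T\<bar> = (T\<^sup>* T)\<^sup>1\<^sup>/\<^sup>2\<close>, listed in non-increasing order with
  multiplicity and continued by zeros if \<open>T\<close> has finite rank. The conditions below
  determine this sequence uniquely. Indices start at 0:
  \<open>singular_number T n\<close> is the classical \<open>s\<^bsub>n+1\<^esub>(T)\<close>.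
\<close>

definition singular_number :: "('a::chilbert_space \<Rightarrow> 'a) \<Rightarrow> nat \<Rightarrow> real" where
  "singular_number T = (THE s. decseq s \<and> (\<forall>n. 0 \<le> s n) \<and>
     (\<forall>\<sigma>>0. finite {n. s n = \<sigma>} \<and>
        card {n. s n = \<sigma>} = complex_vector.dim (eigenspace (abs_operator T) (of_real \<sigma>))))"

definition schatten :: "real \<Rightarrow> ('a::chilbert_space \<Rightarrow> 'a) set" where
  "schatten p = {T. compact_operator T \<and> summable (\<lambda>n. singular_number T n powr p)}"

definition schatten_star :: "real \<Rightarrow> ('a::chilbert_space \<Rightarrow> 'a) set" where
  "schatten_star \<rho> = {T. (\<forall>\<epsilon>>0. T \<in> schatten (\<rho> + \<epsilon>)) \<and> T \<notin> schatten \<rho>}"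


section \<open>Vector-valued integrals along the contour\<close>

text \<open>
  The library's \<^const>\<open>has_contour_integral\<close> for integrands with values in a
  complex Hilbert space.
\<close>

definition has_vector_contour_integral ::
    "(complex \<Rightarrow> 'a::chilbert_space) \<Rightarrow> 'a \<Rightarrow> (real \<Rightarrow> complex) \<Rightarrow> bool" where
  "has_vector_contour_integral F I \<gamma> \<longleftrightarrow>
     ((\<lambda>s. vector_derivative \<gamma> (at s within {0..1}) *\<^sub>C F (\<gamma> s)) has_integral I) {0..1}"

text \<open>
  The part in the disc of radius \<open>R\<close> of the contour that comes from infinity along
  \<open>Arg z = -\<psi>\<close>, follows the arc of radius \<open>r\<close> with increasing argument, and
  returns to infinity along \<open>Arg z = \<psi>\<close>.
\<close>

definition truncated_contour :: "real \<Rightarrow> real \<Rightarrow> real \<Rightarrow> real \<Rightarrow> complex" where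
  "truncated_contour r \<psi> R =
     linepath (of_real R * cis (-\<psi>)) (of_real r * cis (-\<psi>)) +++
     part_circlepath 0 r (-\<psi>) \<psi> +++
     linepath (of_real r * cis \<psi>) (of_real R * cis \<psi>)"

definition has_sector_contour_integral ::
    "(complex \<Rightarrow> 'a::chilbert_space) \<Rightarrow> 'a \<Rightarrow> real \<Rightarrow> real \<Rightarrow> bool" where
  "has_sector_contour_integral F I r \<psi> \<longleftrightarrow>
     (\<exists>J. (\<forall>R>r. has_vector_contour_integral F (J R) (truncated_contour r \<psi> R)) \<and>
          (J \<longlongrightarrow> I) at_top)"


section \<open>Root vectors and the blocks of the root vector series\<close>

definition jordan_basis ::
    "('a::chilbert_space \<Rightarrow> 'a) \<Rightarrow> complex \<Rightarrow> nat \<Rightarrow> (nat \<Rightarrow> nat) \<Rightarrow> (nat \<Rightarrow> nat \<Rightarrow> 'a) \<Rightarrow> bool" where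
  "jordan_basis T z m k e \<longleftrightarrow>
     (let J = (SIGMA \<xi>:{1..m}. {0..k \<xi>}) in
        inj_on (\<lambda>(\<xi>, i). e \<xi> i) J \<and>
        \<not> complex_vector.dependent ((\<lambda>(\<xi>, i). e \<xi> i) ` J) \<and>
        complex_vector.span ((\<lambda>(\<xi>, i). e \<xi> i) ` J) = root_subspace T z)"

definition jordan_chain ::
    "('a::chilbert_space \<Rightarrow> 'a) \<Rightarrow> complex \<Rightarrow> nat \<Rightarrow> (nat \<Rightarrow> 'a) \<Rightarrow> bool" where
  "jordan_chain T z l v \<longleftrightarrow>
     T (v 0) = z *\<^sub>C v 0 \<and> (\<forall>i\<in>{1..l}. T (v i) = z *\<^sub>C v i + v (i - 1))"

text \<open>
  \<open>\<mu> 1, \<mu> 2, \<dots>\<close> enumerates the distinct non-zero eigenvalues of \<open>B\<close> by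
  non-increasing modulus. If there are only finitely many, the enumeration is continued by
  \<open>\<mu> q = 0\<close> with \<open>m q = 0\<close>, so that these indices contribute nothing.
  \<open>e q \<xi> i\<close> and \<open>g q \<xi> i\<close> stand for the vectors with index \<open>q\<^sub>\<xi> + i\<close>, where
  \<open>1 \<le> \<xi> \<le> m q\<close> and \<open>0 \<le> i \<le> k q \<xi>\<close>.
\<close>

definition root_vector_system ::
    "('a::chilbert_space \<Rightarrow> 'a) \<Rightarrow> (nat \<Rightarrow> complex) \<Rightarrow> (nat \<Rightarrow> nat) \<Rightarrow> (nat \<Rightarrow> nat \<Rightarrow> nat) \<Rightarrow>
     (nat \<Rightarrow> nat \<Rightarrow> nat \<Rightarrow> 'a) \<Rightarrow> (nat \<Rightarrow> nat \<Rightarrow> nat \<Rightarrow> 'a) \<Rightarrow> bool" where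
  "root_vector_system B \<mu> m k e g \<longleftrightarrow>
     bij_betw \<mu> {q. 1 \<le> q \<and> \<mu> q \<noteq> 0} (eigenvalues B - {0}) \<and>
     (\<forall>q\<ge>1. norm (\<mu> (Suc q)) \<le> norm (\<mu> q)) \<and>
     (\<forall>q\<ge>1. m q = (if \<mu> q = 0 then 0 else complex_vector.dim (eigenspace B (\<mu> q)))) \<and>
     (\<forall>q\<ge>1. \<mu> q \<noteq> 0 \<longrightarrow> jordan_basis B (\<mu> q) (m q) (k q) (e q)) \<and>
     (\<forall>q\<ge>1. \<forall>\<xi>\<in>{1..m q}. jordan_chain B (\<mu> q) (k q \<xi>) (e q \<xi>) \<and>
        jordan_chain (cadjoint B) (cnj (\<mu> q)) (k q \<xi>) (g q \<xi>)) \<and>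
     (\<forall>q\<ge>1. \<forall>\<xi>\<in>{1..m q}. \<forall>i\<in>{0..k q \<xi>}.
      \<forall>q'\<ge>1. \<forall>\<xi>'\<in>{1..m q'}. \<forall>j\<in>{0..k q' \<xi>'}.
        cinner (e q \<xi> i) (g q' \<xi>' j) \<noteq> 0 \<longleftrightarrow> q' = q \<and> \<xi>' = \<xi> \<and> j = k q \<xi> - i)"

definition root_coeff ::
    "(nat \<Rightarrow> nat \<Rightarrow> nat) \<Rightarrow> (nat \<Rightarrow> nat \<Rightarrow> nat \<Rightarrow> 'a::chilbert_space) \<Rightarrow> (nat \<Rightarrow> nat \<Rightarrow> nat \<Rightarrow> 'a) \<Rightarrow>
     'a \<Rightarrow> nat \<Rightarrow> nat \<Rightarrow> nat \<Rightarrow> complex" where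
  "root_coeff k e g f q \<xi> i =
     cinner f (g q \<xi> (k q \<xi> - i)) / cinner (e q \<xi> i) (g q \<xi> (k q \<xi> - i))"

definition H_coeff :: "nat \<Rightarrow> (complex \<Rightarrow> complex) \<Rightarrow> complex \<Rightarrow> real \<Rightarrow> complex" where
  "H_coeff n \<phi> z t =
     exp (\<phi> z * of_real t) / fact n *
     Lim (at (1 / z)) ((deriv ^^ n) (\<lambda>\<zeta>. exp (- \<phi> (inverse \<zeta>) * of_real t)))"

definition root_coeff_t ::
    "(complex \<Rightarrow> complex) \<Rightarrow> (nat \<Rightarrow> complex) \<Rightarrow> (nat \<Rightarrow> nat \<Rightarrow> nat) \<Rightarrow>
     (nat \<Rightarrow> nat \<Rightarrow> nat \<Rightarrow> 'a::chilbert_space) \<Rightarrow> (nat \<Rightarrow> nat \<Rightarrow> nat \<Rightarrow> 'a) \<Rightarrow>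
     real \<Rightarrow> 'a \<Rightarrow> nat \<Rightarrow> nat \<Rightarrow> nat \<Rightarrow> complex" where
  "root_coeff_t \<phi> \<mu> k e g t f q \<xi> i =
     exp (- \<phi> (1 / \<mu> q) * of_real t) *
     (\<Sum>n=0..k q \<xi> - i. H_coeff n \<phi> (1 / \<mu> q) t * root_coeff k e g f q \<xi> (i + n))"

definition abel_block ::
    "(nat \<Rightarrow> complex) \<Rightarrow> (nat \<Rightarrow> nat) \<Rightarrow> (nat \<Rightarrow> nat \<Rightarrow> nat) \<Rightarrow>
     (nat \<Rightarrow> nat \<Rightarrow> nat \<Rightarrow> 'a::chilbert_space) \<Rightarrow> (nat \<Rightarrow> nat \<Rightarrow> nat \<Rightarrow> 'a) \<Rightarrow>
     (nat \<Rightarrow> nat) \<Rightarrow> nat \<Rightarrow> (complex \<Rightarrow> complex) \<Rightarrow> real \<Rightarrow> 'a \<Rightarrow> 'a" where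
  "abel_block \<mu> m k e g N \<nu> \<phi> t f =
     (\<Sum>q = N \<nu> + 1..N (Suc \<nu>). \<Sum>\<xi> = 1..m q. \<Sum>i = 0..k q \<xi>.
        root_coeff_t \<phi> \<mu> k e g t f q \<xi> i *\<^sub>C e q \<xi> i)"

end

theory Submission
  imports Defs "Jordan_Normal_Form.Determinant" "HOL-Real_Asymp.Real_Asymp"
begin

text \<open>
  On the two rays of the contour the sector condition bounds the resolvent, and on suitable circles
  \<open>\<bar>z\<bar> = R\<^sub>\<nu>\<close> with \<open>R\<^sub>\<nu> \<rightarrow> \<infinity>\<close> one has
  \<open>\<parallel>(I - zB)\<^sup>-\<^sup>1\<parallel> \<le> exp (\<eta>\<^sub>\<nu> R\<^sub>\<nu>\<^sup>\<alpha>)\<close> with \<open>\<eta>\<^sub>\<nu> \<rightarrow> 0\<close>. Against the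
  decay of \<open>exp (-z\<^sup>\<alpha> t)\<close> this makes the arcs of these circles negligible, and the pieces of the contour
  integral between consecutive circles are the blocks of the root vector series.

  The bound on the circles comes from a finite-rank truncation of \<open>B\<close> instead of Fredholm determinants of the
  full operator. The first \<open>n\<close> singular vectors give \<open>B = K + E\<close> with \<open>rank K \<le> n\<close> and
  \<open>\<parallel>E\<parallel> \<le> s\<^sub>n\<close>. For \<open>\<bar>z\<bar> s\<^sub>n \<le> 1/2\<close> the operator \<open>I - zB\<close> is
  invertible iff an \<open>n \<times> n\<close> determinant \<open>D(z)\<close> is non-zero, and by Hadamard's inequality both
  \<open>D\<close> and the numerators in Cramer's rule are at most \<open>\<Prod>\<^sub>j (1 + 2\<bar>z\<bar>s\<^sub>j)\<close>, the product running
  over the first \<open>n\<close> singular numbers. The condition \<open>s\<^sub>n = o(n\<^sup>-\<^sup>1\<^sup>/\<^sup>\<alpha>)\<close> admits \<open>n = o(\<bar>z\<bar>\<^sup>\<alpha>)\<close>, and then the product is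
  \<open>exp (o(\<bar>z\<bar>\<^sup>\<alpha>))\<close>. A minimum modulus theorem supplies circles on which \<open>D\<close> is not small.
\<close>

text \<open>The sequence \<open>N\<close> is chosen before \<open>f\<close> and \<open>t\<close>,
  while the decay on the arcs is
  \<open>exp (- (t * cos (\<alpha> * \<psi>)) * R powr \<alpha>)\<close> with \<open>t\<close>
  arbitrarily small. A resolvent bound \<open>exp (C * R powr \<alpha>)\<close> with fixed
  \<open>C\<close> would serve only large \<open>t\<close>; this is why the hypothesis on the
  singular numbers is a little-o and why the n-th circle carries the exponent 1/n. The poles inside
  the contour are not treated as residues of an operator-valued function. A vector is split by a
  finite-rank projection built from the biorthogonal system: on root vectors the resolvent is an
  explicit finite sum of poles, and on the complementary part it coincides with the resolvent of a
  compact operator from which these poles have been removed. Cauchy's theorem and residues are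
  applied only to scalar functions \<open>cinner (F z) y\<close>; bounds proportional to
  \<open>norm y\<close> then give back norms. Absolute convergence needs no control of the ratios of
  consecutive radii: the ray pieces between the circles are bounded by telescoping differences, and
  only the arcs need a summable bound.\<close>

unbundle no m_inv_syntax

instance chilbert_space \<subseteq> banach ..

section \<open>Complex inner product spaces\<close>

lemma cinner_add_right: "cinner x (y + z) = cinner x y + cinner x z"
  by (metis cinner_add_left cinner_commute complex_cnj_add)

lemma cinner_scaleC_right: "cinner x (a *\<^sub>C y) = cnj a * cinner x y"
  by (metis cinner_commute cinner_scaleC_left complex_cnj_mult)

lemma cinner_self: "cinner x x = of_real ((norm x)\<^sup>2)"
proof -
  have "Im (cinner x x) = 0"
    using cinner_commute[of x x] by (metis cnj.simps(2) equal_neg_zero)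
  moreover have "Re (cinner x x) = (norm x)\<^sup>2"
    by (metis inner_eq_Re_cinner dot_square_norm)
  ultimately show ?thesis by (simp add: complex_eq_iff)
qed

lemma norm_scaleC [simp]: "norm (a *\<^sub>C (x::'a::complex_inner)) = cmod a * norm x"
proof -
  have "cinner (a *\<^sub>C x) (a *\<^sub>C x) = (a * cnj a) * cinner x x"
    by (simp add: cinner_scaleC_left cinner_scaleC_right)
  hence "of_real ((norm (a *\<^sub>C x))\<^sup>2) = (of_real ((cmod a * norm x)\<^sup>2) :: complex)"
    unfolding cinner_self complex_norm_square[symmetric] by (simp add: power_mult_distrib)
  hence "(norm (a *\<^sub>C x))\<^sup>2 = (cmod a * norm x)\<^sup>2"
    using of_real_eq_iff by blast
  thus ?thesis by (simp add: power2_eq_iff_nonneg)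
qed

lemma cinner_minus_left: "cinner (- x) y = - cinner x y"
  using cinner_scaleC_left[of "-1" x y] by (simp add: complex_vector.scale_minus_left scaleC_one)

lemma cinner_minus_right: "cinner x (- y) = - cinner x y"
  by (metis cinner_commute cinner_minus_left complex_cnj_minus)

lemma norm_diff_cinner:
  "of_real ((norm (x - y))\<^sup>2) = cinner x x - cinner x y - cinner y x + cinner y y"
proof -
  have "cinner (x + - y) (x + - y) = cinner x x - cinner x y - cinner y x + cinner y y"
    unfolding cinner_add_left cinner_add_right cinner_minus_left cinner_minus_right by simp
  thus ?thesis by (simp add: cinner_self)
qed

text \<open>Pythagoras along \<open>y\<close>. Non-negativity of the left side is the Cauchy-Schwarz
  inequality, and minimality of \<open>norm x\<close> on the line through \<open>x\<close> in
  direction \<open>y\<close> forces the subtracted term to vanish.\<close>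

lemma orthogonal_projection_norm:
  assumes "y \<noteq> 0"
  shows "(norm (x - (cinner x y / of_real ((norm y)\<^sup>2)) *\<^sub>C y))\<^sup>2
           = (norm x)\<^sup>2 - (cmod (cinner x y))\<^sup>2 / (norm y)\<^sup>2"
proof -
  define n where "n = complex_of_real ((norm y)\<^sup>2)"
  have n: "n \<noteq> 0" "cnj n = n" "cinner y y = n" using assms by (auto simp: n_def cinner_self)
  have "of_real ((norm (x - (cinner x y / n) *\<^sub>C y))\<^sup>2) =
      cinner x x - cnj (cinner x y) / n * cinner x y - cinner x y / n * cinner y x
      + cinner x y / n * (cnj (cinner x y) / n * n)"
    unfolding norm_diff_cinner by (simp add: cinner_scaleC_left cinner_scaleC_right n)
  also have "\<dots> = cinner x x - cinner x y * cnj (cinner x y) / n"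
    using n cinner_commute[of y x] by (simp add: field_simps)
  also have "\<dots> = of_real ((norm x)\<^sup>2 - (cmod (cinner x y))\<^sup>2 / (norm y)\<^sup>2)"
    unfolding n_def cinner_self complex_norm_square[symmetric] by simp
  finally show ?thesis unfolding n_def of_real_eq_iff .
qed

lemma cmod_cinner_le: "cmod (cinner x y) \<le> norm x * norm y"
proof (cases "y = 0")
  case True
  then show ?thesis
    using cinner_add_right[of x 0 0] by simp
next
  case False
  have "0 \<le> (norm x)\<^sup>2 - (cmod (cinner x y))\<^sup>2 / (norm y)\<^sup>2"
    unfolding orthogonal_projection_norm[OF False, symmetric] by simp
  hence "(cmod (cinner x y))\<^sup>2 \<le> (norm x * norm y)\<^sup>2"
    using False by (simp add: field_simps power_mult_distrib)
  thus ?thesis by (rule power2_le_imp_le) simp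
qed

global_interpretation cinner: bounded_bilinear cinner
  by unfold_locales
    (auto simp: cinner_add_left cinner_add_right scaleR_eq_scaleC cinner_scaleC_left
      cinner_scaleC_right scaleR_conv_of_real intro!: exI[of _ 1] cmod_cinner_le)

global_interpretation scaleC: bounded_bilinear "scaleC :: complex \<Rightarrow> 'a::complex_inner \<Rightarrow> 'a"
  by unfold_locales
    (auto simp: scaleC_add_right scaleC_add_left scaleR_eq_scaleC scaleC_scaleC scaleR_conv_of_real
      mult.commute intro!: exI[of _ 1])

lemma orthogonal_if_minimal:
  assumes "\<And>a. norm x \<le> norm (x - a *\<^sub>C y)"
  shows "cinner x y = 0"
proof (cases "y = 0")
  case False
  have "(norm x)\<^sup>2 \<le> (norm x)\<^sup>2 - (cmod (cinner x y))\<^sup>2 / (norm y)\<^sup>2"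
    unfolding orthogonal_projection_norm[OF False, symmetric] by (rule power_mono[OF assms]) simp
  with False show ?thesis by (simp add: field_simps)
qed (simp add: cinner.zero_right)

lemma eq_0_if_cinner: "(\<And>y. cinner x y = 0) \<Longrightarrow> x = 0"
  using cinner_self[of x] by auto

lemma eq_if_cinner: "(\<And>y. cinner x y = cinner x' y) \<Longrightarrow> x = x'"
  using eq_0_if_cinner[of "x - x'"] by (simp add: cinner.diff_left)

text \<open>Turns estimates of scalar contour integrals that are uniform in \<open>y\<close> into
  norm estimates of the vector integral; testing with \<open>y = x\<close> is enough.\<close>

lemma norm_le_if_cinner:
  assumes "\<And>y. cmod (cinner x y) \<le> c * norm y" "0 \<le> c"
  shows "norm x \<le> c"
proof (cases "x = 0")
  case False
  have "(norm x)\<^sup>2 \<le> c * norm x" using assms(1)[of x] by (simp add: cinner_self norm_power)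
  with False show ?thesis by (simp add: power2_eq_square)
qed (use assms in simp)

section \<open>Bounded complex-linear maps, compact operators, functionals and adjoints\<close>

definition cbounded_linear :: "('a::chilbert_space \<Rightarrow> 'a) \<Rightarrow> bool" where
  "cbounded_linear T \<longleftrightarrow> Vector_Spaces.linear scaleC scaleC T \<and> bounded_linear T"

lemma cbounded_linearI:
  assumes "\<And>x y. T (x + y) = T x + T y" "\<And>a x. T (a *\<^sub>C x) = a *\<^sub>C T x"
    and "\<And>x. norm (T x) \<le> K * norm x"
  shows "cbounded_linear T"
  unfolding cbounded_linear_def
proof
  show "Vector_Spaces.linear scaleC scaleC T"
    by unfold_locales (use assms in auto)
  show "bounded_linear T"
    by (rule bounded_linear_intro[of _ K]) (use assms in \<open>auto simp: scaleR_eq_scaleC mult.commute\<close>)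
qed

lemma clinear_simps:
  assumes "Vector_Spaces.linear scaleC scaleC T"
  shows "T (x + y) = T x + T y" "T (a *\<^sub>C x) = a *\<^sub>C T x"
  using assms by (auto simp: Vector_Spaces.linear_def module_hom_def module_hom_axioms_def)

lemma cbounded_linear_simps:
  assumes "cbounded_linear T"
  shows "T (x + y) = T x + T y" "T (a *\<^sub>C x) = a *\<^sub>C T x" "T (x - y) = T x - T y"
    "T 0 = 0" "T (- x) = - T x" "T (sum u A) = (\<Sum>i\<in>A. T (u i))"
  using assms clinear_simps[of T] bounded_linear.linear[of T]
  unfolding cbounded_linear_def
  by (auto simp: real_vector.linear_diff linear_0 linear_neg linear_sum)

lemma cbounded_linear_bound:
  assumes "cbounded_linear T"
  obtains K where "0 < K" "\<And>x. norm (T x) \<le> K * norm x"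
  using assms bounded_linear.pos_bounded[of T] unfolding cbounded_linear_def
  by (auto simp: mult.commute)

lemma cbounded_linear_tendsto:
  assumes "cbounded_linear T" "(u \<longlongrightarrow> x) F"
  shows "((\<lambda>n. T (u n)) \<longlongrightarrow> T x) F"
  using assms bounded_linear.tendsto unfolding cbounded_linear_def by blast

lemma cbounded_linear_compose:
  assumes "cbounded_linear S" "cbounded_linear T"
  shows "cbounded_linear (S \<circ> T)"
proof -
  obtain K where K: "0 < K" "\<And>x. norm (S x) \<le> K * norm x" using cbounded_linear_bound assms by blast
  obtain L where L: "0 < L" "\<And>x. norm (T x) \<le> L * norm x" using cbounded_linear_bound assms by blast
  show ?thesis
  proof (rule cbounded_linearI[where K = "K * L"])
    fix x
    have "norm (S (T x)) \<le> K * norm (T x)" by (rule K)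
    also have "\<dots> \<le> K * (L * norm x)" using K L by (intro mult_left_mono) auto
    finally show "norm ((S \<circ> T) x) \<le> K * L * norm x" by (simp add: mult.assoc)
  qed (auto simp: cbounded_linear_simps assms)
qed

text \<open>Compactness is defined with linearity only. Boundedness follows since the image of the
  unit ball is relatively compact, and homogeneity carries the bound to all vectors.\<close>

lemma compact_operator_cbounded_linear:
  assumes "compact_operator T"
  shows "cbounded_linear T"
proof -
  have lin: "Vector_Spaces.linear scaleC scaleC T" and "compact (closure (T ` cball 0 1))"
    using assms bounded_cball unfolding compact_operator_def by blast+
  hence "bounded (T ` cball 0 1)"
    by (meson bounded_subset closure_subset compact_imp_bounded)
  then obtain K where "\<forall>y\<in>T ` cball 0 1. norm y \<le> K"
    unfolding bounded_iff by blast
  hence K: "norm (T x) \<le> K" if "norm x \<le> 1" for x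
    using that by simp
  show ?thesis
  proof (rule cbounded_linearI)
    fix x
    show "norm (T x) \<le> K * norm x"
    proof (cases "x = 0")
      case True
      then show ?thesis using clinear_simps(2)[OF lin, of 0 x] by simp
    next
      case False
      have "T x = of_real (norm x) *\<^sub>C T (of_real (inverse (norm x)) *\<^sub>C x)"
        using False by (simp flip: clinear_simps(2)[OF lin] add: scaleC_scaleC of_real_inverse scaleC_one)
      also have "norm \<dots> \<le> norm x * K"
        unfolding norm_scaleC by (intro mult_mono K) (use False in \<open>auto simp: norm_inverse\<close>)
      finally show ?thesis by (simp add: mult.commute)
    qed
  qed (use clinear_simps[OF lin] in auto)
qed

lemma compact_operator_convergent_subseq:
  assumes "compact_operator T" "\<And>n. norm (x n) \<le> K"
  obtains \<sigma> y where "strict_mono (\<sigma> :: nat \<Rightarrow> nat)" "(\<lambda>n. T (x (\<sigma> n))) \<longlonglongrightarrow> y"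
proof -
  have "bounded (cball (0::'a) K)" by simp
  hence "compact (closure (T ` cball 0 K))" using assms(1) unfolding compact_operator_def by blast
  hence "seq_compact (closure (T ` cball 0 K))" by (simp add: compact_eq_seq_compact_metric)
  moreover have "\<forall>n. T (x n) \<in> closure (T ` cball 0 K)"
    using assms(2) by (intro allI subsetD[OF closure_subset] imageI) simp
  ultimately obtain \<sigma> y where "strict_mono (\<sigma> :: nat \<Rightarrow> nat)" "((\<lambda>n. T (x n)) \<circ> \<sigma>) \<longlonglongrightarrow> y"
    by (rule seq_compactE) simp
  thus ?thesis using that by (auto simp: o_def)
qed

text \<open>The representing vector is a multiple of a maximizer of \<open>Re \<phi>\<close> on the unit ball; a maximizing
  sequence is Cauchy by the parallelogram law.\<close>

lemma riesz_representation:
  fixes \<phi> :: "'a::chilbert_space \<Rightarrow> complex"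
  assumes add: "\<And>x y. \<phi> (x + y) = \<phi> x + \<phi> y"
    and scale: "\<And>a x. \<phi> (a *\<^sub>C x) = a * \<phi> x"
    and bdd: "\<And>x. cmod (\<phi> x) \<le> K * norm x"
  obtains w where "\<And>x. \<phi> x = cinner x w"
proof (cases "\<forall>x. \<phi> x = 0")
  case True
  then show ?thesis using that[of 0] by (simp add: cinner.zero_right)
next
  case False
  have \<phi>: "bounded_linear \<phi>"
    by (rule bounded_linear_intro[of _ K]) (use assms in \<open>auto simp: scaleR_eq_scaleC mult.commute scaleR_conv_of_real\<close>)
  have diff: "\<phi> (x - y) = \<phi> x - \<phi> y" for x y
    using \<phi> bounded_linear.linear linear_diff by blast
  define X where "X = {Re (\<phi> x) | x. norm x \<le> 1}"
  define s where "s = Sup X"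
  have X0: "X \<noteq> {}" unfolding X_def using norm_zero by (metis (mono_tags) empty_Collect_eq zero_le_one)
  have "Re (\<phi> x) \<le> \<bar>K\<bar>" if "norm x \<le> 1" for x
  proof -
    have "Re (\<phi> x) \<le> K * norm x" using complex_Re_le_cmod bdd order_trans by blast
    also have "\<dots> \<le> \<bar>K\<bar> * 1" using that by (intro mult_mono) auto
    finally show ?thesis by simp
  qed
  hence bX: "bdd_above X" unfolding X_def bdd_above_def by blast
  have le_s: "cmod (\<phi> x) \<le> s * norm x" for x
  proof (cases "\<phi> x = 0 \<or> x = 0")
    case True
    have "0 \<le> s" unfolding s_def
      by (rule cSup_upper[OF _ bX]) (auto simp: X_def intro!: exI[of _ 0] simp: linear_0 bounded_linear.linear[OF \<phi>])
    with True show ?thesis by (auto simp: linear_0 bounded_linear.linear[OF \<phi>])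
  next
    case False
    \<comment> \<open>Rescales \<open>x\<close> to norm 1 and rotates it so that the value of the
      functional becomes a positive real, to which the supremum of real parts applies.\<close>
    define c where "c = cnj (\<phi> x) / of_real (cmod (\<phi> x) * norm x)"
    have "cmod c * norm x = 1" using False by (simp add: c_def norm_divide norm_mult)
    hence "Re (\<phi> (c *\<^sub>C x)) \<in> X" unfolding X_def by fastforce
    hence "Re (\<phi> (c *\<^sub>C x)) \<le> s" unfolding s_def by (rule cSup_upper[OF _ bX])
    moreover have "\<phi> (c *\<^sub>C x) = of_real (cmod (\<phi> x) / norm x)"
    proof -
      have "\<phi> (c *\<^sub>C x) = (\<phi> x * cnj (\<phi> x)) / of_real (cmod (\<phi> x) * norm x)"
        by (simp add: scale c_def mult.commute)
      also have "\<dots> = of_real ((cmod (\<phi> x))\<^sup>2) / of_real (cmod (\<phi> x) * norm x)"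
        by (simp only: complex_norm_square)
      finally show ?thesis using False by (simp add: power2_eq_square)
    qed
    ultimately have "cmod (\<phi> x) / norm x \<le> s" by simp
    thus ?thesis using False by (simp add: field_simps)
  qed
  obtain x0 where "\<phi> x0 \<noteq> 0" using False by blast
  hence "x0 \<noteq> 0" using linear_0[OF bounded_linear.linear[OF \<phi>]] by auto
  have s_pos: "0 < s"
  proof -
    have "0 < s * norm x0" using le_s[of x0] \<open>\<phi> x0 \<noteq> 0\<close> by (meson less_le_trans zero_less_norm_iff)
    thus ?thesis using \<open>x0 \<noteq> 0\<close> by (simp add: zero_less_mult_iff)
  qed
  have "\<exists>x. norm x \<le> 1 \<and> s - 1 / real (Suc n) < Re (\<phi> x)" for n
  proof -
    have "s - 1 / real (Suc n) < Sup X" by (simp add: s_def)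
    thus ?thesis using less_cSup_iff[OF X0 bX] unfolding X_def by blast
  qed
  then obtain x where x: "\<And>n. norm (x n) \<le> 1" "\<And>n. s - 1 / real (Suc n) < Re (\<phi> (x n))" by metis
  have par: "(norm (x m - x n))\<^sup>2 \<le> 8 / s * (1 / real (Suc N))" if "N \<le> m" "N \<le> n" for m n N
  proof -
    have inv_le: "1 / real (Suc k) \<le> 1 / real (Suc N)" if "N \<le> k" for k
      using that by (simp add: frac_le)
    define d where "d = 1 / real (Suc N)"
    have "2 * s - 2 * d \<le> Re (\<phi> (x m + x n))"
      using x(2)[of m] x(2)[of n] inv_le[OF that(1)] inv_le[OF that(2)] by (simp add: add d_def)
    also have "\<dots> \<le> s * norm (x m + x n)" using complex_Re_le_cmod le_s order_trans by blast
    finally have *: "2 - 2 * d / s \<le> norm (x m + x n)" using s_pos by (simp add: field_simps)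
    have "(norm (x m + x n))\<^sup>2 + (norm (x m - x n))\<^sup>2 = 2 * (norm (x m))\<^sup>2 + 2 * (norm (x n))\<^sup>2"
      by (simp add: power2_norm_eq_inner inner_simps inner_commute)
    moreover have "(norm (x m))\<^sup>2 \<le> 1" "(norm (x n))\<^sup>2 \<le> 1"
      using x(1) by (simp_all add: power_le_one)
    \<comment> \<open>Squaring \<open>*\<close> requires a non-negative left side; when that side is
      negative, the claimed lower bound is itself negative.\<close>
    moreover have "4 - 8 * (d / s) \<le> (norm (x m + x n))\<^sup>2"
    proof (cases "0 \<le> 2 - 2 * d / s")
      case True
      have "4 - 8 * (d / s) \<le> (2 - 2 * (d / s))\<^sup>2" by (simp add: power2_eq_square algebra_simps)
      also have "\<dots> \<le> (norm (x m + x n))\<^sup>2" using True * by (intro power_mono) auto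
      finally show ?thesis .
    next
      case False
      have "2 * d / s = 2 * (d / s)" by simp
      with False have "4 - 8 * (d / s) \<le> 0" by linarith
      thus ?thesis by (meson dual_order.trans zero_le_power2)
    qed
    moreover have "8 / s * (1 / real (Suc N)) = 8 * (d / s)" by (simp add: d_def)
    ultimately show ?thesis by linarith
  qed
  have "Cauchy x"
  proof (rule metric_CauchyI)
    fix e :: real assume "0 < e"
    obtain N where N: "8 / (s * e\<^sup>2) < real N" using reals_Archimedean2 by blast
    have se: "0 < s * e\<^sup>2" using s_pos \<open>0 < e\<close> by simp
    hence "8 < real N * (s * e\<^sup>2)" using N pos_divide_less_eq by blast
    also have "\<dots> \<le> real (Suc N) * (s * e\<^sup>2)" using se by (intro mult_right_mono) auto
    finally have "8 / s < real (Suc N) * e\<^sup>2" using s_pos by (simp add: pos_divide_less_eq mult_ac)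
    hence "8 / s / real (Suc N) < e\<^sup>2" by (subst pos_divide_less_eq) (simp_all add: mult.commute)
    hence "8 / s * (1 / real (Suc N)) < e\<^sup>2" by simp
    hence "(norm (x m - x n))\<^sup>2 < e\<^sup>2" if "N \<le> m" "N \<le> n" for m n using par[OF that] by linarith
    thus "\<exists>M. \<forall>m\<ge>M. \<forall>n\<ge>M. dist (x m) (x n) < e"
      unfolding dist_norm using \<open>0 < e\<close> by (meson less_imp_le power2_less_imp_less)
  qed
  then obtain u where u: "x \<longlonglongrightarrow> u" using Cauchy_convergent_iff convergent_def by blast
  have nu: "norm u \<le> 1" by (rule Lim_bounded[OF tendsto_norm[OF u]]) (use x(1) in auto)
  have "(\<lambda>n. Re (\<phi> (x n))) \<longlonglongrightarrow> Re (\<phi> u)"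
    by (intro tendsto_intros bounded_linear.tendsto[OF \<phi>] u)
  moreover have "(\<lambda>n. s - 1 / real (Suc n)) \<longlonglongrightarrow> s - 0"
    by (intro tendsto_intros LIMSEQ_Suc lim_1_over_n)
  ultimately have "s \<le> Re (\<phi> u)"
    using x(2) by (intro LIMSEQ_le[of _ s]) (auto intro!: exI[of _ 0] less_imp_le)
  moreover have "cmod (\<phi> u) \<le> s"
    using le_s[of u] nu s_pos by (smt (verit) mult_left_le)
  ultimately have \<phi>u: "\<phi> u = of_real s"
    by (smt (verit) complex_Re_le_cmod cmod_eq_Re complex_eq_iff Re_complex_of_real Im_complex_of_real
        abs_of_nonneg cmod_power2 power2_less_eq_zero_iff zero_le_power2 power_mono s_pos)
  \<comment> \<open>Subtracting a multiple of a kernel vector keeps the value \<open>s\<close>, so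
    the norm stays at least 1, while \<open>norm u \<le> 1\<close>: \<open>u\<close> is the shortest
    vector of its coset.\<close>
  have orth: "cinner u y = 0" if "\<phi> y = 0" for y
  proof (rule orthogonal_if_minimal)
    fix a
    have "s \<le> s * norm (u - a *\<^sub>C y)"
      using le_s[of "u - a *\<^sub>C y"] that s_pos by (simp add: diff scale \<phi>u)
    thus "norm u \<le> norm (u - a *\<^sub>C y)" using s_pos nu by simp
  qed
  have "norm u = 1"
    using le_s[of u] nu s_pos by (simp add: \<phi>u)
  show ?thesis
  proof (rule that[of "of_real s *\<^sub>C u"])
    fix y
    have "\<phi> (y - (\<phi> y / of_real s) *\<^sub>C u) = 0" using s_pos by (simp add: diff scale \<phi>u)
    hence "cinner (y - (\<phi> y / of_real s) *\<^sub>C u) u = 0" by (metis orth cinner_commute complex_cnj_zero)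
    thus "\<phi> y = cinner y (of_real s *\<^sub>C u)" using s_pos \<open>norm u = 1\<close>
      by (simp add: cinner.diff_left cinner_scaleC_left cinner_scaleC_right cinner_self)
  qed
qed

text \<open>Justifies the choice operator in the definition: Riesz' theorem supplies, for each
  \<open>y\<close>, a vector representing the bounded functional \<open>cinner (T x) y\<close> of
  \<open>x\<close>.\<close>

lemma cadjoint:
  assumes "cbounded_linear T"
  shows "cinner (T x) y = cinner x (cadjoint T y)"
proof -
  obtain K where K: "0 < K" "\<And>x. norm (T x) \<le> K * norm x" using cbounded_linear_bound assms by blast
  have "\<exists>w. \<forall>x. cinner (T x) y = cinner x w" for y
  proof -
    have "cmod (cinner (T x) y) \<le> K * norm y * norm x" for x
      using cmod_cinner_le[of "T x" y] mult_right_mono[OF K(2)[of x] norm_ge_zero[of y]]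
      by (simp add: mult_ac)
    then obtain w where "\<And>x. cinner (T x) y = cinner x w"
      using riesz_representation[of "\<lambda>x. cinner (T x) y" "K * norm y"]
      by (auto simp: cbounded_linear_simps assms cinner_add_left cinner_scaleC_left)
    thus ?thesis by blast
  qed
  hence "\<exists>S. \<forall>x y. cinner (T x) y = cinner x (S y)" by metis
  from someI_ex[OF this] show ?thesis unfolding cadjoint_def by blast
qed

lemma cadjoint':
  assumes "cbounded_linear T"
  shows "cinner (cadjoint T x) y = cinner x (T y)"
  by (metis assms cadjoint cinner_commute)

lemma cbounded_linear_cadjoint:
  assumes "cbounded_linear T"
  shows "cbounded_linear (cadjoint T)"
proof -
  obtain K where K: "0 < K" "\<And>x. norm (T x) \<le> K * norm x" using cbounded_linear_bound assms by blast
  show ?thesis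
  proof (rule cbounded_linearI)
    show "cadjoint T (x + y) = cadjoint T x + cadjoint T y" for x y
      by (rule eq_if_cinner) (simp add: cadjoint'[OF assms] cinner_add_left)
    show "cadjoint T (a *\<^sub>C x) = a *\<^sub>C cadjoint T x" for a x
      by (rule eq_if_cinner) (simp add: cadjoint'[OF assms] cinner_scaleC_left)
    show "norm (cadjoint T x) \<le> K * norm x" for x
    proof (rule norm_le_if_cinner)
      fix y
      have "cmod (cinner x (T y)) \<le> norm x * norm (T y)" by (rule cmod_cinner_le)
      also have "\<dots> \<le> norm x * (K * norm y)" by (intro mult_left_mono K) auto
      finally show "cmod (cinner (cadjoint T x) y) \<le> K * norm x * norm y"
        by (simp add: cadjoint'[OF assms] mult_ac)
    qed (use K in simp)
  qed
qed

section \<open>Orthonormal sequences\<close>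

text \<open>Zero vectors are admitted, so that operators of finite rank need no separate treatment.\<close>

definition orthonormal_seq :: "(nat \<Rightarrow> 'a::chilbert_space) \<Rightarrow> bool" where
  "orthonormal_seq v \<longleftrightarrow> (\<forall>i j. i \<noteq> j \<longrightarrow> cinner (v i) (v j) = 0) \<and> (\<forall>i. norm (v i) = 0 \<or> norm (v i) = 1)"

lemma cinner_sum_orthonormal:
  assumes "orthonormal_seq v" "finite A"
  shows "cinner (\<Sum>j\<in>A. c j *\<^sub>C v j) (v i) = (if i \<in> A then c i * cinner (v i) (v i) else 0)"
proof -
  have "cinner (\<Sum>j\<in>A. c j *\<^sub>C v j) (v i) = (\<Sum>j\<in>A. if j = i then c i * cinner (v i) (v i) else 0)"
    unfolding cinner.sum_left
    by (rule sum.cong) (use assms in \<open>auto simp: orthonormal_seq_def cinner_scaleC_left\<close>)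
  thus ?thesis using assms(2) by simp
qed

lemma norm_sum_orthonormal:
  assumes "orthonormal_seq v" "finite A"
  shows "(norm (\<Sum>j\<in>A. c j *\<^sub>C v j))\<^sup>2 = (\<Sum>j\<in>A. (cmod (c j))\<^sup>2 * (norm (v j))\<^sup>2)"
proof -
  define S where "S = (\<Sum>j\<in>A. c j *\<^sub>C v j)"
  have "of_real ((norm S)\<^sup>2) = cinner S (\<Sum>j\<in>A. c j *\<^sub>C v j)"
    by (simp only: cinner_self S_def)
  also have "\<dots> = (\<Sum>i\<in>A. cnj (c i) * cinner (\<Sum>j\<in>A. c j *\<^sub>C v j) (v i))"
    by (simp add: cinner.sum_right cinner_scaleC_right S_def)
  also have "\<dots> = (\<Sum>i\<in>A. (c i * cnj (c i)) * cinner (v i) (v i))"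
    by (rule sum.cong) (auto simp: cinner_sum_orthonormal[OF assms])
  also have "\<dots> = of_real (\<Sum>j\<in>A. (cmod (c j))\<^sup>2 * (norm (v j))\<^sup>2)"
    by (simp add: complex_norm_square[symmetric] cinner_self)
  finally show ?thesis unfolding of_real_eq_iff S_def .
qed

lemma bessel_identity:
  assumes "orthonormal_seq v" "finite A"
  shows "(norm (x - (\<Sum>j\<in>A. cinner x (v j) *\<^sub>C v j)))\<^sup>2 = (norm x)\<^sup>2 - (\<Sum>j\<in>A. (cmod (cinner x (v j)))\<^sup>2)"
proof -
  define y where "y = (\<Sum>j\<in>A. cinner x (v j) *\<^sub>C v j)"
  \<comment> \<open>For a zero vector both sides vanish, so sequences with zeros obey the identity
    as well.\<close>
  have nv: "(cmod (cinner x (v j)))\<^sup>2 * (norm (v j))\<^sup>2 = (cmod (cinner x (v j)))\<^sup>2" for j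
    using assms(1) by (cases "v j = 0") (auto simp: orthonormal_seq_def cinner.zero_right)
  have yy: "cinner y y = of_real (\<Sum>j\<in>A. (cmod (cinner x (v j)))\<^sup>2)"
    unfolding cinner_self y_def norm_sum_orthonormal[OF assms] nv ..
  have xy: "cinner x y = of_real (\<Sum>j\<in>A. (cmod (cinner x (v j)))\<^sup>2)"
    unfolding y_def cinner.sum_right cinner_scaleC_right of_real_sum
    by (rule sum.cong) (simp_all only: complex_norm_square mult.commute)
  have "of_real ((norm (x - y))\<^sup>2) = cinner x x - of_real (\<Sum>j\<in>A. (cmod (cinner x (v j)))\<^sup>2)"
    unfolding norm_diff_cinner cinner_commute[of y x] xy yy by simp
  hence "of_real ((norm (x - y))\<^sup>2) = (of_real ((norm x)\<^sup>2 - (\<Sum>j\<in>A. (cmod (cinner x (v j)))\<^sup>2)) :: complex)"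
    by (simp only: cinner_self of_real_diff)
  thus ?thesis unfolding y_def of_real_eq_iff .
qed

lemma bessel_inequality:
  assumes "orthonormal_seq v" "finite A"
  shows "(\<Sum>j\<in>A. (cmod (cinner x (v j)))\<^sup>2) \<le> (norm x)\<^sup>2"
  using bessel_identity[OF assms, of x] zero_le_power2 by (metis diff_ge_0_iff_ge)

lemma norm_minus_projection_le:
  assumes "orthonormal_seq v" "finite A"
  shows "norm (x - (\<Sum>j\<in>A. cinner x (v j) *\<^sub>C v j)) \<le> norm x"
proof (rule power2_le_imp_le)
  show "(norm (x - (\<Sum>j\<in>A. cinner x (v j) *\<^sub>C v j)))\<^sup>2 \<le> (norm x)\<^sup>2"
    unfolding bessel_identity[OF assms] by (simp add: sum_nonneg)
qed simp

lemma minus_projection_orthogonal: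
  assumes "orthonormal_seq v" "finite A" "i \<in> A"
  shows "cinner (x - (\<Sum>j\<in>A. cinner x (v j) *\<^sub>C v j)) (v i) = 0"
  unfolding cinner.diff_left cinner_sum_orthonormal[OF assms(1,2)]
  using assms by (cases "v i = 0") (auto simp: orthonormal_seq_def cinner_self cinner.zero_right)

section \<open>Singular numbers of compact operators\<close>

definition orth_compl :: "'a::chilbert_space set \<Rightarrow> 'a set" where
  "orth_compl A = {x. \<forall>a\<in>A. cinner x a = 0}"

lemma closed_orth_compl: "closed (orth_compl A)"
proof -
  have "orth_compl A = (\<Inter>a\<in>A. {x. cinner x a = 0})" by (auto simp: orth_compl_def)
  moreover have "closed {x. cinner x a = 0}" for a
    by (intro closed_Collect_eq continuous_intros cinner.continuous_on)
  ultimately show ?thesis by auto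
qed

definition sup_norm_on :: "('a::chilbert_space \<Rightarrow> 'a) \<Rightarrow> 'a set \<Rightarrow> real" where
  "sup_norm_on T M = Sup ((\<lambda>x. norm (T x)) ` (M \<inter> cball 0 1))"

lemma
  assumes T: "cbounded_linear T" and M: "0 \<in> M" "\<And>a x. x \<in> M \<Longrightarrow> a *\<^sub>C x \<in> M"
  shows sup_norm_on_nonneg: "0 \<le> sup_norm_on T M"
    and norm_le_sup_norm_on: "x \<in> M \<Longrightarrow> norm (T x) \<le> sup_norm_on T M * norm x"
proof -
  obtain K where K: "0 < K" "\<And>x. norm (T x) \<le> K * norm x" using cbounded_linear_bound T by blast
  have bdd: "bdd_above ((\<lambda>x. norm (T x)) ` (M \<inter> cball 0 1))"
    unfolding bdd_above_def
  proof (intro exI ballI)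
    fix y assume "y \<in> (\<lambda>x. norm (T x)) ` (M \<inter> cball 0 1)"
    then obtain x where x: "y = norm (T x)" "norm x \<le> 1" by auto
    have "y \<le> K * norm x" using x K by simp
    also have "\<dots> \<le> K * 1" using x K by (intro mult_left_mono) auto
    finally show "y \<le> K" by simp
  qed
  have le: "norm (T x) \<le> sup_norm_on T M" if "x \<in> M" "norm x \<le> 1" for x
    unfolding sup_norm_on_def by (rule cSup_upper[OF _ bdd]) (use that in auto)
  show nonneg: "0 \<le> sup_norm_on T M"
    using le[of 0] M(1) by (simp add: cbounded_linear_simps[OF T])
  show "norm (T x) \<le> sup_norm_on T M * norm x" if "x \<in> M"
  proof (cases "x = 0")
    case False
    have "norm (T (of_real (inverse (norm x)) *\<^sub>C x)) \<le> sup_norm_on T M"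
      by (rule le) (use that M False in \<open>auto simp: norm_inverse\<close>)
    with False show ?thesis by (simp add: cbounded_linear_simps[OF T] norm_inverse norm_divide field_simps)
  qed (simp add: cbounded_linear_simps[OF T])
qed

text \<open>A maximising sequence has \<open>w n = cadjoint T (T (x n)) - s^2 x n\<close> tending to
  0, because \<open>(norm (w n))^2\<close> is at most
  \<open>2 s^2 (s^2 - (norm (T (x n)))^2)\<close>. Compactness makes \<open>T (x n)\<close> converge
  along a subsequence, and then \<open>x n\<close> itself, being
  \<open>(cadjoint T (T (x n)) - w n) / s^2\<close>, converges to an eigenvector.\<close>

lemma exists_maximal_vector:
  assumes T: "compact_operator T" and M: "closed M" "0 \<in> M" "\<And>a x. x \<in> M \<Longrightarrow> a *\<^sub>C x \<in> M"
    and inv: "\<And>x. x \<in> M \<Longrightarrow> cadjoint T (T x) \<in> M"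
    and pos: "0 < sup_norm_on T M"
  shows "\<exists>v\<in>M. norm v = 1 \<and> cadjoint T (T v) = of_real ((sup_norm_on T M)\<^sup>2) *\<^sub>C v"
proof -
  define s where "s = sup_norm_on T M"
  note T' = compact_operator_cbounded_linear[OF T]
  note S' = cbounded_linear_cadjoint[OF T']
  have s: "0 < s" using pos s_def by simp
  have le: "norm (T x) \<le> s * norm x" if "x \<in> M" for x
    unfolding s_def by (rule norm_le_sup_norm_on[OF T' M(2,3) that])
  have le1: "norm (T x) \<le> s" if "x \<in> M" "norm x \<le> 1" for x
    using order_trans[OF le[OF that(1)] mult_left_mono[OF that(2), of s]] s by simp
  have "\<exists>x\<in>M. norm x \<le> 1 \<and> s - 1 / real (Suc n) < norm (T x)" for n
  proof -
    have "s - 1 / real (Suc n) < Sup ((\<lambda>x. norm (T x)) ` (M \<inter> cball 0 1))"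
      by (simp add: s_def sup_norm_on_def)
    hence "\<exists>y\<in>(\<lambda>x. norm (T x)) ` (M \<inter> cball 0 1). s - 1 / real (Suc n) < y"
      by (rule less_cSupD[rotated]) (use M(2) in auto)
    thus ?thesis by auto
  qed
  then obtain x where x: "\<And>n. x n \<in> M" "\<And>n. norm (x n) \<le> 1" "\<And>n. s - 1 / real (Suc n) < norm (T (x n))"
    by metis
  obtain \<sigma> y where \<sigma>: "strict_mono (\<sigma> :: nat \<Rightarrow> nat)" and y: "(\<lambda>n. T (x (\<sigma> n))) \<longlonglongrightarrow> y"
    using compact_operator_convergent_subseq[OF T, of x 1] x(2) by blast
  have "(\<lambda>n. s - 1 / real (Suc n)) \<longlonglongrightarrow> s - 0"
    by (intro tendsto_intros LIMSEQ_Suc lim_1_over_n)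
  hence "(\<lambda>n. s - 1 / real (Suc n)) \<longlonglongrightarrow> s" by simp
  hence lim: "(\<lambda>n. norm (T (x n))) \<longlonglongrightarrow> s"
  proof (rule tendsto_sandwich[rotated 2])
    show "\<forall>\<^sub>F n in sequentially. s - 1 / real (Suc n) \<le> norm (T (x n))"
      using x(3) by (intro always_eventually allI less_imp_le)
    show "\<forall>\<^sub>F n in sequentially. norm (T (x n)) \<le> s"
      by (intro always_eventually allI le1 x)
  qed simp_all
  \<comment> \<open>Invariance of \<open>M\<close> enters here: the bound for \<open>T\<close> on
    \<open>M\<close> is applied to \<open>cadjoint T (T z)\<close>.\<close>
  have S: "norm (cadjoint T (T z)) \<le> s * norm (T z)" if "z \<in> M" for z
  proof (cases "cadjoint T (T z) = 0")
    case False
    have "(norm (cadjoint T (T z)))\<^sup>2 = cmod (cinner (cadjoint T (T z)) (cadjoint T (T z)))"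
      by (simp add: cinner_self norm_power)
    also have "\<dots> = cmod (cinner (T z) (T (cadjoint T (T z))))"
      by (simp add: cadjoint'[OF T'])
    also have "\<dots> \<le> norm (T z) * (s * norm (cadjoint T (T z)))"
      by (rule order_trans[OF cmod_cinner_le mult_left_mono[OF le[OF inv[OF that]]]]) simp
    finally show ?thesis using False by (simp add: power2_eq_square mult_ac)
  qed (use s in simp)
  define w where "w n = cadjoint T (T (x n)) - of_real (s\<^sup>2) *\<^sub>C x n" for n
  have "(norm (w n))\<^sup>2 \<le> 2 * s\<^sup>2 * (s\<^sup>2 - (norm (T (x n)))\<^sup>2)" for n
  proof -
    let ?S = "cadjoint T (T (x n))"
    have xS: "cinner ?S (x n) = of_real ((norm (T (x n)))\<^sup>2)" "cinner (x n) ?S = of_real ((norm (T (x n)))\<^sup>2)"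
      by (simp_all add: cadjoint'[OF T'] cadjoint[OF T', symmetric] cinner_self)
    have "of_real ((norm (w n))\<^sup>2) = of_real ((norm ?S)\<^sup>2) - of_real (s\<^sup>2) * of_real ((norm (T (x n)))\<^sup>2)
       - of_real (s\<^sup>2) * of_real ((norm (T (x n)))\<^sup>2) + of_real (s\<^sup>2) * (of_real (s\<^sup>2) * cinner (x n) (x n))"
      unfolding w_def norm_diff_cinner cinner_scaleC_left cinner_scaleC_right xS cinner_self[of ?S] by simp
    also have "\<dots> = of_real ((norm ?S)\<^sup>2 - 2 * s\<^sup>2 * (norm (T (x n)))\<^sup>2 + s\<^sup>2 * s\<^sup>2 * (norm (x n))\<^sup>2)"
      by (simp add: cinner_self)
    finally have "(norm (w n))\<^sup>2 = (norm ?S)\<^sup>2 - 2 * s\<^sup>2 * (norm (T (x n)))\<^sup>2 + s\<^sup>2 * s\<^sup>2 * (norm (x n))\<^sup>2"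
      unfolding of_real_eq_iff .
    moreover have "(norm ?S)\<^sup>2 \<le> (s * s)\<^sup>2"
      by (intro power_mono order_trans[OF S[OF x(1)] mult_left_mono[OF le1[OF x(1,2)]]]) (use s in auto)
    moreover have "s\<^sup>2 * s\<^sup>2 * (norm (x n))\<^sup>2 \<le> s\<^sup>2 * s\<^sup>2 * 1"
      using x(2) by (intro mult_left_mono) (auto simp: power_le_one)
    ultimately show ?thesis by (simp add: power2_eq_square algebra_simps)
  qed
  moreover have "(\<lambda>n. 2 * s\<^sup>2 * (s\<^sup>2 - (norm (T (x n)))\<^sup>2)) \<longlonglongrightarrow> 2 * s\<^sup>2 * (s\<^sup>2 - s\<^sup>2)"
    by (intro tendsto_intros lim)
  ultimately have "(\<lambda>n. (norm (w n))\<^sup>2) \<longlonglongrightarrow> 0"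
    by (intro Lim_null_comparison[of "\<lambda>n. (norm (w n))\<^sup>2" "\<lambda>n. 2 * s\<^sup>2 * (s\<^sup>2 - (norm (T (x n)))\<^sup>2)"]
        always_eventually allI) simp_all
  hence "(\<lambda>n. sqrt ((norm (w n))\<^sup>2)) \<longlonglongrightarrow> sqrt 0" by (rule tendsto_real_sqrt)
  hence "w \<longlonglongrightarrow> 0" by (simp add: tendsto_norm_zero_iff)
  hence w: "(\<lambda>n. w (\<sigma> n)) \<longlonglongrightarrow> 0" using LIMSEQ_subseq_LIMSEQ[OF _ \<sigma>] by (fastforce simp: o_def)
  define v where "v = inverse (of_real (s\<^sup>2)) *\<^sub>C cadjoint T y"
  have "(\<lambda>n. inverse (of_real (s\<^sup>2)) *\<^sub>C (cadjoint T (T (x (\<sigma> n))) - w (\<sigma> n))) \<longlonglongrightarrow> inverse (of_real (s\<^sup>2)) *\<^sub>C (cadjoint T y - 0)"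
    by (intro scaleC.tendsto tendsto_intros cbounded_linear_tendsto[OF S'] y w)
  moreover have "inverse (of_real (s\<^sup>2)) *\<^sub>C (cadjoint T (T (x n)) - w n) = x n" for n
    using s by (simp add: w_def scaleC_scaleC scaleC_one)
  ultimately have xv: "(\<lambda>n. x (\<sigma> n)) \<longlonglongrightarrow> v" by (simp add: v_def)
  have vM: "v \<in> M" by (rule closed_sequentially[OF M(1) _ xv]) (use x in auto)
  have "T v = y" by (rule LIMSEQ_unique[OF cbounded_linear_tendsto[OF T' xv] y])
  hence Sv: "cadjoint T (T v) = of_real (s\<^sup>2) *\<^sub>C v"
    using s by (simp add: v_def scaleC_scaleC scaleC_one)
  have "(\<lambda>n. norm (T (x (\<sigma> n)))) \<longlonglongrightarrow> s"
    using LIMSEQ_subseq_LIMSEQ[OF lim \<sigma>] by (simp add: o_def)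
  hence "norm (T v) = s" using LIMSEQ_unique[OF tendsto_norm[OF y]] \<open>T v = y\<close> by blast
  moreover have "norm v \<le> 1" by (rule Lim_bounded[OF tendsto_norm[OF xv]]) (use x(2) in auto)
  ultimately have "norm v = 1" using le[OF vM] s by (smt (verit) mult_left_le mult_less_cancel_left2)
  thus ?thesis using vM Sv s_def by blast
qed

text \<open>\<open>v n\<close> is a unit eigenvector of \<open>T\<^sup>*T\<close> for \<open>(s n)\<^sup>2\<close>, and \<open>v n = 0\<close> as soon as \<open>s n = 0\<close>.\<close>

definition singular_system :: "('a::chilbert_space \<Rightarrow> 'a) \<Rightarrow> (nat \<Rightarrow> real) \<Rightarrow> (nat \<Rightarrow> 'a) \<Rightarrow> bool" where
  "singular_system T s v \<longleftrightarrow> decseq s \<and> (\<forall>n. 0 \<le> s n) \<and> s \<longlonglongrightarrow> 0 \<and> orthonormal_seq v \<and>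
     (\<forall>n. norm (v n) = (if s n = 0 then 0 else 1)) \<and>
     (\<forall>n. cadjoint T (T (v n)) = of_real ((s n)\<^sup>2) *\<^sub>C v n) \<and>
     (\<forall>n x. (\<forall>j<n. cinner x (v j) = 0) \<longrightarrow> norm (T x) \<le> s n * norm x)"

text \<open>The value 0, taken once \<open>T\<close> vanishes on the complement, keeps the sequence
  infinite also for operators of finite rank.\<close>

definition maximal_vector :: "('a::chilbert_space \<Rightarrow> 'a) \<Rightarrow> 'a set \<Rightarrow> 'a" where
  "maximal_vector T A =
     (let s = sup_norm_on T (orth_compl A)
      in if 0 < s then SOME v. v \<in> orth_compl A \<and> norm v = 1 \<and> cadjoint T (T v) = of_real (s\<^sup>2) *\<^sub>C v
         else 0)"

text \<open>A recursion on the set of predecessors, since the next vector must be orthogonal to all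
  of them.\<close>

primrec maximal_vectors :: "('a::chilbert_space \<Rightarrow> 'a) \<Rightarrow> nat \<Rightarrow> 'a set" where
  "maximal_vectors T 0 = {}"
| "maximal_vectors T (Suc n) = insert (maximal_vector T (maximal_vectors T n)) (maximal_vectors T n)"

text \<open>Greedy choice: each vector maximises \<open>T\<close> on the orthogonal complement of
  its predecessors. That complement is invariant under \<open>cadjoint T \<circ> T\<close> because
  the predecessors are eigenvectors of this self-adjoint product. The values tend to 0, since
  otherwise the \<open>T (v n)\<close> would be pairwise orthogonal with norms bounded below,
  against compactness.\<close>

lemma singular_system_exists:
  assumes T: "compact_operator T"
  shows "\<exists>s v. singular_system T s v"
proof -
  define A where "A = maximal_vectors T"
  define v where "v n = maximal_vector T (A n)" for n
  define s where "s n = sup_norm_on T (orth_compl (A n))" for n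
  note T' = compact_operator_cbounded_linear[OF T]
  note S' = cbounded_linear_cadjoint[OF T']
  have A: "A n = v ` {..<n}" for n
    by (induction n) (auto simp: A_def v_def lessThan_Suc)
  have M: "0 \<in> orth_compl B" "x \<in> orth_compl B \<Longrightarrow> a *\<^sub>C x \<in> orth_compl B" for B a and x :: 'a
    by (auto simp: orth_compl_def cinner.zero_left cinner_scaleC_left)
  have s0: "0 \<le> s n" for n unfolding s_def by (rule sup_norm_on_nonneg[OF T' M])
  have sle: "norm (T x) \<le> s n * norm x" if "\<forall>j<n. cinner x (v j) = 0" for n x
    unfolding s_def by (rule norm_le_sup_norm_on[OF T' M]) (use that in \<open>auto simp: A orth_compl_def\<close>)
  have v: "v n \<in> orth_compl (A n) \<and> norm (v n) = (if s n = 0 then 0 else 1) \<and>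
      cadjoint T (T (v n)) = of_real ((s n)\<^sup>2) *\<^sub>C v n" for n
  proof (induction n rule: less_induct)
    case (less n)
    show ?case
    proof (cases "0 < s n")
      case True
      have inv: "cadjoint T (T x) \<in> orth_compl (A n)" if "x \<in> orth_compl (A n)" for x
      proof -
        have "cinner (cadjoint T (T x)) (v j) = 0" if "j < n" for j
        proof -
          have "cinner (cadjoint T (T x)) (v j) = cinner x (cadjoint T (T (v j)))"
            by (simp add: cadjoint'[OF T'] cadjoint[OF T', symmetric])
          thus ?thesis using less[OF that] \<open>x \<in> orth_compl (A n)\<close> that
            by (auto simp: cinner_scaleC_right A orth_compl_def)
        qed
        thus ?thesis by (auto simp: A orth_compl_def)
      qed
      have "\<exists>u. u \<in> orth_compl (A n) \<and> norm u = 1 \<and> cadjoint T (T u) = of_real ((s n)\<^sup>2) *\<^sub>C u"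
        using exists_maximal_vector[OF T closed_orth_compl[of "A n"] M inv] True unfolding s_def by blast
      from someI_ex[OF this] show ?thesis
        using True unfolding v_def maximal_vector_def s_def[symmetric] Let_def by auto
    next
      case False
      hence "v n = 0" "s n = 0" using s0[of n] unfolding v_def maximal_vector_def s_def[symmetric] by (auto simp: Let_def)
      thus ?thesis using M(1) by (simp add: cbounded_linear_simps[OF T'] cbounded_linear_simps[OF S'] scaleC.zero_right)
    qed
  qed
  have Tv: "norm (T (v n)) = s n" for n
  proof -
    have "of_real ((norm (T (v n)))\<^sup>2) = cinner (cadjoint T (T (v n))) (v n)"
      by (simp add: cadjoint'[OF T'] cinner_self)
    also have "\<dots> = of_real ((s n)\<^sup>2)" using v[of n] by (auto simp: cinner_scaleC_left cinner_self)
    finally show ?thesis using s0[of n] by (simp add: power2_eq_iff_nonneg flip: of_real_power)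
  qed
  have orth: "cinner (v i) (v j) = 0" if "i \<noteq> j" for i j
  proof -
    have "cinner (v i) (v j) = 0" if "j < i" for i j
      using v[of i] that by (auto simp: orth_compl_def A)
    thus ?thesis using that by (metis cinner_commute complex_cnj_zero nat_neq_iff)
  qed
  have dec: "decseq s"
    unfolding decseq_Suc_iff
  proof
    fix n
    have "norm (T (v (Suc n))) \<le> s n * norm (v (Suc n))"
      by (rule sle) (use orth in auto)
    also have "\<dots> \<le> s n * 1" using v[of "Suc n"] s0 by (intro mult_left_mono) auto
    finally show "s (Suc n) \<le> s n" by (simp add: Tv)
  qed
  obtain L where L: "s \<longlonglongrightarrow> L" "\<And>n. L \<le> s n"
    using decseq_convergent[OF dec, of 0] s0 by auto
  have "L = 0"
  proof (rule ccontr)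
    assume "L \<noteq> 0"
    hence "0 < L" using L s0 LIMSEQ_le_const[OF L(1), of 0] by fastforce
    have "norm (v n) \<le> 1" for n using v[of n] by auto
    then obtain \<sigma> y where \<sigma>: "strict_mono (\<sigma> :: nat \<Rightarrow> nat)" and y: "(\<lambda>n. T (v (\<sigma> n))) \<longlonglongrightarrow> y"
      using compact_operator_convergent_subseq[OF T] by blast
    have "Cauchy (\<lambda>n. T (v (\<sigma> n)))" using y by (rule LIMSEQ_imp_Cauchy)
    then obtain N where N: "\<And>m n. N \<le> m \<Longrightarrow> N \<le> n \<Longrightarrow> norm (T (v (\<sigma> m)) - T (v (\<sigma> n))) < L"
      using \<open>0 < L\<close> unfolding Cauchy_def dist_norm by blast
    let ?i = "\<sigma> N" and ?j = "\<sigma> (Suc N)"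
    have "?i \<noteq> ?j" using \<sigma> by (metis n_not_Suc_n strict_mono_eq)
    have "of_real ((norm (T (v ?i) - T (v ?j)))\<^sup>2) = cinner (cadjoint T (T (v ?i))) (v ?i)
       - cinner (cadjoint T (T (v ?i))) (v ?j) - cinner (cadjoint T (T (v ?j))) (v ?i) + cinner (cadjoint T (T (v ?j))) (v ?j)"
      unfolding norm_diff_cinner by (simp add: cadjoint'[OF T'])
    also have "\<dots> = of_real ((s ?i)\<^sup>2 + (s ?j)\<^sup>2)"
      using v[of ?i] v[of ?j] orth[of ?i ?j] orth[of ?j ?i] \<open>?i \<noteq> ?j\<close> by (auto simp: cinner_scaleC_left cinner_self)
    finally have "(norm (T (v ?i) - T (v ?j)))\<^sup>2 = (s ?i)\<^sup>2 + (s ?j)\<^sup>2" unfolding of_real_eq_iff .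
    moreover have "L\<^sup>2 \<le> (s ?i)\<^sup>2" using L(2) \<open>0 < L\<close> by (intro power_mono) auto
    moreover have "(norm (T (v ?i) - T (v ?j)))\<^sup>2 < L\<^sup>2" using N[of N "Suc N"] by (intro power_strict_mono) auto
    ultimately show False using zero_le_power2[of "s ?j"] by linarith
  qed
  hence "singular_system T s v"
    unfolding singular_system_def orthonormal_seq_def using dec s0 L(1) orth v sle by auto
  thus ?thesis by blast
qed

text \<open>Resolves the description operator in \<^const>\<open>singular_number\<close>.\<close>

lemma decseq_eq_if_multiplicities_eq:
  fixes s s' :: "nat \<Rightarrow> real"
  assumes "decseq s" "decseq s'" "\<And>n. 0 \<le> s n" "\<And>n. 0 \<le> s' n"
    and fin: "\<And>\<sigma>. 0 < \<sigma> \<Longrightarrow> finite {n. s n = \<sigma>}" "\<And>\<sigma>. 0 < \<sigma> \<Longrightarrow> finite {n. s' n = \<sigma>}"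
    and card: "\<And>\<sigma>. 0 < \<sigma> \<Longrightarrow> card {n. s n = \<sigma>} = card {n. s' n = \<sigma>}"
  shows "s = s'"
proof -
  have False if d: "decseq s" "decseq s'" and eq: "\<And>i. i < n \<Longrightarrow> s i = s' i"
    and lt: "s' n < s n" and s'0: "0 \<le> s' n" and fin: "finite {i. s i = s n}"
    and card: "card {i. s i = s n} = card {i. s' i = s n}" for s s' :: "nat \<Rightarrow> real" and n
  proof -
    \<comment> \<open>In \<open>s'\<close> the value \<open>s n\<close> can occur only before
      \<open>n\<close>, where both sequences agree; \<open>s\<close> takes it at \<open>n\<close> in
      addition, so the multiplicities differ.\<close>
    have "i < n" if "s' i = s n" for i using d(2) lt that by (metis decseqD leD leI)
    hence sub: "{i. s' i = s n} \<subset> {i. s i = s n}" using eq lt by auto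
    show False using psubset_card_mono[OF fin sub] card by simp
  qed
  note * = this
  show ?thesis
  proof (rule ccontr)
    assume "s \<noteq> s'"
    hence "\<exists>n. s n \<noteq> s' n" by auto
    then obtain n where n: "s n \<noteq> s' n" "\<And>i. i < n \<Longrightarrow> s i = s' i"
      using exists_least_iff[of "\<lambda>n. s n \<noteq> s' n"] by blast
    show False
    proof (cases "s' n < s n")
      case True
      hence "0 < s n" using assms(4)[of n] by linarith
      thus False using *[of s s' n] assms n True by simp
    next
      case False
      hence "s n < s' n" "0 < s' n" using assms(3)[of n] n(1) by linarith+
      thus False using *[of s' s n] assms n by simp
    qed
  qed
qed

section \<open>The modulus of a compact operator and its eigenvalue multiplicities\<close>

context
  fixes T :: "'a::chilbert_space \<Rightarrow> 'a" and s :: "nat \<Rightarrow> real" and v :: "nat \<Rightarrow> 'a"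
  assumes compT: "compact_operator T" and sys: "singular_system T s v"
begin

lemma singular_system_facts:
  "decseq s" "0 \<le> s n" "s \<longlonglongrightarrow> 0" "orthonormal_seq v" "norm (v n) = (if s n = 0 then 0 else 1)"
  "cadjoint T (T (v n)) = of_real ((s n)\<^sup>2) *\<^sub>C v n"
  using sys unfolding singular_system_def by blast+

lemma norm_T_minus_projection_le:
  "norm (T (x - (\<Sum>j<n. cinner x (v j) *\<^sub>C v j))) \<le> s n * norm x"
proof -
  have "norm (T (x - (\<Sum>j<n. cinner x (v j) *\<^sub>C v j))) \<le> s n * norm (x - (\<Sum>j<n. cinner x (v j) *\<^sub>C v j))"
    using sys minus_projection_orthogonal[OF singular_system_facts(4), of "{..<n}"]
    unfolding singular_system_def by blast
  also have "\<dots> \<le> s n * norm x"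
    by (intro mult_left_mono norm_minus_projection_le singular_system_facts) auto
  finally show ?thesis .
qed

lemma norm_T_singular_vector: "norm (T (v n)) = s n"
proof -
  note T' = compact_operator_cbounded_linear[OF compT]
  have "of_real ((norm (T (v n)))\<^sup>2) = cinner (cadjoint T (T (v n))) (v n)"
    by (simp add: cadjoint'[OF T'] cinner_self)
  also have "\<dots> = of_real ((s n)\<^sup>2)" using singular_system_facts(5,6)[of n] by (auto simp: cinner_scaleC_left cinner_self)
  finally show ?thesis using singular_system_facts(2)[of n] by (simp add: power2_eq_iff_nonneg flip: of_real_power)
qed

text \<open>The spectral series of the modulus; \<open>abs_operator_eq\<close> identifies it with
  \<open>abs_operator T\<close>, which resolves the definite description there.\<close>

private definition abs_sum :: "'a \<Rightarrow> 'a" where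
  "abs_sum x = (\<Sum>j. (of_real (s j) * cinner x (v j)) *\<^sub>C v j)"

text \<open>One estimate for two purposes: large \<open>m\<close> gives the Cauchy criterion,
  \<open>m = 0\<close> the bound on the sum.\<close>

private lemma norm_partial_abs_sum_le:
  "norm (\<Sum>j\<in>{m..<n}. (of_real (s j) * cinner x (v j)) *\<^sub>C v j) \<le> s m * norm x"
proof (rule power2_le_imp_le)
  have "(norm (\<Sum>j\<in>{m..<n}. (of_real (s j) * cinner x (v j)) *\<^sub>C v j))\<^sup>2
     = (\<Sum>j\<in>{m..<n}. (s j)\<^sup>2 * (cmod (cinner x (v j)))\<^sup>2 * (norm (v j))\<^sup>2)"
    by (simp add: norm_sum_orthonormal singular_system_facts norm_mult power_mult_distrib)
  also have "\<dots> \<le> (\<Sum>j\<in>{m..<n}. (s m)\<^sup>2 * (cmod (cinner x (v j)))\<^sup>2 * 1)"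
    using singular_system_facts by (intro sum_mono mult_mono power_mono) (auto simp: decseqD)
  also have "\<dots> = (s m)\<^sup>2 * (\<Sum>j\<in>{m..<n}. (cmod (cinner x (v j)))\<^sup>2)"
    by (simp add: sum_distrib_left)
  also have "\<dots> \<le> (s m)\<^sup>2 * (norm x)\<^sup>2"
    by (intro mult_left_mono bessel_inequality singular_system_facts) auto
  finally show "(norm (\<Sum>j\<in>{m..<n}. (of_real (s j) * cinner x (v j)) *\<^sub>C v j))\<^sup>2 \<le> (s m * norm x)\<^sup>2"
    by (simp add: power_mult_distrib)
qed (use singular_system_facts in simp)

private lemma abs_sum_sums: "(\<lambda>j. (of_real (s j) * cinner x (v j)) *\<^sub>C v j) sums abs_sum x"
  unfolding abs_sum_def
proof (rule summable_sums, unfold summable_Cauchy, intro allI impI)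
  fix e :: real assume "0 < e"
  have "(\<lambda>n. s n * norm x) \<longlonglongrightarrow> 0 * norm x" by (intro tendsto_intros singular_system_facts)
  hence "\<forall>\<^sub>F n in sequentially. s n * norm x < e" using \<open>0 < e\<close> by (auto dest: order_tendstoD)
  then obtain N where "\<And>n. N \<le> n \<Longrightarrow> s n * norm x < e" unfolding eventually_sequentially by blast
  thus "\<exists>N. \<forall>m\<ge>N. \<forall>n. norm (\<Sum>j = m..<n. (of_real (s j) * cinner x (v j)) *\<^sub>C v j) < e"
    using norm_partial_abs_sum_le le_less_trans by blast
qed

private lemma abs_sum_cbounded_linear: "cbounded_linear abs_sum"
proof (rule cbounded_linearI)
  show "abs_sum (x + y) = abs_sum x + abs_sum y" for x y
    using sums_add[OF abs_sum_sums[of x] abs_sum_sums[of y]] abs_sum_sums[of "x + y"]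
    by (simp add: cinner_add_left distrib_left scaleC_add_left sums_unique2)
  show "abs_sum (a *\<^sub>C x) = a *\<^sub>C abs_sum x" for a x
    using bounded_linear.sums[OF scaleC.bounded_linear_right abs_sum_sums, of a x] abs_sum_sums[of "a *\<^sub>C x"]
    by (simp add: cinner_scaleC_left scaleC_scaleC mult.left_commute sums_unique2)
  show "norm (abs_sum x) \<le> s 0 * norm x" for x
    using abs_sum_sums[of x, unfolded sums_def] norm_partial_abs_sum_le[where m = 0 and x = x]
    by (intro Lim_bounded[OF tendsto_norm]) (auto simp: atLeast0LessThan)
qed

private lemma abs_sum_positive: "positive_operator abs_sum"
proof -
  have "cinner (abs_sum x) x \<in> \<real> \<and> 0 \<le> Re (cinner (abs_sum x) x)" for x
  proof -
    have "(\<lambda>j. cinner ((of_real (s j) * cinner x (v j)) *\<^sub>C v j) x) sums cinner (abs_sum x) x"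
      by (rule bounded_linear.sums[OF cinner.bounded_linear_left abs_sum_sums])
    moreover have "cinner ((of_real (s j) * cinner x (v j)) *\<^sub>C v j) x = of_real (s j * (cmod (cinner x (v j)))\<^sup>2)" for j
      unfolding cinner_scaleC_left cinner_commute[of "v j" x] of_real_mult complex_norm_square by (simp add: mult_ac)
    ultimately have *: "(\<lambda>j. of_real (s j * (cmod (cinner x (v j)))\<^sup>2)) sums cinner (abs_sum x) x" by simp
    have "0 \<le> Re (cinner (abs_sum x) x)"
      by (rule sums_le[OF _ sums_zero sums_Re[OF *]]) (simp add: singular_system_facts(2))
    moreover have "Im (cinner (abs_sum x) x) = 0"
      using sums_unique2[OF sums_Im[OF *], of 0] by simp
    ultimately show ?thesis by (simp add: complex_is_Real_iff)
  qed
  thus ?thesis using abs_sum_cbounded_linear unfolding positive_operator_def cbounded_linear_def by blast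
qed

text \<open>The projections themselves converge only to the component of \<open>x\<close> orthogonal
  to the kernel of \<open>T\<close>; the missing component is annihilated by
  \<open>T\<close>.\<close>

private lemma projection_T_tendsto: "(\<lambda>n. T (\<Sum>j<n. cinner x (v j) *\<^sub>C v j)) \<longlonglongrightarrow> T x"
proof (rule LIM_zero_cancel, rule Lim_null_comparison)
  note T' = compact_operator_cbounded_linear[OF compT]
  show "\<forall>\<^sub>F n in sequentially. norm (T (\<Sum>j<n. cinner x (v j) *\<^sub>C v j) - T x) \<le> s n * norm x"
    using norm_T_minus_projection_le[of x]
    by (intro always_eventually allI) (metis cbounded_linear_simps(3)[OF T'] norm_minus_commute)
  show "(\<lambda>n. s n * norm x) \<longlonglongrightarrow> 0"
    using tendsto_mult_left[OF singular_system_facts(3)] by (auto intro: tendsto_eq_intros singular_system_facts(3))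
qed

private lemma root_projection:
  assumes "cbounded_linear Q" "\<And>j. Q (v j) = of_real (s j) *\<^sub>C v j"
  shows "Q (\<Sum>j<n. cinner x (v j) *\<^sub>C v j) = (\<Sum>j<n. (of_real (s j) * cinner x (v j)) *\<^sub>C v j)"
  by (simp add: cbounded_linear_simps[OF assms(1)] assms(2) scaleC_scaleC mult.commute)

private lemma abs_sum_singular_vector: "abs_sum (v i) = of_real (s i) *\<^sub>C v i"
proof -
  have "(of_real (s j) * cinner (v i) (v j)) *\<^sub>C v j = (if j = i then of_real (s i) *\<^sub>C v i else 0)" for j
    using singular_system_facts(4) singular_system_facts(5)[of i]
    by (auto simp: orthonormal_seq_def cinner_self split: if_splits)
  hence "(\<lambda>j. if j = i then of_real (s i) *\<^sub>C v i else 0) sums abs_sum (v i)"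
    using abs_sum_sums[of "v i"] by simp
  thus ?thesis using sums_unique2[OF _ sums_single[of i "\<lambda>_. of_real (s i) *\<^sub>C v i"]] by blast
qed

private lemma abs_sum_square: "abs_sum \<circ> abs_sum = cadjoint T \<circ> T"
proof
  fix x
  note T' = compact_operator_cbounded_linear[OF compT]
  note S' = cbounded_linear_cadjoint[OF T']
  define p where "p n = (\<Sum>j<n. cinner x (v j) *\<^sub>C v j)" for n
  have "abs_sum (p n) = (\<Sum>j<n. (of_real (s j) * cinner x (v j)) *\<^sub>C v j)" for n
    unfolding p_def by (rule root_projection[OF abs_sum_cbounded_linear abs_sum_singular_vector])
  hence "(\<lambda>n. abs_sum (p n)) \<longlonglongrightarrow> abs_sum x" using abs_sum_sums[of x] unfolding sums_def by simp
  hence "(\<lambda>n. abs_sum (abs_sum (p n))) \<longlonglongrightarrow> abs_sum (abs_sum x)"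
    by (rule cbounded_linear_tendsto[OF abs_sum_cbounded_linear])
  moreover have "abs_sum (abs_sum (p n)) = cadjoint T (T (p n))" for n
    unfolding p_def
    by (simp add: cbounded_linear_simps[OF abs_sum_cbounded_linear] abs_sum_singular_vector
       cbounded_linear_simps[OF T'] cbounded_linear_simps[OF S'] singular_system_facts(6) scaleC_scaleC power2_eq_square
       mult.assoc)
  moreover have "(\<lambda>n. cadjoint T (T (p n))) \<longlonglongrightarrow> cadjoint T (T x)"
    unfolding p_def by (rule cbounded_linear_tendsto[OF S' projection_T_tendsto])
  ultimately show "(abs_sum \<circ> abs_sum) x = (cadjoint T \<circ> T) x"
    using LIMSEQ_unique by (simp add: o_def)
qed

text \<open>For \<open>w = Q (v j) - s j v j\<close> one has \<open>Q w = - s j w\<close>, so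
  positivity of \<open>Q\<close> forces \<open>w = 0\<close>; thus \<open>Q\<close> agrees with the
  series on all singular vectors. Convergence is inherited from \<open>T\<close> because
  \<open>norm (Q y) = norm (T y)\<close>.\<close>

private lemma positive_square_root_unique:
  assumes pos: "positive_operator Q" and sq: "Q \<circ> Q = cadjoint T \<circ> T"
  shows "Q = abs_sum"
proof
  fix x
  note T' = compact_operator_cbounded_linear[OF compT]
  have Q': "cbounded_linear Q" using pos unfolding positive_operator_def cbounded_linear_def by blast
  note Q = cbounded_linear_simps[OF Q']
  have real: "Im (cinner (Q y) y) = 0" and nonneg: "0 \<le> Re (cinner (Q y) y)" for y
    using pos unfolding positive_operator_def complex_is_Real_iff by blast+
  \<comment> \<open>Polarisation: the quadratic form is real at \<open>y + z\<close> and at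
    \<open>y + \<i> z\<close>, which makes \<open>Q\<close> self-adjoint.\<close>
  have sa: "cinner (Q y) z = cinner y (Q z)" for y z
  proof -
    have "Im (cinner (Q y) z + cinner (Q z) y) = 0"
      using real[of "y + z"] real[of y] real[of z] by (simp add: Q cinner_add_left cinner_add_right)
    moreover have "Im (- \<i> * cinner (Q y) z + \<i> * cinner (Q z) y) = 0"
      using real[of "y + \<i> *\<^sub>C z"] real[of y] real[of z]
      by (simp add: Q cinner_add_left cinner_add_right cinner_scaleC_left cinner_scaleC_right)
    ultimately have "cinner (Q y) z = cnj (cinner (Q z) y)" by (simp add: complex_eq_iff)
    thus ?thesis by (metis cinner_commute)
  qed
  have SS: "Q (Q y) = cadjoint T (T y)" for y using sq by (metis comp_apply)
  have Qv: "Q (v j) = of_real (s j) *\<^sub>C v j" for j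
  proof (cases "s j = 0")
    case True
    hence "v j = 0" using singular_system_facts(5)[of j] by simp
    thus ?thesis by (simp add: Q scaleC.zero_right)
  next
    case False
    define w where "w = Q (v j) - of_real (s j) *\<^sub>C v j"
    have "Q w = - (of_real (s j) *\<^sub>C w)"
      unfolding w_def
      by (simp add: Q SS singular_system_facts(6) scaleC.diff_right scaleC_scaleC power2_eq_square)
    hence "cinner (Q w) w = - (of_real (s j) * of_real ((norm w)\<^sup>2))"
      by (simp add: cinner_minus_left cinner_scaleC_left cinner_self)
    hence "0 \<le> - (s j * (norm w)\<^sup>2)" using nonneg[of w] by (simp flip: of_real_power)
    hence "w = 0" using singular_system_facts(2)[of j] False
      by (simp add: mult_le_0_iff)
    thus ?thesis by (simp add: w_def)
  qed
  have norm_Q: "norm (Q y) = norm (T y)" for y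
  proof -
    have "of_real ((norm (Q y))\<^sup>2) = (of_real ((norm (T y))\<^sup>2) :: complex)"
      unfolding cinner_self[symmetric] by (simp add: sa SS cadjoint[OF T', symmetric])
    thus ?thesis unfolding of_real_eq_iff by (simp add: power2_eq_iff_nonneg)
  qed
  define p where "p n = (\<Sum>j<n. cinner x (v j) *\<^sub>C v j)" for n
  have "(\<lambda>n. Q (p n)) \<longlonglongrightarrow> Q x"
  proof (rule LIM_zero_cancel, rule tendsto_norm_zero_cancel)
    have "(\<lambda>n. norm (T (p n) - T x)) \<longlonglongrightarrow> 0"
      unfolding p_def by (intro tendsto_norm_zero LIM_zero projection_T_tendsto)
    thus "(\<lambda>n. norm (Q (p n) - Q x)) \<longlonglongrightarrow> 0"
      by (simp add: Q(3)[symmetric] cbounded_linear_simps(3)[OF T', symmetric] norm_Q)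
  qed
  moreover have "(\<lambda>n. Q (p n)) \<longlonglongrightarrow> abs_sum x"
    using abs_sum_sums[of x] unfolding sums_def p_def root_projection[OF Q' Qv] .
  ultimately show "Q x = abs_sum x" by (rule LIMSEQ_unique)
qed

private lemma abs_operator_eq: "abs_operator T = abs_sum"
  unfolding abs_operator_def
  by (rule the_equality) (simp_all add: abs_sum_positive abs_sum_square positive_square_root_unique)

private lemma finite_multiplicity: "0 < \<sigma> \<Longrightarrow> finite {n. s n = \<sigma>}"
proof -
  assume "0 < \<sigma>"
  hence "\<forall>\<^sub>F n in sequentially. s n < \<sigma>" using singular_system_facts(3) by (auto dest: order_tendstoD)
  then obtain N where "\<And>n. N \<le> n \<Longrightarrow> s n < \<sigma>" unfolding eventually_sequentially by blast
  hence "{n. s n = \<sigma>} \<subseteq> {..<N}" by (force simp: not_le[symmetric])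
  thus ?thesis using finite_subset by blast
qed

text \<open>Comparing coefficients shows that an eigenvector for \<open>\<sigma>\<close> is
  orthogonal to every \<open>v j\<close> with \<open>s j \<noteq> \<sigma>\<close>; its series is
  then a finite sum, and dividing by \<open>\<sigma>\<close> recovers the vector.\<close>

private lemma dim_eigenspace:
  assumes "0 < \<sigma>"
  shows "complex_vector.dim (eigenspace abs_sum (of_real \<sigma>)) = card {n. s n = \<sigma>}"
proof (rule complex_vector.dim_unique)
  define J where "J = {n. s n = \<sigma>}"
  have finJ: "finite J" unfolding J_def by (rule finite_multiplicity[OF assms])
  have nv: "cinner (v j) (v j) = 1" if "j \<in> J" for j
    using that assms singular_system_facts(5)[of j] by (simp add: J_def cinner_self)
  have orth: "cinner (v i) (v j) = 0" if "i \<noteq> j" for i j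
    using that singular_system_facts(4) by (simp add: orthonormal_seq_def)
  have inj: "inj_on v J" by (rule inj_onI) (metis nv orth zero_neq_one)
  show "v ` {n. s n = \<sigma>} \<subseteq> eigenspace abs_sum (of_real \<sigma>)"
    by (auto simp: eigenspace_def abs_sum_singular_vector)
  show "card (v ` {n. s n = \<sigma>}) = card {n. s n = \<sigma>}"
    using card_image[OF inj] by (simp add: J_def)
  show "\<not> complex_vector.dependent (v ` {n. s n = \<sigma>})"
  proof
    assume "complex_vector.dependent (v ` {n. s n = \<sigma>})"
    then obtain u where u: "\<exists>x\<in>v ` J. u x \<noteq> 0" "(\<Sum>x\<in>v ` J. u x *\<^sub>C x) = 0"
      using complex_vector.dependent_finite[of "v ` J"] finJ by (auto simp: J_def)
    then obtain i where i: "i \<in> J" "u (v i) \<noteq> 0" by blast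
    have "(\<Sum>j\<in>J. u (v j) *\<^sub>C v j) = 0" using u(2) by (simp add: sum.reindex[OF inj])
    hence "cinner (\<Sum>j\<in>J. u (v j) *\<^sub>C v j) (v i) = 0" by (simp add: cinner.zero_left)
    thus False using i nv by (simp add: cinner_sum_orthonormal[OF singular_system_facts(4) finJ])
  qed
  show "eigenspace abs_sum (of_real \<sigma>) \<subseteq> complex_vector.span (v ` {n. s n = \<sigma>})"
  proof
    fix x assume "x \<in> eigenspace abs_sum (of_real \<sigma>)"
    hence Px: "abs_sum x = of_real \<sigma> *\<^sub>C x" by (simp add: eigenspace_def)
    have z: "cinner x (v j) = 0" if "s j \<noteq> \<sigma>" for j
    proof -
      have "(\<lambda>i. cinner ((of_real (s i) * cinner x (v i)) *\<^sub>C v i) (v j)) sums cinner (abs_sum x) (v j)"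
        by (rule bounded_linear.sums[OF cinner.bounded_linear_left abs_sum_sums])
      moreover have "cinner ((of_real (s i) * cinner x (v i)) *\<^sub>C v i) (v j) = (if i = j then of_real (s j) * cinner x (v j) else 0)" for i
        using orth[of i j] singular_system_facts(5)[of j] by (auto simp: cinner_scaleC_left cinner_self cinner.zero_right split: if_splits)
      ultimately have "(\<lambda>i. if i = j then of_real (s j) * cinner x (v j) else 0) sums cinner (abs_sum x) (v j)" by simp
      hence "cinner (abs_sum x) (v j) = of_real (s j) * cinner x (v j)"
        using sums_unique2[OF _ sums_single[of j "\<lambda>_. of_real (s j) * cinner x (v j)"]] by blast
      hence "of_real \<sigma> * cinner x (v j) = of_real (s j) * cinner x (v j)" by (simp add: Px cinner_scaleC_left)
      thus ?thesis using that by simp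
    qed
    have "(\<lambda>j. (of_real (s j) * cinner x (v j)) *\<^sub>C v j) sums (\<Sum>j\<in>J. (of_real (s j) * cinner x (v j)) *\<^sub>C v j)"
      by (rule sums_finite[OF finJ]) (auto simp: J_def z scaleC.zero_left)
    hence "of_real \<sigma> *\<^sub>C x = (\<Sum>j\<in>J. (of_real (s j) * cinner x (v j)) *\<^sub>C v j)"
      unfolding Px[symmetric] by (rule sums_unique2[OF abs_sum_sums])
    also have "\<dots> \<in> complex_vector.span (v ` J)"
      by (intro complex_vector.span_sum complex_vector.span_scale complex_vector.span_base) simp
    finally have "inverse (of_real \<sigma>) *\<^sub>C of_real \<sigma> *\<^sub>C x \<in> complex_vector.span (v ` J)"
      by (rule complex_vector.span_scale)
    thus "x \<in> complex_vector.span (v ` {n. s n = \<sigma>})" using assms by (simp add: scaleC_scaleC scaleC_one J_def)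
  qed
qed

theorem singular_number_eq: "singular_number T = s"
  unfolding singular_number_def abs_operator_eq
proof (rule the_equality)
  show "decseq s \<and> (\<forall>n. 0 \<le> s n) \<and> (\<forall>\<sigma>>0. finite {n. s n = \<sigma>} \<and>
      card {n. s n = \<sigma>} = complex_vector.dim (eigenspace abs_sum (complex_of_real \<sigma>)))"
    using singular_system_facts finite_multiplicity dim_eigenspace by simp
next
  fix s' :: "nat \<Rightarrow> real"
  assume "decseq s' \<and> (\<forall>n. 0 \<le> s' n) \<and> (\<forall>\<sigma>>0. finite {n. s' n = \<sigma>} \<and>
      card {n. s' n = \<sigma>} = complex_vector.dim (eigenspace abs_sum (complex_of_real \<sigma>)))"
  thus "s' = s"
    using singular_system_facts finite_multiplicity dim_eigenspace
    by (intro decseq_eq_if_multiplicities_eq) auto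
qed

end

section \<open>Determinants: Hadamard's inequality and Cramer's rule\<close>

text \<open>Entries are a function of two indices, so that matrices depending on \<open>z\<close>
  and matrices with one column replaced are written without carrier sets.\<close>

definition cdet :: "nat \<Rightarrow> (nat \<Rightarrow> nat \<Rightarrow> complex) \<Rightarrow> complex" where
  "cdet n a = Determinant.det (mat n n (\<lambda>(i, j). a i j))"

lemma cdet_expand: "cdet n a = (\<Sum>p | p permutes {0..<n}. signof p * (\<Prod>i = 0..<n. a i (p i)))"
proof -
  have "(\<Prod>i = 0..<n. mat n n (\<lambda>(i, j). a i j) $$ (i, p i)) = (\<Prod>i = 0..<n. a i (p i))"
    if "p permutes {0..<n}" for p
    using permutes_in_image[OF that] by (intro prod.cong) auto
  thus ?thesis by (simp add: cdet_def Determinant.det_def'[OF mat_carrier])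
qed

lemma holomorphic_on_cdet:
  assumes "\<And>i j. i < n \<Longrightarrow> j < n \<Longrightarrow> (\<lambda>z. a z i j) holomorphic_on S"
  shows "(\<lambda>z. cdet n (a z)) holomorphic_on S"
  unfolding cdet_expand
  by (intro holomorphic_intros assms) (auto dest: permutes_in_image)

lemma cdet_transpose: "cdet n (\<lambda>i j. a j i) = cdet n a"
proof -
  have "mat n n (\<lambda>(i, j). a j i) = transpose_mat (mat n n (\<lambda>(i, j). a i j))"
    by (intro eq_matI) auto
  thus ?thesis unfolding cdet_def by (simp add: Determinant.det_transpose[OF mat_carrier])
qed

lemma cdet_cnj: "cdet n (\<lambda>i j. cnj (a i j)) = cnj (cdet n a)"
  unfolding cdet_expand by (simp add: sign_def)

lemma cdet_mult: "cdet n a * cdet n b = cdet n (\<lambda>i j. \<Sum>l<n. a i l * b l j)"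
proof -
  have "mat n n (\<lambda>(i, j). a i j) * mat n n (\<lambda>(i, j). b i j) = mat n n (\<lambda>(i, j). \<Sum>l<n. a i l * b l j)"
    by (intro eq_matI) (auto simp: scalar_prod_def atLeast0LessThan)
  thus ?thesis unfolding cdet_def by (metis Determinant.det_mult mat_carrier)
qed

lemma cdet_diagonal:
  assumes "\<And>i j. i < n \<Longrightarrow> j < n \<Longrightarrow> i \<noteq> j \<Longrightarrow> a i j = 0"
  shows "cdet n a = (\<Prod>i<n. a i i)"
proof -
  have "cdet n a = prod_list (diag_mat (mat n n (\<lambda>(i, j). a i j)))"
    unfolding cdet_def by (rule Determinant.det_upper_triangular[OF _ mat_carrier]) (use assms in auto)
  also have "diag_mat (mat n n (\<lambda>(i, j). a i j)) = map (\<lambda>i. a i i) [0..<n]"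
    by (auto simp: diag_mat_def)
  finally show ?thesis by (simp add: prod.distinct_set_conv_list[symmetric] atLeast0LessThan)
qed

lemma cdet_addrow:
  assumes "l < n" "k \<noteq> l"
  shows "cdet n (\<lambda>i j. if i = k then a i j + c * a l j else a i j) = cdet n a"
proof -
  have "mat n n (\<lambda>(i, j). if i = k then a i j + c * a l j else a i j) = addrow c k l (mat n n (\<lambda>(i, j). a i j))"
    using assms by (intro eq_matI) auto
  thus ?thesis unfolding cdet_def by (simp add: Determinant.det_addrow[OF assms mat_carrier])
qed

section \<open>Hadamard's inequality by orthogonalising the rows\<close>

definition row_inner :: "nat \<Rightarrow> (nat \<Rightarrow> complex) \<Rightarrow> (nat \<Rightarrow> complex) \<Rightarrow> complex" where
  "row_inner n x y = (\<Sum>j<n. x j * cnj (y j))"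

definition row_norm2 :: "nat \<Rightarrow> (nat \<Rightarrow> complex) \<Rightarrow> real" where
  "row_norm2 n x = (\<Sum>j<n. (cmod (x j))\<^sup>2)"

lemma row_norm2_nonneg: "0 \<le> row_norm2 n x"
  unfolding row_norm2_def by (simp add: sum_nonneg)

lemma row_inner_self: "row_inner n x x = of_real (row_norm2 n x)"
  unfolding row_inner_def row_norm2_def of_real_sum complex_norm_square ..

lemma row_inner_commute: "row_inner n y x = cnj (row_inner n x y)"
  unfolding row_inner_def by (simp add: mult.commute)

lemma row_inner_add_left: "row_inner n (\<lambda>j. x j + c * y j) z = row_inner n x z + c * row_inner n y z"
  unfolding row_inner_def by (simp add: algebra_simps sum.distrib sum_distrib_left)

lemma row_norm2_eq_0: "row_norm2 n y = 0 \<Longrightarrow> j < n \<Longrightarrow> y j = 0"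
  unfolding row_norm2_def by (simp add: sum_nonneg_eq_0_iff)

lemma row_projection:
  fixes x y :: "nat \<Rightarrow> complex"
  assumes "row_norm2 n y \<noteq> 0"
  defines "c \<equiv> - row_inner n x y / of_real (row_norm2 n y)"
  shows "row_inner n (\<lambda>j. x j + c * y j) y = 0"
    and "row_norm2 n (\<lambda>j. x j + c * y j) \<le> row_norm2 n x"
proof -
  show 0: "row_inner n (\<lambda>j. x j + c * y j) y = 0"
    using assms(1) unfolding row_inner_add_left row_inner_self c_def by simp
  let ?z = "\<lambda>j. x j + c * y j"
  have "of_real (row_norm2 n ?z) = row_inner n x ?z + c * row_inner n y ?z"
    unfolding row_inner_self[symmetric] by (rule row_inner_add_left)
  also have "\<dots> = row_inner n x ?z" using 0 by (simp add: row_inner_commute[of n y ?z])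
  also have "\<dots> = cnj (row_inner n x x + c * row_inner n y x)"
    unfolding row_inner_commute[of n x ?z] row_inner_add_left ..
  also have "\<dots> = of_real (row_norm2 n x) - (row_inner n x y * cnj (row_inner n x y)) / of_real (row_norm2 n y)"
    by (simp add: row_inner_self row_inner_commute[of n y x] c_def)
  also have "\<dots> = of_real (row_norm2 n x - (cmod (row_inner n x y))\<^sup>2 / row_norm2 n y)"
    by (simp only: complex_norm_square[symmetric] of_real_diff of_real_divide)
  finally have "row_norm2 n ?z = row_norm2 n x - (cmod (row_inner n x y))\<^sup>2 / row_norm2 n y"
    unfolding of_real_eq_iff .
  thus "row_norm2 n ?z \<le> row_norm2 n x" using row_norm2_nonneg[of n y] by simp
qed

text \<open>The product with the conjugate transpose is the Gram matrix of the rows, which is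
  diagonal here.\<close>

lemma hadamard_rows_orthogonal:
  assumes "\<And>i l. i < n \<Longrightarrow> l < n \<Longrightarrow> i \<noteq> l \<Longrightarrow> row_inner n (a i) (a l) = 0"
  shows "(cmod (cdet n a))\<^sup>2 = (\<Prod>i<n. row_norm2 n (a i))"
proof -
  have "cdet n a * cdet n (\<lambda>i j. cnj (a j i)) = cdet n (\<lambda>i j. row_inner n (a i) (a j))"
    unfolding cdet_mult row_inner_def ..
  also have "\<dots> = (\<Prod>i<n. row_inner n (a i) (a i))"
    by (rule cdet_diagonal) (rule assms)
  also have "cdet n (\<lambda>i j. cnj (a j i)) = cnj (cdet n a)"
    using cdet_cnj[of n "\<lambda>i j. a j i"] by (simp only: cdet_transpose[of n a])
  finally have "of_real ((cmod (cdet n a))\<^sup>2) = (of_real (\<Prod>i<n. row_norm2 n (a i)) :: complex)"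
    by (simp only: complex_norm_square row_inner_self of_real_prod)
  thus ?thesis unfolding of_real_eq_iff .
qed

text \<open>Gram-Schmidt without normalisation: adding multiples of earlier rows keeps the
  determinant, and subtracting a projection does not increase the norm. The rows may be dependent,
  so an earlier row of norm 0 is passed over; orthogonality to it is automatic.\<close>

lemma orthogonalize_row:
  assumes orth: "\<And>i l. i < k \<Longrightarrow> l < k \<Longrightarrow> i \<noteq> l \<Longrightarrow> row_inner n (a i) (a l) = 0" and "k < n" "m \<le> k"
  shows "\<exists>x. cdet n (a(k := x)) = cdet n a \<and> row_norm2 n x \<le> row_norm2 n (a k) \<and>
           (\<forall>l<m. row_inner n x (a l) = 0)"
  using \<open>m \<le> k\<close>
proof (induction m)
  case 0
  show ?case by (rule exI[of _ "a k"]) simp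
next
  case (Suc m)
  then obtain x where x: "cdet n (a(k := x)) = cdet n a" "row_norm2 n x \<le> row_norm2 n (a k)"
     "\<forall>l<m. row_inner n x (a l) = 0" by (meson Suc_leD)
  show ?case
  proof (cases "row_norm2 n (a m) = 0")
    case True
    hence "row_inner n x (a m) = 0" unfolding row_inner_def by (simp add: row_norm2_eq_0)
    with x show ?thesis by (intro exI[of _ x]) (auto simp: less_Suc_eq simp del: fun_upd_apply)
  next
    case False
    define c where "c = - row_inner n x (a m) / of_real (row_norm2 n (a m))"
    have eq: "a(k := \<lambda>j. x j + c * a m j)
        = (\<lambda>i j. if i = k then (a(k := x)) i j + c * (a(k := x)) m j else (a(k := x)) i j)"
      using Suc.prems by (auto simp: fun_eq_iff)
    have "cdet n (a(k := \<lambda>j. x j + c * a m j)) = cdet n (a(k := x))"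
      unfolding eq by (rule cdet_addrow) (use Suc.prems \<open>k < n\<close> in auto)
    moreover have "row_inner n (\<lambda>j. x j + c * a m j) (a l) = 0" if "l < Suc m" for l
    proof (cases "l = m")
      case True
      then show ?thesis using row_projection(1)[OF False, of x] by (simp add: c_def)
    next
      case False
      then show ?thesis using that x(3) orth[of m l] Suc.prems by (simp add: row_inner_add_left)
    qed
    ultimately show ?thesis using x row_projection(2)[OF False, of x]
      by (intro exI[of _ "\<lambda>j. x j + c * a m j"]) (auto simp: c_def simp del: fun_upd_apply)
  qed
qed

lemma orthogonalize_rows:
  assumes "k \<le> n"
  shows "\<exists>b. cdet n b = cdet n a \<and> (\<forall>i. row_norm2 n (b i) \<le> row_norm2 n (a i)) \<and>
     (\<forall>i<k. \<forall>l<k. i \<noteq> l \<longrightarrow> row_inner n (b i) (b l) = 0)"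
  using assms
proof (induction k)
  case 0
  show ?case by (rule exI[of _ a]) simp
next
  case (Suc k)
  then obtain b where b: "cdet n b = cdet n a" "\<And>i. row_norm2 n (b i) \<le> row_norm2 n (a i)"
    "\<And>i l. i < k \<Longrightarrow> l < k \<Longrightarrow> i \<noteq> l \<Longrightarrow> row_inner n (b i) (b l) = 0" by auto
  obtain x where x: "cdet n (b(k := x)) = cdet n b" "row_norm2 n x \<le> row_norm2 n (b k)"
     "\<And>l. l < k \<Longrightarrow> row_inner n x (b l) = 0"
    using orthogonalize_row[of k n b k] b(3) Suc.prems by auto
  have "row_inner n (b l) x = 0" if "l < k" for l
    using x(3)[OF that] by (simp add: row_inner_commute[of n "b l" x])
  thus ?case using b x order_trans[OF x(2) b(2)]
    by (intro exI[of _ "b(k := x)"]) (auto simp: less_Suc_eq simp del: fun_upd_apply, auto)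
qed

text \<open>Stated for columns although the orthogonalisation acts on rows: column \<open>j\<close>
  of the perturbation matrix is the part governed by \<open>s j\<close>, and Cramer's rule replaces
  a column.\<close>

theorem hadamard_inequality: "cmod (cdet n a) \<le> (\<Prod>j<n. sqrt (\<Sum>i<n. (cmod (a i j))\<^sup>2))"
proof -
  define a' where "a' i j = a j i" for i j
  obtain b where b: "cdet n b = cdet n a'" "\<And>i. row_norm2 n (b i) \<le> row_norm2 n (a' i)"
    "\<And>i l. i < n \<Longrightarrow> l < n \<Longrightarrow> i \<noteq> l \<Longrightarrow> row_inner n (b i) (b l) = 0"
    using orthogonalize_rows[of n n a'] by auto
  have "(cmod (cdet n a))\<^sup>2 = (\<Prod>i<n. row_norm2 n (b i))"
    using hadamard_rows_orthogonal[of n b] b cdet_transpose[of n a]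
    unfolding a'_def by metis
  also have "\<dots> \<le> (\<Prod>i<n. row_norm2 n (a' i))"
    by (rule prod_mono) (use b row_norm2_nonneg in auto)
  finally have "cmod (cdet n a) \<le> sqrt (\<Prod>i<n. row_norm2 n (a' i))"
    by (rule real_le_rsqrt)
  also have "sqrt (\<Prod>i\<in>I. row_norm2 n (a' i)) = (\<Prod>i\<in>I. sqrt (row_norm2 n (a' i)))" for I
    by (induction I rule: infinite_finite_induct) (auto simp: real_sqrt_mult)
  finally show ?thesis by (simp add: row_norm2_def a'_def)
qed

lemma mult_mat_vec_fun:
  "mat n n (\<lambda>(i, j). a i j) *\<^sub>v vec n c = vec n (\<lambda>i. \<Sum>j<n. a i j * c j)"
  by (intro eq_vecI) (auto simp: scalar_prod_def atLeast0LessThan)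

lemma cramer_rule:
  assumes "\<And>i. i < n \<Longrightarrow> (\<Sum>j<n. a i j * c j) = b i" "k < n"
  shows "c k * cdet n a = cdet n (\<lambda>i j. if j = k then b i else a i j)"
proof -
  define A where "A = mat n n (\<lambda>(i, j). a i j)"
  have "Determinant.det (replace_col A (A *\<^sub>v vec n c) k) = vec n c $ k * Determinant.det A"
    by (rule cramer_lemma_mat) (use assms in \<open>auto simp: A_def\<close>)
  moreover have "replace_col A (A *\<^sub>v vec n c) k = mat n n (\<lambda>(i, j). if j = k then b i else a i j)"
    unfolding A_def mult_mat_vec_fun
    by (intro eq_matI) (auto simp: replace_col_def assms)
  ultimately show ?thesis using assms(2) by (simp add: cdet_def A_def)
qed

lemma cdet_nonzero_solvable:
  assumes "cdet n a \<noteq> 0"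
  shows "\<exists>c. \<forall>i<n. (\<Sum>j<n. a i j * c j) = b i"
proof -
  define A where "A = mat n n (\<lambda>(i, j). a i j)"
  have A: "A \<in> carrier_mat n n" by (simp add: A_def)
  define w where "w = adj_mat A *\<^sub>v vec n b"
  have w: "w \<in> carrier_vec n" using adj_mat(1)[OF A] by (auto simp: w_def)
  have "A *\<^sub>v w = (A * adj_mat A) *\<^sub>v vec n b"
    unfolding w_def using A adj_mat(1)[OF A] by (metis assoc_mult_mat_vec vec_carrier)
  also have "\<dots> = (Determinant.det A \<cdot>\<^sub>m 1\<^sub>m n) *\<^sub>v vec n b" using adj_mat(2)[OF A] by simp
  finally have Aw: "A *\<^sub>v w = Determinant.det A \<cdot>\<^sub>v vec n b"
    by (intro eq_vecI) (auto simp: scalar_prod_def if_distrib[where f = "\<lambda>x. _ * x * _"] cong: if_cong)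
  have "(\<Sum>j<n. a i j * (inverse (cdet n a) * w $ j)) = b i" if "i < n" for i
  proof -
    have "(A *\<^sub>v w) $ i = (\<Sum>j<n. a i j * w $ j)"
      using that w by (auto simp: A_def scalar_prod_def atLeast0LessThan)
    hence "(\<Sum>j<n. a i j * w $ j) = cdet n a * b i"
      using that unfolding Aw by (simp add: cdet_def A_def)
    hence "inverse (cdet n a) * (\<Sum>j<n. a i j * w $ j) = b i" using assms by simp
    thus ?thesis by (simp only: sum_distrib_left mult.left_commute)
  qed
  thus ?thesis by (intro exI[of _ "\<lambda>j. inverse (cdet n a) * w $ j"]) simp
qed

lemma cdet_zero_kernel:
  assumes "cdet n a = 0"
  shows "\<exists>c. (\<exists>k<n. c k \<noteq> 0) \<and> (\<forall>i<n. (\<Sum>j<n. a i j * c j) = 0)"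
proof -
  define A where "A = mat n n (\<lambda>(i, j). a i j)"
  have A: "A \<in> carrier_mat n n" by (simp add: A_def)
  obtain w where w: "w \<in> carrier_vec n" "w \<noteq> 0\<^sub>v n" "A *\<^sub>v w = 0\<^sub>v n"
    using det_0_iff_vec_prod_zero_field[OF A] assms by (auto simp: cdet_def A_def)
  have "\<exists>k<n. w $ k \<noteq> 0" using w(1,2) by (metis carrier_vecD eq_vecI index_zero_vec)
  moreover have "(\<Sum>j<n. a i j * w $ j) = 0" if "i < n" for i
  proof -
    have "(A *\<^sub>v w) $ i = (\<Sum>j<n. a i j * w $ j)"
      using that w(1) by (auto simp: A_def scalar_prod_def atLeast0LessThan)
    thus ?thesis using that unfolding w(3) by simp
  qed
  ultimately show ?thesis by (intro exI[of _ "\<lambda>j. w $ j"]) simp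
qed

section \<open>A lower bound for holomorphic functions on circles\<close>

text \<open>A Borel--Caratheodory estimate: the Cayley transform of \<open>A - log (g z / g 0)\<close>, which has positive
  real part, is estimated by Schwarz's lemma.\<close>

lemma zero_free_lower_bound:
  assumes g: "g holomorphic_on ball 0 R" "\<And>z. z \<in> ball 0 R \<Longrightarrow> g z \<noteq> 0"
    and M: "\<And>z. z \<in> ball 0 R \<Longrightarrow> cmod (g z) \<le> M" and g0: "1 \<le> cmod (g 0)"
    and R: "0 < R" and z: "cmod z \<le> R / 2"
  shows "exp (- 2 - 2 * ln M) \<le> cmod (g z)"
proof -
  obtain L where L: "L holomorphic_on ball 0 R" "\<And>z. z \<in> ball 0 R \<Longrightarrow> exp (L z) = g z"
    using holomorphic_logarithm_exists[OF convex_ball open_ball g, of 0] R by auto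
  have M1: "1 \<le> M" using M[of 0] g0 R by auto
  have ReL: "Re (L z) = ln (cmod (g z))" if "z \<in> ball 0 R" for z
    by (simp add: L(2)[OF that, symmetric])
  \<comment> \<open>The summand 1 keeps the real part of \<open>u\<close> strictly positive even if
    \<open>M = 1\<close>.\<close>
  define A where "A = ln M + 1"
  have A: "0 < A" using M1 by (simp add: A_def add_nonneg_pos)
  define u where "u z = of_real A - (L z - L 0)" for z
  have Reu: "0 < Re (u z)" if "z \<in> ball 0 R" for z
  proof -
    have "ln (cmod (g z)) \<le> ln M" using M[OF that] g(2)[OF that] M1 by (subst ln_le_cancel_iff) auto
    moreover have "0 \<le> ln (cmod (g 0))" using g0 by simp
    ultimately show ?thesis using ReL[OF that] ReL[of 0] R by (simp add: u_def A_def)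
  qed
  have less: "cmod (u z - A) < cmod (u z + A)" if "z \<in> ball 0 R" for z
  proof (rule power2_less_imp_less)
    show "(cmod (u z - A))\<^sup>2 < (cmod (u z + A))\<^sup>2"
      using mult_pos_pos[OF A Reu[OF that]] unfolding cmod_power2 by (simp add: power2_eq_square algebra_simps)
  qed simp
  define q where "q w = (u (of_real R * w) - A) / (u (of_real R * w) + A)" for w
  have in_ball: "of_real R * w \<in> ball 0 R" if "cmod w < 1" for w
    using that R by (simp add: norm_mult)
  have q1: "cmod (q w) < 1" if "cmod w < 1" for w
  proof -
    have "0 < cmod (u (of_real R * w) + A)"
      using less[OF in_ball[OF that]] norm_ge_zero le_less_trans by blast
    thus ?thesis using less[OF in_ball[OF that]] by (simp add: q_def norm_divide)
  qed
  have nz: "u (of_real R * w) + A \<noteq> 0" if "cmod w < 1" for w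
    using less[OF in_ball[OF that]] by (metis norm_zero norm_ge_zero not_le)
  have "(\<lambda>w. complex_of_real R * w) ` ball 0 1 \<subseteq> ball 0 R" by (intro image_subsetI in_ball) simp
  hence "(\<lambda>w. L (of_real R * w)) holomorphic_on ball 0 1"
    using holomorphic_on_compose_gen[of "\<lambda>w. of_real R * w" "ball 0 1" L "ball 0 R"] L(1)
    by (auto simp: o_def intro!: holomorphic_intros)
  hence holq: "q holomorphic_on ball 0 1"
    unfolding q_def using nz by (intro holomorphic_intros) (auto simp: u_def intro!: holomorphic_intros)
  have q0: "q 0 = 0" by (simp add: q_def u_def)
  define w where "w = z / of_real R"
  have w: "cmod w \<le> 1 / 2" using z R by (simp add: w_def norm_divide field_simps)
  have Rw: "of_real R * w = z" using R by (simp add: w_def)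
  have w1: "cmod w < 1" using w by simp
  have "cmod (q w) \<le> cmod w" by (rule Schwarz_Lemma(1)[OF holq q0 q1 w1])
  hence "cmod (q w) \<le> 1 / 2" using w by simp
  moreover have "u z - A = q w * (u z + A)" using nz[OF w1] by (simp add: q_def Rw)
  ultimately have "cmod (u z - A) \<le> 1 / 2 * cmod (u z + A)"
    by (simp only: norm_mult) (intro mult_right_mono norm_ge_zero)
  moreover have "cmod (u z + A) \<le> cmod (u z) + A" using norm_triangle_ineq[of "u z" A] A by simp
  moreover have "cmod (u z) \<le> cmod (u z - A) + A" using norm_triangle_ineq[of "u z - A" A] A by simp
  \<comment> \<open>The constant 3 is (1 + 1/2) / (1 - 1/2), from Schwarz's bound at
    \<open>cmod w \<le> 1 / 2\<close>.\<close>
  ultimately have "cmod (u z) \<le> 3 * A" by simp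
  hence "Re (u z) \<le> 3 * A" using complex_Re_le_cmod[of "u z"] by linarith
  hence "- 2 * A \<le> Re (L z) - Re (L 0)" by (simp add: u_def)
  moreover have "0 \<le> Re (L 0)" using ReL[of 0] g0 R by simp
  ultimately have "- 2 - 2 * ln M \<le> Re (L z)" by (simp add: A_def)
  moreover have "z \<in> ball 0 R" using z R by simp
  ultimately show ?thesis using L(2)[of z] by (metis exp_le_cancel_iff norm_exp_eq_Re)
qed

text \<open>The modulus is 1 on the circle of radius \<open>R\<close> and \<open>cmod a / R\<close>
  at 0. For zeros with \<open>cmod a \<le> R / 2\<close> the latter is at most 1/2, on which the
  count of zeros rests.\<close>

definition blaschke :: "real \<Rightarrow> complex \<Rightarrow> complex \<Rightarrow> complex" where
  "blaschke R a z = of_real R * (z - a) / (of_real (R\<^sup>2) - cnj a * z)"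

text \<open>The induction terminates because each division by a Blaschke factor at least doubles the value
  at 0, while the bound \<open>M\<close> persists by the maximum principle.\<close>

lemma blaschke_factorization:
  assumes S: "open S" "cball 0 R \<subseteq> S" and R: "0 < R"
  shows "f holomorphic_on S \<Longrightarrow> (\<And>z. cmod z \<le> R \<Longrightarrow> cmod (f z) \<le> M) \<Longrightarrow> M < cmod (f 0) * 2 ^ d \<Longrightarrow>
    \<exists>as g. g holomorphic_on S \<and> (\<forall>z. cmod z \<le> R \<longrightarrow> cmod (g z) \<le> M) \<and>
      (\<forall>z. cmod z \<le> R / 2 \<longrightarrow> g z \<noteq> 0) \<and> (\<forall>a\<in>set as. cmod a \<le> R / 2) \<and>
      cmod (f 0) * 2 ^ length as \<le> cmod (g 0) \<and>
      (\<forall>z. cmod z \<le> R \<longrightarrow> f z = g z * (\<Prod>a\<leftarrow>as. blaschke R a z))"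
proof (induction d arbitrary: f)
  case 0
  with R have False by (metis linorder_not_less mult.right_neutral norm_zero order_less_imp_le power_0)
  thus ?case ..
next
  case (Suc d)
  show ?case
  proof (cases "\<forall>z. cmod z \<le> R / 2 \<longrightarrow> f z \<noteq> 0")
    case True
    with Suc.prems show ?thesis by (intro exI[of _ "[]"] exI[of _ f]) auto
  next
    case False
    then obtain a where a: "cmod a \<le> R / 2" "f a = 0" by blast
    have f0: "f 0 \<noteq> 0"
    proof
      assume "f 0 = 0"
      with Suc.prems(2)[of 0] Suc.prems(3) R show False by simp
    qed
    hence a0: "a \<noteq> 0" using a by auto
    define f1 where "f1 z = (if z = a then deriv f a else f z / (z - a))" for z
    have f1: "f1 holomorphic_on S"
      by (rule pole_theorem_open_0[OF Suc.prems(1) S(1), of a]) (auto simp: f1_def a)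
    define g where "g z = f1 z * (of_real (R\<^sup>2) - cnj a * z) / of_real R" for z
    have holg: "g holomorphic_on S" unfolding g_def using f1 R by (intro holomorphic_intros) auto
    have ff1: "f z = (z - a) * f1 z" for z using a by (simp add: f1_def)
    have den: "of_real (R\<^sup>2) - cnj a * z \<noteq> 0" if "cmod z \<le> R" for z
    proof
      assume "of_real (R\<^sup>2) - cnj a * z = 0"
      hence "cmod (cnj a * z) = R\<^sup>2" by (metis eq_iff_diff_eq_0 norm_of_real abs_of_nonneg zero_le_power2)
      moreover have "cmod (cnj a * z) \<le> R / 2 * R"
        unfolding norm_mult using a that R by (intro mult_mono) auto
      ultimately show False using R by (simp add: power2_eq_square)
    qed
    have fg: "f z = g z * blaschke R a z" if "cmod z \<le> R" for z
      using den[OF that] R by (simp add: ff1[of z] g_def blaschke_def)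
    have b1: "cmod (blaschke R a z) = 1" if "cmod z = R" for z
    proof -
      have zz: "z * cnj z = of_real (R\<^sup>2)" using that complex_norm_square[of z] by simp
      have "z * (cnj z - cnj a) = of_real (R\<^sup>2) - cnj a * z" using zz by (simp add: algebra_simps)
      hence "cmod (of_real (R\<^sup>2) - cnj a * z) = R * cmod (z - a)"
        by (metis complex_cnj_diff complex_mod_cnj norm_mult that)
      moreover have "z - a \<noteq> 0" using a that R by auto
      ultimately show ?thesis using R by (simp add: blaschke_def norm_divide norm_mult)
    qed
    have gM: "cmod (g z) \<le> M" if "cmod z \<le> R" for z
    proof (rule maximum_modulus_frontier[of g "cball 0 R"])
      show "g holomorphic_on interior (cball 0 R)"
        using holg S(2) interior_subset holomorphic_on_subset by (metis order_trans)
      show "continuous_on (closure (cball 0 R)) g"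
        using holomorphic_on_imp_continuous_on[OF holg] S(2) continuous_on_subset by auto
      fix w :: complex assume "w \<in> frontier (cball 0 R)"
      hence w: "cmod w = R" by (simp add: sphere_def R)
      have "cmod (f w) = cmod (g w)" using fg[of w] b1[OF w] w by (simp add: norm_mult)
      thus "cmod (g w) \<le> M" using Suc.prems(2)[of w] w by simp
    qed (use that in auto)
    have g0: "2 * cmod (f 0) \<le> cmod (g 0)"
    proof -
      have "cmod (f 0) = cmod a * cmod (f1 0)" by (simp add: ff1[of 0] norm_mult)
      moreover have "cmod (g 0) = cmod (f1 0) * R"
        using R by (simp add: g_def norm_mult norm_divide power2_eq_square)
      moreover have "2 * cmod a * cmod (f1 0) \<le> R * cmod (f1 0)" using a by (intro mult_right_mono) auto
      ultimately show ?thesis by (simp add: mult_ac)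
    qed
    have "M < cmod (g 0) * 2 ^ d"
    proof -
      have "M < 2 * cmod (f 0) * 2 ^ d" using Suc.prems(3) by simp
      also have "\<dots> \<le> cmod (g 0) * 2 ^ d" by (intro mult_right_mono g0) simp
      finally show ?thesis .
    qed
    from Suc.IH[OF holg gM this] obtain as h where h: "h holomorphic_on S" "\<And>z. cmod z \<le> R \<Longrightarrow> cmod (h z) \<le> M"
      "\<And>z. cmod z \<le> R / 2 \<Longrightarrow> h z \<noteq> 0" "\<forall>a\<in>set as. cmod a \<le> R / 2" "cmod (g 0) * 2 ^ length as \<le> cmod (h 0)"
      "\<And>z. cmod z \<le> R \<Longrightarrow> g z = h z * (\<Prod>a\<leftarrow>as. blaschke R a z)" by blast
    have "cmod (f 0) * 2 ^ length (a # as) = 2 * cmod (f 0) * 2 ^ length as" by simp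
    also have "\<dots> \<le> cmod (g 0) * 2 ^ length as" by (intro mult_right_mono g0) simp
    also note h(5)
    finally show ?thesis using h a fg by (intro exI[of _ "a # as"] exI[of _ h]) auto
  qed
qed

text \<open>Controls the main term of the primitive \<open>x * ln \<bar>x\<bar> - x\<close> of
  \<open>ln \<bar>x\<bar>\<close> at the end points of the interval of radii.\<close>

lemma abs_mult_ln_le: "\<bar>x * ln \<bar>x\<bar>\<bar> \<le> 1 + x\<^sup>2" for x :: real
proof (cases "x = 0")
  case False
  define y where "y = \<bar>x\<bar>"
  have y: "0 < y" using False by (simp add: y_def)
  have "ln y \<le> y" using ln_le_minus_one[OF y] by simp
  hence 1: "y * ln y \<le> y * y" using y by (intro mult_left_mono) auto
  have "ln (1 / y) \<le> 1 / y" using ln_le_minus_one[of "1 / y"] y by simp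
  hence "y * ln (1 / y) \<le> y * (1 / y)" using y by (intro mult_left_mono) auto
  hence 2: "- (y * ln y) \<le> 1" using y by (simp add: ln_div)
  have "0 \<le> y * y" by simp
  with 1 2 have "\<bar>y * ln y\<bar> \<le> 1 + y * y" by linarith
  moreover have "\<bar>x * ln \<bar>x\<bar>\<bar> = \<bar>y * ln y\<bar>" by (simp add: y_def abs_mult)
  moreover have "x\<^sup>2 = y * y" by (simp add: y_def power2_eq_square)
  ultimately show ?thesis by simp
qed simp

text \<open>Continuity at 0 permits the fundamental theorem of calculus across the singularities of
  the logarithm. Near 0, \<open>w = sqrt \<bar>y\<bar>\<close> turns the product into
  \<open>2 * (w * w * ln w)\<close> up to sign, which is at most \<open>2 * w\<close> in absolute
  value.\<close>

lemma continuous_on_mult_ln: "continuous_on UNIV (\<lambda>x::real. x * ln \<bar>x\<bar>)"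
  unfolding continuous_on_eq_continuous_at[OF open_UNIV]
proof
  fix x :: real
  show "isCont (\<lambda>x. x * ln \<bar>x\<bar>) x"
  proof (cases "x = 0")
    case False
    thus ?thesis by (intro continuous_intros) auto
  next
    case True
    have "((\<lambda>x. x * ln \<bar>x\<bar>) \<longlongrightarrow> 0) (at (0::real))"
    proof (rule Lim_null_comparison)
      have "\<bar>y * ln \<bar>y\<bar>\<bar> \<le> 2 * sqrt \<bar>y\<bar>" if "\<bar>y\<bar> < 1" for y :: real
      proof (cases "y = 0")
        case False
        define w where "w = sqrt \<bar>y\<bar>"
        have w: "0 < w" "w \<le> 1" "\<bar>y\<bar> = w * w" using False that by (auto simp: w_def)
        have "ln (1 / w) \<le> 1 / w" using ln_le_minus_one[of "1 / w"] w by simp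
        hence "w * w * ln (1 / w) \<le> w * w * (1 / w)" using w by (intro mult_left_mono) auto
        hence "- (w * w * ln w) \<le> w" using w by (simp add: ln_div)
        moreover have "ln w \<le> 0" using w by simp
        hence "w * w * ln w \<le> 0" by (intro mult_nonneg_nonpos) auto
        moreover have "\<bar>y * ln \<bar>y\<bar>\<bar> = \<bar>\<bar>y\<bar> * ln \<bar>y\<bar>\<bar>" by (simp add: abs_mult)
        moreover have "\<bar>y\<bar> * ln \<bar>y\<bar> = 2 * (w * w * ln w)"
          using w by (simp add: ln_mult)
        ultimately have "\<bar>y * ln \<bar>y\<bar>\<bar> \<le> 2 * w" by linarith
        thus ?thesis unfolding w_def .
      qed simp
      thus "\<forall>\<^sub>F y in at 0. norm (y * ln \<bar>y\<bar>) \<le> 2 * sqrt \<bar>y\<bar>"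
        unfolding eventually_at by (intro exI[of _ 1]) auto
      have "((\<lambda>y. 2 * sqrt \<bar>y\<bar>) \<longlongrightarrow> 2 * sqrt \<bar>0\<bar>) (at (0::real))"
        by (intro tendsto_intros)
      thus "((\<lambda>y. 2 * sqrt \<bar>y\<bar>) \<longlongrightarrow> 0) (at (0::real))" by simp
    qed
    thus ?thesis using True by (simp add: isCont_def)
  qed
qed

text \<open>The mean of \<open>ln \<bar>r - x\<bar>\<close> over \<open>1 \<le> r \<le> 2\<close> is bounded below uniformly in \<open>x\<close>.\<close>

lemma log_average:
  fixes xs :: "real list"
  assumes "\<And>x. x \<in> set xs \<Longrightarrow> 0 \<le> x \<and> x \<le> 4"
  shows "\<exists>r. 1 \<le> r \<and> r \<le> 2 \<and> r \<notin> set xs \<and> - 22 * real (length xs) \<le> (\<Sum>x\<leftarrow>xs. ln \<bar>r - x\<bar>)"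
proof (rule ccontr)
  assume "\<not> ?thesis"
  hence neg: "(\<Sum>x\<leftarrow>xs. ln \<bar>r - x\<bar>) < - 22 * real (length xs)" if "1 \<le> r" "r \<le> 2" "r \<notin> set xs" for r
    using that by force
  have "xs \<noteq> []" using neg[of 1] by auto
  define G where "G r = (\<Sum>x\<leftarrow>xs. (r - x) * ln \<bar>r - x\<bar> - (r - x))" for r
  have G': "(G has_vector_derivative (\<Sum>x\<leftarrow>xs. ln \<bar>r - x\<bar>)) (at r)" if "r \<notin> set xs" for r
    using that unfolding G_def
  proof (induction xs)
    case (Cons x xs)
    have "((\<lambda>r. (r - x) * ln \<bar>r - x\<bar> - (r - x)) has_real_derivative ln \<bar>r - x\<bar>) (at r)"
    proof (cases "x < r")
      case True
      have "((\<lambda>r. (r - x) * ln (r - x) - (r - x)) has_real_derivative ln \<bar>r - x\<bar>) (at r)"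
        using True by (auto intro!: derivative_eq_intros)
      thus ?thesis
        by (rule has_field_derivative_transform_within_open[of _ _ _ "{x<..}"]) (use True in auto)
    next
      case False
      hence "r < x" using Cons.prems by auto
      have "((\<lambda>r. (r - x) * ln (x - r) - (r - x)) has_real_derivative ln \<bar>r - x\<bar>) (at r)"
        using \<open>r < x\<close> by (auto intro!: derivative_eq_intros simp: divide_simps)
      thus ?thesis
        by (rule has_field_derivative_transform_within_open[of _ _ _ "{..<x}"]) (use \<open>r < x\<close> in auto)
    qed
    thus ?case using Cons by (auto intro!: derivative_intros simp: has_real_derivative_iff_has_vector_derivative)
  qed simp
  have contG: "continuous_on {1..2} G"
    unfolding G_def
  proof (induction xs)
    case (Cons x xs)
    have "continuous_on {1..2} (\<lambda>r. (r - x) * ln \<bar>r - x\<bar>)"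
      by (rule continuous_on_compose2[OF continuous_on_mult_ln, of "{1..2}" "\<lambda>r. r - x"]) (auto intro: continuous_intros)
    thus ?case using Cons by (auto intro!: continuous_intros)
  qed simp
  have int: "((\<lambda>r. \<Sum>x\<leftarrow>xs. ln \<bar>r - x\<bar>) has_integral (G 2 - G 1)) {1..2}"
    by (rule fundamental_theorem_of_calculus_strong[of "set xs"]) (use G' contG in auto)
  define F where "F r = (if r \<in> set xs then - 22 * real (length xs) else \<Sum>x\<leftarrow>xs. ln \<bar>r - x\<bar>)" for r
  have "(F has_integral (G 2 - G 1)) {1..2}"
    by (rule has_integral_spike_finite[OF _ _ int, of "set xs"]) (auto simp: F_def)
  moreover have "((\<lambda>r. - 22 * real (length xs)) has_integral (- 22 * real (length xs)) * (2 - 1)) {1..2::real}"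
    using has_integral_const_real[of "- 22 * real (length xs)" 1 2] by simp
  ultimately have "G 2 - G 1 \<le> (- 22 * real (length xs)) * (2 - 1)"
    by (rule has_integral_le) (use neg in \<open>auto simp: F_def intro: less_imp_le\<close>)
  hence "G 2 - G 1 \<le> - 22 * real (length xs)" by simp
  \<comment> \<open>By \<open>abs_mult_ln_le\<close> each entry contributes at least
    \<open>- 5 - 10 - 1\<close>, so 18 is generous; the strict gap to 22 gives the
    contradiction.\<close>
  moreover have "- 18 * real (length xs) \<le> G 2 - G 1"
    using assms unfolding G_def
  proof (induction xs)
    case (Cons x xs)
    have x: "0 \<le> x" "x \<le> 4" using Cons.prems by auto
    have "(2 - x)\<^sup>2 \<le> 2\<^sup>2" "(1 - x)\<^sup>2 \<le> 3\<^sup>2"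
      using x power_mono[of "\<bar>2 - x\<bar>" 2 2] power_mono[of "\<bar>1 - x\<bar>" 3 2] by simp_all
    hence "- 18 \<le> ((2 - x) * ln \<bar>2 - x\<bar> - (2 - x)) - ((1 - x) * ln \<bar>1 - x\<bar> - (1 - x))"
      using abs_mult_ln_le[of "2 - x"] abs_mult_ln_le[of "1 - x"] by (simp add: abs_le_iff)
    thus ?case using Cons by (simp add: algebra_simps)
  qed simp
  moreover have "0 < real (length xs)" using \<open>xs \<noteq> []\<close> by simp
  ultimately show False by linarith
qed

text \<open>A minimum modulus theorem with explicit constants. In the disc of radius
  \<open>8 * \<rho>\<close> the zeros of modulus at most \<open>4 * \<rho>\<close> are split off as
  Blaschke factors; the remaining factor falls under the zero-free estimate for
  \<open>cmod z \<le> 2 * \<rho>\<close>, and the Blaschke product is handled by an averaged choice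
  of the radius. Since each zero at least doubles the value at 0, there are at most
  \<open>2 * ln M\<close> of them.\<close>

theorem circle_lower_bound:
  assumes D: "D holomorphic_on ball 0 R'" "8 * \<rho> < R'" "D 0 = 1" and \<rho>: "0 < \<rho>"
    and M: "\<And>z. cmod z \<le> 8 * \<rho> \<Longrightarrow> cmod (D z) \<le> M"
  shows "\<exists>\<rho>'. \<rho> \<le> \<rho>' \<and> \<rho>' \<le> 2 * \<rho> \<and> (\<forall>z. cmod z = \<rho>' \<longrightarrow> exp (- 2 - 54 * ln M) \<le> cmod (D z))"
proof -
  define R where "R = 8 * \<rho>"
  have R: "0 < R" using \<rho> by (simp add: R_def)
  have M1: "1 \<le> M" using M[of 0] D(3) \<rho> by simp
  obtain d :: nat where "M < 2 ^ d" using real_arch_pow[of 2 M] by auto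
  hence "M < cmod (D 0) * 2 ^ d" using D by simp
  moreover have sub: "cball 0 R \<subseteq> ball 0 R'" using D(2) by (auto simp: R_def)
  ultimately obtain as g where "g holomorphic_on ball 0 R' \<and> (\<forall>z. cmod z \<le> R \<longrightarrow> cmod (g z) \<le> M) \<and>
      (\<forall>z. cmod z \<le> R / 2 \<longrightarrow> g z \<noteq> 0) \<and> (\<forall>a\<in>set as. cmod a \<le> R / 2) \<and>
      cmod (D 0) * 2 ^ length as \<le> cmod (g 0) \<and>
      (\<forall>z. cmod z \<le> R \<longrightarrow> D z = g z * (\<Prod>a\<leftarrow>as. blaschke R a z))"
    using blaschke_factorization[OF open_ball sub R D(1) M[folded R_def], of d] by blast
  hence g: "g holomorphic_on ball 0 R'" "\<And>z. cmod z \<le> R \<Longrightarrow> cmod (g z) \<le> M"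
      "\<And>z. cmod z \<le> R / 2 \<Longrightarrow> g z \<noteq> 0" "\<And>a. a \<in> set as \<Longrightarrow> cmod a \<le> R / 2" "2 ^ length as \<le> cmod (g 0)"
      "\<And>z. cmod z \<le> R \<Longrightarrow> D z = g z * (\<Prod>a\<leftarrow>as. blaschke R a z)"
    by (simp_all add: D(3))
  define n where "n = length as"
  define xs where "xs = map (\<lambda>a. cmod a / \<rho>) as"
  have "0 \<le> x \<and> x \<le> 4" if "x \<in> set xs" for x
    using that g(4) \<rho> by (auto simp: xs_def R_def field_simps)
  then obtain r where r: "1 \<le> r" "r \<le> 2" "r \<notin> set xs" "- 22 * real n \<le> (\<Sum>x\<leftarrow>xs. ln \<bar>r - x\<bar>)"
    using log_average[of xs] by (auto simp: xs_def n_def)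
  have "2 ^ n \<le> M" using g(5) g(2)[of 0] R by (simp add: n_def)
  hence "ln (2 ^ n) \<le> ln M" using M1 by (subst ln_le_cancel_iff) auto
  hence "real n * ln 2 \<le> ln M" by (simp add: ln_realpow)
  moreover have "real n * (1 / 2) \<le> real n * ln 2" using ln2_ge_two_thirds by (intro mult_left_mono) auto
  ultimately have n: "real n \<le> 2 * ln M" by linarith
  \<comment> \<open>Of the 26 per zero, 22 come from \<open>log_average\<close> and 4 from the
    factor \<open>1 / 16 \<ge> exp (- 4)\<close>. That factor is \<open>\<rho> / (2 * R)\<close>,
    where \<open>2 * R^2\<close> bounds the denominator of a Blaschke factor.\<close>
  have prod: "exp (- 26 * real n) \<le> cmod (\<Prod>a\<leftarrow>as. blaschke R a z)" if z: "cmod z = r * \<rho>" for z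
  proof -
    have z2: "cmod z \<le> 2 * \<rho>" using z r \<rho> by simp
    have b: "\<bar>r - cmod a / \<rho>\<bar> / 16 \<le> cmod (blaschke R a z)" if "a \<in> set as" for a
    proof -
      have "cmod (cnj a * z) \<le> R / 2 * (2 * \<rho>)"
        unfolding norm_mult complex_mod_cnj using g(4)[OF that] z2 R by (intro mult_mono) auto
      also have "\<dots> = R\<^sup>2 / 8" by (simp add: R_def power2_eq_square)
      also have "\<dots> \<le> R\<^sup>2 / 2" by simp
      finally have az: "cmod (cnj a * z) \<le> R\<^sup>2 / 2" .
      have ne: "of_real (R\<^sup>2) - cnj a * z \<noteq> 0"
      proof
        assume "of_real (R\<^sup>2) - cnj a * z = 0"
        hence "cmod (cnj a * z) = R\<^sup>2" by (metis eq_iff_diff_eq_0 norm_of_real abs_of_nonneg zero_le_power2)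
        with az R show False by simp
      qed
      have le: "cmod (of_real (R\<^sup>2) - cnj a * z) \<le> 2 * R\<^sup>2"
      proof -
        have "cmod (of_real (R\<^sup>2)) = R\<^sup>2" by (simp only: norm_of_real abs_power2)
        moreover have "0 \<le> R\<^sup>2" by simp
        ultimately show ?thesis
          using norm_triangle_ineq4[of "of_real (R\<^sup>2)" "cnj a * z"] az by linarith
      qed
      have "\<bar>r - cmod a / \<rho>\<bar> / 16 = \<bar>cmod z - cmod a\<bar> / (16 * \<rho>)"
        using \<rho> by (simp add: z field_simps abs_mult flip: abs_divide) (simp add: abs_if field_simps)
      also have "\<dots> \<le> cmod (z - a) / (16 * \<rho>)"
        using \<rho> norm_triangle_ineq3[of z a] by (intro divide_right_mono) auto
      also have "\<dots> = R * cmod (z - a) / (2 * R\<^sup>2)" using \<rho> by (simp add: R_def power2_eq_square)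
      also have "\<dots> \<le> R * cmod (z - a) / cmod (of_real (R\<^sup>2) - cnj a * z)"
        using le ne R by (intro divide_left_mono) auto
      also have "\<dots> = cmod (blaschke R a z)" using R by (simp add: blaschke_def norm_divide norm_mult)
      finally show ?thesis .
    qed
    have exp16: "exp (- 4) \<le> (1 / 16 :: real)"
    proof -
      have "(2::real) ^ 4 \<le> exp 1 ^ 4" using exp_ge_add_one_self[of 1] by (intro power_mono) auto
      also have "exp 1 ^ 4 = exp (4::real)" by (simp flip: exp_of_nat_mult)
      finally show ?thesis by (simp add: exp_minus field_simps)
    qed
    have "exp ((\<Sum>x\<leftarrow>map (\<lambda>a. cmod a / \<rho>) bs. ln \<bar>r - x\<bar>) - 4 * real (length bs)) \<le> cmod (\<Prod>a\<leftarrow>bs. blaschke R a z)"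
      if "set bs \<subseteq> set as" for bs
      using that
    proof (induction bs)
      case (Cons a bs)
      have "r \<noteq> cmod a / \<rho>" using r(3) Cons.prems by (auto simp: xs_def)
      hence pos: "0 < \<bar>r - cmod a / \<rho>\<bar>" by simp
      have "exp ((\<Sum>x\<leftarrow>map (\<lambda>a. cmod a / \<rho>) (a # bs). ln \<bar>r - x\<bar>) - 4 * real (length (a # bs)))
         = (\<bar>r - cmod a / \<rho>\<bar> * exp (- 4)) * exp ((\<Sum>x\<leftarrow>map (\<lambda>a. cmod a / \<rho>) bs. ln \<bar>r - x\<bar>) - 4 * real (length bs))"
      proof -
        have "(\<Sum>x\<leftarrow>map (\<lambda>a. cmod a / \<rho>) (a # bs). ln \<bar>r - x\<bar>) - 4 * real (length (a # bs))
          = ln \<bar>r - cmod a / \<rho>\<bar> + - 4 + ((\<Sum>x\<leftarrow>map (\<lambda>a. cmod a / \<rho>) bs. ln \<bar>r - x\<bar>) - 4 * real (length bs))"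
          by simp
        thus ?thesis by (simp only: exp_add exp_ln[OF pos])
      qed
      also have "\<dots> \<le> (\<bar>r - cmod a / \<rho>\<bar> / 16) * cmod (\<Prod>a\<leftarrow>bs. blaschke R a z)"
        using mult_left_mono[OF exp16, of "\<bar>r - cmod a / \<rho>\<bar>"] Cons by (intro mult_mono) auto
      also have "\<dots> \<le> cmod (blaschke R a z) * cmod (\<Prod>a\<leftarrow>bs. blaschke R a z)"
        by (intro mult_right_mono b) (use Cons.prems in auto)
      finally show ?case by (simp add: norm_mult)
    qed simp
    from this[of as] have "exp ((\<Sum>x\<leftarrow>xs. ln \<bar>r - x\<bar>) - 4 * real n) \<le> cmod (\<Prod>a\<leftarrow>as. blaschke R a z)"
      by (simp add: xs_def n_def)
    moreover have "exp (- 26 * real n) \<le> exp ((\<Sum>x\<leftarrow>xs. ln \<bar>r - x\<bar>) - 4 * real n)" using r(4) by simp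
    ultimately show ?thesis by linarith
  qed
  show ?thesis
  proof (intro exI[of _ "r * \<rho>"] conjI allI impI)
    show "\<rho> \<le> r * \<rho>" "r * \<rho> \<le> 2 * \<rho>" using r \<rho> by simp_all
    fix z assume z: "cmod z = r * \<rho>"
    have "(1::real) \<le> 2 ^ length as" by simp
    hence g0: "1 \<le> cmod (g 0)" using g(5) by linarith
    have zR: "cmod z \<le> R / 2 / 2" "cmod z \<le> R" using z r \<rho> by (auto simp: R_def)
    have "exp (- 2 - 2 * ln M) \<le> cmod (g z)"
    proof (rule zero_free_lower_bound[of g "R / 2"])
      show "g holomorphic_on ball 0 (R / 2)"
        by (rule holomorphic_on_subset[OF g(1)]) (use R D(2) in \<open>auto simp: R_def\<close>)
    qed (use g R g0 zR in auto)
    moreover have "exp (- 26 * (2 * ln M)) \<le> exp (- 26 * real n)" using n by simp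
    hence "exp (- 26 * (2 * ln M)) \<le> cmod (\<Prod>a\<leftarrow>as. blaschke R a z)" using prod[OF z] by linarith
    ultimately have "exp (- 2 - 2 * ln M) * exp (- 26 * (2 * ln M)) \<le> cmod (g z) * cmod (\<Prod>a\<leftarrow>as. blaschke R a z)"
      by (intro mult_mono) auto
    \<comment> \<open>54 = 2 + 26 * 2, by the bound \<open>2 * ln M\<close> on the number of
      zeros.\<close>
    moreover have "exp (- 2 - 2 * ln M) * exp (- 26 * (2 * ln M)) = exp (- 2 - 54 * ln M)"
      unfolding exp_add[symmetric] by (rule arg_cong[of _ _ exp]) simp
    ultimately show "exp (- 2 - 54 * ln M) \<le> cmod (D z)"
      unfolding g(6)[OF zR(2)] norm_mult by linarith
  qed
qed

section \<open>Resolvents\<close>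

text \<open>\<open>inv\<close> is the inverse of a function, so the value is meaningful only where
  \<open>regular A z\<close> holds. Written out, it is the expression in the integrand of the
  theorem; the competing group-theoretic syntax for \<open>inv\<close> is switched off for this
  reason.\<close>

definition resolvent_op :: "('a::chilbert_space \<Rightarrow> 'a) \<Rightarrow> complex \<Rightarrow> 'a \<Rightarrow> 'a" where
  "resolvent_op A z = inv (\<lambda>x. x - z *\<^sub>C A x)"

definition regular :: "('a::chilbert_space \<Rightarrow> 'a) \<Rightarrow> complex \<Rightarrow> bool" where
  "regular A z \<longleftrightarrow> surj (\<lambda>x. x - z *\<^sub>C A x) \<and> (\<exists>C. \<forall>x. norm x \<le> C * norm (x - z *\<^sub>C A x))"

context
  fixes A :: "'a::chilbert_space \<Rightarrow> 'a"
  assumes A: "cbounded_linear A"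
begin

lemma regular_inj:
  assumes "regular A z" "x - z *\<^sub>C A x = y - z *\<^sub>C A y"
  shows "x = y"
proof -
  obtain C where "norm (x - y) \<le> C * norm ((x - y) - z *\<^sub>C A (x - y))"
    using assms(1) unfolding regular_def by blast
  moreover have "(x - y) - z *\<^sub>C A (x - y) = 0"
    using assms(2) by (simp add: cbounded_linear_simps[OF A] scaleC.diff_right algebra_simps)
  ultimately show ?thesis by simp
qed

lemma resolvent_op_eq:
  assumes "regular A z"
  shows "resolvent_op A z f - z *\<^sub>C A (resolvent_op A z f) = f"
  using assms surj_f_inv_f[of "\<lambda>x. x - z *\<^sub>C A x" f] by (simp add: regular_def resolvent_op_def)

lemma resolvent_op_unique:
  assumes "regular A z" "x - z *\<^sub>C A x = f"
  shows "resolvent_op A z f = x"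
  by (rule regular_inj[OF assms(1)]) (simp add: resolvent_op_eq assms)

lemma resolvent_op_bound:
  assumes "regular A z"
  obtains C where "0 < C" "\<And>f. norm (resolvent_op A z f) \<le> C * norm f"
proof -
  obtain C where C: "\<And>x. norm x \<le> C * norm (x - z *\<^sub>C A x)" using assms unfolding regular_def by blast
  show ?thesis
  proof (rule that[of "\<bar>C\<bar> + 1"])
    fix f
    have "norm (resolvent_op A z f) \<le> C * norm f"
      using C[of "resolvent_op A z f"] by (simp add: resolvent_op_eq assms)
    also have "\<dots> \<le> (\<bar>C\<bar> + 1) * norm f" by (intro mult_right_mono) auto
    finally show "norm (resolvent_op A z f) \<le> (\<bar>C\<bar> + 1) * norm f" .
  qed simp
qed

lemma cbounded_linear_resolvent_op:
  assumes "regular A z"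
  shows "cbounded_linear (resolvent_op A z)"
proof -
  obtain C where C: "0 < C" "\<And>f. norm (resolvent_op A z f) \<le> C * norm f"
    using resolvent_op_bound[OF assms] by blast
  note eq = resolvent_op_eq[OF assms]
  show ?thesis
  proof (rule cbounded_linearI[OF _ _ C(2)])
    show "resolvent_op A z (x + y) = resolvent_op A z x + resolvent_op A z y" for x y
    proof (rule resolvent_op_unique[OF assms])
      have "resolvent_op A z x + resolvent_op A z y - z *\<^sub>C A (resolvent_op A z x + resolvent_op A z y)
        = (resolvent_op A z x - z *\<^sub>C A (resolvent_op A z x)) + (resolvent_op A z y - z *\<^sub>C A (resolvent_op A z y))"
        by (simp add: cbounded_linear_simps[OF A] scaleC_add_right)
      thus "resolvent_op A z x + resolvent_op A z y - z *\<^sub>C A (resolvent_op A z x + resolvent_op A z y) = x + y"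
        by (simp only: eq)
    qed
    show "resolvent_op A z (a *\<^sub>C x) = a *\<^sub>C resolvent_op A z x" for a x
    proof (rule resolvent_op_unique[OF assms])
      have "a *\<^sub>C resolvent_op A z x - z *\<^sub>C A (a *\<^sub>C resolvent_op A z x) = a *\<^sub>C (resolvent_op A z x - z *\<^sub>C A (resolvent_op A z x))"
        by (simp add: cbounded_linear_simps[OF A] scaleC.diff_right scaleC_scaleC mult.commute)
      thus "a *\<^sub>C resolvent_op A z x - z *\<^sub>C A (a *\<^sub>C resolvent_op A z x) = a *\<^sub>C x" by (simp only: eq)
    qed
  qed
qed

lemma resolvent_identity:
  assumes "regular A z" "regular A w"
  shows "resolvent_op A z f - resolvent_op A w f = (z - w) *\<^sub>C resolvent_op A z (A (resolvent_op A w f))"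
proof -
  let ?r = "resolvent_op A w f"
  have "resolvent_op A z (f - (z - w) *\<^sub>C A ?r) = ?r"
  proof (rule resolvent_op_unique[OF assms(1)])
    show "?r - z *\<^sub>C A ?r = f - (z - w) *\<^sub>C A ?r"
      using resolvent_op_eq[OF assms(2), of f] by (simp add: scaleC.diff_left algebra_simps)
  qed
  thus ?thesis
    by (simp add: cbounded_linear_simps[OF cbounded_linear_resolvent_op[OF assms(1)]] algebra_simps)
qed

text \<open>For \<open>cmod (z - w)\<close> below \<open>1 / (2 * C * K)\<close> the term
  \<open>(z - w) *\<^sub>C A x\<close> is absorbed into the left side at the cost of a factor
  2.\<close>

lemma resolvent_op_locally_bounded:
  assumes "regular A w"
  obtains C d where "0 < C" "0 < d" "\<And>z f. regular A z \<Longrightarrow> cmod (z - w) < d \<Longrightarrow> norm (resolvent_op A z f) \<le> C * norm f"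
proof -
  obtain K where K: "0 < K" "\<And>x. norm (A x) \<le> K * norm x" using cbounded_linear_bound A by blast
  obtain C where C: "0 < C" "\<And>f. norm (resolvent_op A w f) \<le> C * norm f"
    using resolvent_op_bound[OF assms] by blast
  show ?thesis
  proof (rule that[of "2 * C" "1 / (2 * C * K)"])
    fix z f assume z: "regular A z" "cmod (z - w) < 1 / (2 * C * K)"
    define x where "x = resolvent_op A z f"
    have "x - z *\<^sub>C A x = f" unfolding x_def by (rule resolvent_op_eq[OF z(1)])
    hence "x - w *\<^sub>C A x = f + (z - w) *\<^sub>C A x" by (simp add: scaleC.diff_left algebra_simps)
    hence "x = resolvent_op A w (f + (z - w) *\<^sub>C A x)" using resolvent_op_unique[OF assms] by metis
    hence "norm x \<le> C * norm (f + (z - w) *\<^sub>C A x)" using C(2) by metis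
    also have "\<dots> \<le> C * (norm f + cmod (z - w) * (K * norm x))"
      using C K(2)[of x] by (intro mult_left_mono order_trans[OF norm_triangle_ineq] add_left_mono)
        (auto intro: mult_left_mono)
    also have "\<dots> = C * norm f + (cmod (z - w) * (2 * C * K)) * (norm x / 2)" by (simp add: algebra_simps)
    also have "\<dots> \<le> C * norm f + 1 * (norm x / 2)"
      using z(2) C K by (intro add_left_mono mult_right_mono) (auto simp: field_simps)
    finally show "norm (resolvent_op A z f) \<le> 2 * C * norm f" by (simp add: x_def)
  qed (use C K in auto)
qed

lemma resolvent_op_tendsto:
  assumes S: "\<And>z. z \<in> S \<Longrightarrow> regular A z" and w: "w \<in> S"
  shows "((\<lambda>z. resolvent_op A z f) \<longlongrightarrow> resolvent_op A w f) (at w within S)"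
proof -
  obtain C d where C: "0 < C" "0 < d" "\<And>z f. regular A z \<Longrightarrow> cmod (z - w) < d \<Longrightarrow> norm (resolvent_op A z f) \<le> C * norm f"
    using resolvent_op_locally_bounded S w by blast
  have ev: "\<forall>\<^sub>F z in at w within S. norm (resolvent_op A z f - resolvent_op A w f)
      \<le> cmod (z - w) * (C * norm (A (resolvent_op A w f)))"
    unfolding eventually_at
  proof (intro exI[of _ d] conjI ballI impI)
    fix z assume "z \<in> S" "z \<noteq> w \<and> dist z w < d"
    thus "norm (resolvent_op A z f - resolvent_op A w f) \<le> cmod (z - w) * (C * norm (A (resolvent_op A w f)))"
      unfolding resolvent_identity[OF S[OF \<open>z \<in> S\<close>] S[OF w]] norm_scaleC
      using C(3)[OF S[OF \<open>z \<in> S\<close>]] by (intro mult_left_mono) (auto simp: dist_norm)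
  qed (use C in simp)
  have "((\<lambda>z. cmod (z - w) * (C * norm (A (resolvent_op A w f)))) \<longlongrightarrow> cmod (w - w) * (C * norm (A (resolvent_op A w f)))) (at w within S)"
    by (intro tendsto_intros)
  hence lim: "((\<lambda>z. cmod (z - w) * (C * norm (A (resolvent_op A w f)))) \<longlongrightarrow> 0) (at w within S)" by simp
  show ?thesis by (rule LIM_zero_cancel, rule Lim_null_comparison[OF ev lim])
qed

lemma continuous_on_resolvent_op:
  assumes "\<And>z. z \<in> S \<Longrightarrow> regular A z"
  shows "continuous_on S (\<lambda>z. resolvent_op A z f)"
  unfolding continuous_on_def using resolvent_op_tendsto[of S] assms by blast

text \<open>The resolvent identity turns the difference quotient into the resolvent at
  \<open>z\<close> applied to a fixed vector, and strong continuity gives its limit. The derivative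
  is taken within \<open>S\<close>, which may be closed.\<close>

lemma holomorphic_on_resolvent_op:
  assumes S: "\<And>z. z \<in> S \<Longrightarrow> regular A z"
  shows "(\<lambda>z. cinner (resolvent_op A z f) y) holomorphic_on S"
proof -
  have "((\<lambda>z. cinner (resolvent_op A z f) y) has_field_derivative
      cinner (resolvent_op A w (A (resolvent_op A w f))) y) (at w within S)" if w: "w \<in> S" for w
    unfolding has_field_derivative_iff
  proof (rule tendsto_cong[THEN iffD1])
    show "((\<lambda>z. cinner (resolvent_op A z (A (resolvent_op A w f))) y) \<longlongrightarrow>
       cinner (resolvent_op A w (A (resolvent_op A w f))) y) (at w within S)"
      by (intro cinner.tendsto resolvent_op_tendsto S w tendsto_const)
    show "\<forall>\<^sub>F z in at w within S. cinner (resolvent_op A z (A (resolvent_op A w f))) y =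
       (cinner (resolvent_op A z f) y - cinner (resolvent_op A w f) y) / (z - w)"
      unfolding eventually_at
    proof (intro exI[of _ 1] conjI ballI impI)
      fix z assume z: "z \<in> S" "z \<noteq> w \<and> dist z w < 1"
      have "cinner (resolvent_op A z f) y - cinner (resolvent_op A w f) y
          = (z - w) * cinner (resolvent_op A z (A (resolvent_op A w f))) y"
        unfolding cinner.diff_left[symmetric] resolvent_identity[OF S[OF z(1)] S[OF w]] cinner_scaleC_left ..
      thus "cinner (resolvent_op A z (A (resolvent_op A w f))) y =
          (cinner (resolvent_op A z f) y - cinner (resolvent_op A w f) y) / (z - w)" using z by simp
    qed simp
  qed
  thus ?thesis unfolding holomorphic_on_def field_differentiable_def by blast
qed

end

text \<open>The solution is the fixed point of the contraction sending \<open>x\<close> to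
  \<open>f + z *\<^sub>C A x\<close>; Banach's theorem takes the place of the Neumann
  series.\<close>

lemma regular_if_small:
  assumes A: "cbounded_linear A" and small: "\<And>x. cmod z * norm (A x) \<le> 1 / 2 * norm x"
  shows "regular A z" and "norm x \<le> 2 * norm (x - z *\<^sub>C A x)"
proof -
  show bound: "norm x \<le> 2 * norm (x - z *\<^sub>C A x)" for x
    using small[of x] norm_triangle_ineq[of "x - z *\<^sub>C A x" "z *\<^sub>C A x"] by simp
  have "\<exists>x. x - z *\<^sub>C A x = f" for f
  proof -
    have "dist (f + z *\<^sub>C A x) (f + z *\<^sub>C A y) \<le> 1 / 2 * dist x y" for x y
      using small[of "x - y"] by (simp add: dist_norm scaleC.diff_right[symmetric] cbounded_linear_simps(3)[OF A, symmetric])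
    hence "\<exists>!x. f + z *\<^sub>C A x = x"
      using banach_fix_type[of "1 / 2" "\<lambda>x. f + z *\<^sub>C A x"] by auto
    then obtain x where "f + z *\<^sub>C A x = x" by blast
    thus ?thesis by (metis add_diff_cancel_right')
  qed
  thus "regular A z" unfolding regular_def surj_def using bound by metis
qed

section \<open>Finite-rank truncation and the perturbation determinant\<close>

context
  fixes T :: "'a::chilbert_space \<Rightarrow> 'a" and s :: "nat \<Rightarrow> real" and v :: "nat \<Rightarrow> 'a"
  assumes compT: "compact_operator T" and sys: "singular_system T s v"
begin

private definition tail_op :: "nat \<Rightarrow> 'a \<Rightarrow> 'a" where
  "tail_op n x = T (x - (\<Sum>j<n. cinner x (v j) *\<^sub>C v j))"

private abbreviation "U n z \<equiv> resolvent_op (tail_op n) z"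

text \<open>With \<open>c\<^sub>i = z (x, v\<^sub>i)\<close>, the equation \<open>x - z T x = f\<close> becomes \<open>x = U f + \<Sum>\<^sub>j c\<^sub>j U T v\<^sub>j\<close>, and the matrix
  \<open>pert n z\<close> is that of the resulting linear system for the \<open>c\<^sub>i\<close>.\<close>

private definition pert :: "nat \<Rightarrow> complex \<Rightarrow> nat \<Rightarrow> nat \<Rightarrow> complex" where
  "pert n z i j = (if i = j then 1 else 0) - z * cinner (U n z (T (v j))) (v i)"

private definition pert_det :: "nat \<Rightarrow> complex \<Rightarrow> complex" where
  "pert_det n z = cdet n (pert n z)"

private lemmas T' = compact_operator_cbounded_linear[OF compT]
private lemmas T_simps = cbounded_linear_simps[OF T']
private lemmas sf = singular_system_facts[OF compT sys]

private lemma tail_op_bound: "norm (tail_op n x) \<le> s n * norm x"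
  unfolding tail_op_def by (rule norm_T_minus_projection_le[OF compT sys])

private lemma tail_op_eq: "tail_op n x = T x - (\<Sum>j<n. cinner x (v j) *\<^sub>C T (v j))"
  by (simp add: tail_op_def T_simps)

private lemma cbounded_linear_tail_op: "cbounded_linear (tail_op n)"
  by (rule cbounded_linearI[OF _ _ tail_op_bound])
    (simp_all add: tail_op_eq T_simps cinner_add_left scaleC_add_left sum.distrib cinner_scaleC_left
      scaleC_scaleC scaleC.diff_right scaleC.sum_right)

private lemma
  assumes "cmod z * s n \<le> 1 / 2"
  shows regular_tail_op: "regular (tail_op n) z"
    and norm_U_le: "norm (U n z x) \<le> 2 * norm x"
proof -
  have small: "cmod z * norm (tail_op n x) \<le> 1 / 2 * norm x" for x
  proof -
    have "cmod z * norm (tail_op n x) \<le> cmod z * (s n * norm x)"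
      by (intro mult_left_mono tail_op_bound) simp
    also have "\<dots> = (cmod z * s n) * norm x" by simp
    also have "\<dots> \<le> 1 / 2 * norm x" by (intro mult_right_mono assms) simp
    finally show ?thesis .
  qed
  show reg: "regular (tail_op n) z" by (rule regular_if_small(1)[OF cbounded_linear_tail_op small])
  show "norm (U n z x) \<le> 2 * norm x"
    using regular_if_small(2)[OF cbounded_linear_tail_op small, of "U n z x"]
    by (simp add: resolvent_op_eq[OF cbounded_linear_tail_op reg])
qed

text \<open>Bessel's inequality bounds the coefficient column by
  \<open>norm (U n z (T (v j)))\<close>, hence by \<open>2 * s j\<close>. Keeping \<open>s j\<close>
  matters: with \<open>s 0\<close> in every column the exponent of the final bound would gain a
  logarithmic factor.\<close>

private lemma norm_pert_column_le:
  assumes "cmod z * s n \<le> 1 / 2"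
  shows "sqrt (\<Sum>i<n. (cmod (pert n z i j))\<^sup>2) \<le> 1 + 2 * cmod z * s j"
proof -
  define w where "w = U n z (T (v j))"
  have "L2_set (\<lambda>i. cmod (pert n z i j)) {..<n} \<le>
      L2_set (\<lambda>i. (if i = j then 1 else 0) + cmod z * cmod (cinner w (v i))) {..<n}"
    by (intro L2_set_mono) (auto simp: pert_def w_def norm_mult intro: order_trans[OF norm_triangle_ineq4])
  also have "\<dots> \<le> L2_set (\<lambda>i. if i = j then 1 else 0) {..<n} + L2_set (\<lambda>i. cmod z * cmod (cinner w (v i))) {..<n}"
    by (rule L2_set_triangle_ineq)
  also have "\<dots> \<le> 1 + cmod z * (2 * s j)"
  proof (rule add_mono)
    show "L2_set (\<lambda>i. if i = j then 1 else 0) {..<n} \<le> 1"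
      unfolding L2_set_def by (simp add: if_distrib[of "\<lambda>x. x\<^sup>2"] cong: if_cong)
    have "L2_set (\<lambda>i. cmod (cinner w (v i))) {..<n} \<le> norm w"
      unfolding L2_set_def using bessel_inequality[OF sf(4), of "{..<n}" w] by (simp add: real_le_lsqrt sum_nonneg)
    also have "norm w \<le> 2 * s j"
      using norm_U_le[OF assms, of "T (v j)"] norm_T_singular_vector[OF compT sys, of j] by (simp add: w_def)
    finally have "cmod z * L2_set (\<lambda>i. cmod (cinner w (v i))) {..<n} \<le> cmod z * (2 * s j)"
      by (intro mult_left_mono) auto
    thus "L2_set (\<lambda>i. cmod z * cmod (cinner w (v i))) {..<n} \<le> cmod z * (2 * s j)"
      by (simp add: L2_set_right_distrib)
  qed
  finally show ?thesis by (simp add: L2_set_def)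
qed

private definition det_bound :: "nat \<Rightarrow> real \<Rightarrow> real" where
  "det_bound n \<rho> = (\<Prod>j<n. 1 + 2 * \<rho> * s j)"

private lemma det_bound_ge_1: "0 \<le> \<rho> \<Longrightarrow> 1 \<le> det_bound n \<rho>"
  unfolding det_bound_def using sf(2) by (intro prod_ge_1) simp

private lemma norm_pert_det_le:
  assumes "cmod z * s n \<le> 1 / 2"
  shows "cmod (pert_det n z) \<le> det_bound n (cmod z)"
  unfolding pert_det_def det_bound_def
  by (rule order_trans[OF hadamard_inequality prod_mono])
    (auto intro!: norm_pert_column_le assms sum_nonneg)

private lemma pert_system:
  assumes "cmod z * s n \<le> 1 / 2" "i < n"
  shows "(\<Sum>j<n. pert n z i j * (z * cinner x (v j))) = z * cinner (U n z (x - z *\<^sub>C T x)) (v i)"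
proof -
  define c where "c j = z * cinner x (v j)" for j
  note reg = regular_tail_op[OF assms(1)]
  note U = cbounded_linear_simps[OF cbounded_linear_resolvent_op[OF cbounded_linear_tail_op reg]]
  have "x - z *\<^sub>C tail_op n x = (x - z *\<^sub>C T x) + (\<Sum>j<n. c j *\<^sub>C T (v j))"
    by (simp add: tail_op_eq c_def scaleC.diff_right scaleC.sum_right scaleC_scaleC)
  hence "U n z ((x - z *\<^sub>C T x) + (\<Sum>j<n. c j *\<^sub>C T (v j))) = x"
    by (rule resolvent_op_unique[OF cbounded_linear_tail_op reg])
  hence x: "x = U n z (x - z *\<^sub>C T x) + (\<Sum>j<n. c j *\<^sub>C U n z (T (v j)))" by (simp only: U)
  have "cinner x (v i) = cinner (U n z (x - z *\<^sub>C T x)) (v i) + (\<Sum>j<n. c j * cinner (U n z (T (v j))) (v i))"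
    by (subst x) (simp only: cinner_add_left cinner.sum_left cinner_scaleC_left)
  hence "c i = z * cinner (U n z (x - z *\<^sub>C T x)) (v i) + (\<Sum>j<n. z * cinner (U n z (T (v j))) (v i) * c j)"
    by (simp add: c_def[of i] distrib_left sum_distrib_left mult_ac)
  moreover have "(\<Sum>j<n. pert n z i j * c j) = c i - (\<Sum>j<n. z * cinner (U n z (T (v j))) (v i) * c j)"
    using assms(2) by (simp add: pert_def left_diff_distrib sum_subtractf if_distrib[of "\<lambda>x. x * _"] cong: if_cong)
  ultimately show ?thesis by (simp add: c_def)
qed

text \<open>The determinant is kept as a factor on the left, so its zeros cause no division.
  Cramer's rule and Hadamard's inequality bound each coefficient \<open>c k\<close>: the replaced
  column contributes \<open>2 * cmod z * norm f\<close> in place of its own factor, which is at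
  least 1. The vector \<open>x\<close> is recovered from its \<open>n\<close> coefficients, whence
  the factor \<open>real n * s 0\<close>.\<close>

private lemma norm_le_pert:
  assumes small: "cmod z * s n \<le> 1 / 2"
  shows "cmod (pert_det n z) * norm x \<le> 2 * (1 + 2 * cmod z * real n * s 0) * det_bound n (cmod z) * norm (x - z *\<^sub>C T x)"
proof -
  define f where "f = x - z *\<^sub>C T x"
  define c where "c j = z * cinner x (v j)" for j
  define b where "b i = z * cinner (U n z f) (v i)" for i
  note reg = regular_tail_op[OF small]
  let ?P = "det_bound n (cmod z)"
  have P: "1 \<le> ?P" by (rule det_bound_ge_1) simp
  have b: "sqrt (\<Sum>i<n. (cmod (b i))\<^sup>2) \<le> 2 * cmod z * norm f"
  proof -
    have "L2_set (\<lambda>i. cmod z * cmod (cinner (U n z f) (v i))) {..<n} = cmod z * L2_set (\<lambda>i. cmod (cinner (U n z f) (v i))) {..<n}"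
      by (simp add: L2_set_right_distrib)
    also have "\<dots> \<le> cmod z * norm (U n z f)"
      unfolding L2_set_def using bessel_inequality[OF sf(4), of "{..<n}" "U n z f"]
      by (intro mult_left_mono) (auto simp: real_le_lsqrt sum_nonneg)
    also have "\<dots> \<le> cmod z * (2 * norm f)" by (intro mult_left_mono norm_U_le[OF small]) simp
    finally show ?thesis by (simp add: L2_set_def b_def norm_mult)
  qed
  have c: "cmod (c k) * cmod (pert_det n z) \<le> 2 * cmod z * norm f * ?P" if k: "k < n" for k
  proof -
    have "(\<Sum>j<n. pert n z i j * c j) = b i" if "i < n" for i
      unfolding c_def b_def f_def by (rule pert_system[OF small that])
    hence "c k * pert_det n z = cdet n (\<lambda>i j. if j = k then b i else pert n z i j)"
      unfolding pert_det_def by (rule cramer_rule) (use k in auto)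
    hence "cmod (c k) * cmod (pert_det n z) = cmod (cdet n (\<lambda>i j. if j = k then b i else pert n z i j))"
      by (metis norm_mult)
    also have "\<dots> \<le> (\<Prod>j<n. sqrt (\<Sum>i<n. (cmod (if j = k then b i else pert n z i j))\<^sup>2))"
      by (rule hadamard_inequality)
    also have "\<dots> \<le> (\<Prod>j<n. if j = k then 2 * cmod z * norm f else 1 + 2 * cmod z * s j)"
      using b norm_pert_column_le[OF small] by (intro prod_mono) (auto simp: sum_nonneg)
    also have "\<dots> = 2 * cmod z * norm f * (\<Prod>j\<in>{..<n} - {k}. 1 + 2 * cmod z * s j)"
      using k by (subst prod.remove[of _ k]) (auto intro!: arg_cong2[of _ _ _ _ "(*)"] prod.cong)
    also have "\<dots> \<le> 2 * cmod z * norm f * ?P"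
    proof (intro mult_left_mono)
      have "?P = (1 + 2 * cmod z * s k) * (\<Prod>j\<in>{..<n} - {k}. 1 + 2 * cmod z * s j)"
        unfolding det_bound_def using k by (subst prod.remove[of _ k]) auto
      moreover have "0 \<le> (\<Prod>j\<in>{..<n} - {k}. 1 + 2 * cmod z * s j)" using sf(2) by (intro prod_nonneg) simp
      ultimately show "(\<Prod>j\<in>{..<n} - {k}. 1 + 2 * cmod z * s j) \<le> ?P"
        using sf(2)[of k] by (simp add: mult_le_cancel_right1)
    qed simp
    finally show ?thesis .
  qed
  have "x - z *\<^sub>C tail_op n x = f + (\<Sum>j<n. c j *\<^sub>C T (v j))"
    by (simp add: tail_op_eq c_def f_def scaleC.diff_right scaleC.sum_right scaleC_scaleC)
  hence "U n z (f + (\<Sum>j<n. c j *\<^sub>C T (v j))) = x"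
    by (rule resolvent_op_unique[OF cbounded_linear_tail_op reg])
  hence "norm x \<le> 2 * norm (f + (\<Sum>j<n. c j *\<^sub>C T (v j)))" using norm_U_le[OF small] by metis
  also have "\<dots> \<le> 2 * (norm f + (\<Sum>j<n. norm (c j *\<^sub>C T (v j))))"
    by (intro mult_left_mono order_trans[OF norm_triangle_ineq] add_left_mono norm_sum) simp
  also have "\<dots> \<le> 2 * (norm f + (\<Sum>j<n. cmod (c j) * s 0))"
  proof (intro mult_left_mono add_left_mono sum_mono)
    fix j show "norm (c j *\<^sub>C T (v j)) \<le> cmod (c j) * s 0"
      using norm_T_singular_vector[OF compT sys, of j] decseqD[OF sf(1), of 0 j] by (auto intro: mult_left_mono)
  qed simp
  finally have "cmod (pert_det n z) * norm x \<le> cmod (pert_det n z) * (2 * (norm f + (\<Sum>j<n. cmod (c j) * s 0)))"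
    by (intro mult_left_mono) auto
  also have "\<dots> = 2 * (cmod (pert_det n z) * norm f + (\<Sum>j<n. (cmod (c j) * cmod (pert_det n z)) * s 0))"
    by (simp add: algebra_simps sum_distrib_left)
  also have "\<dots> \<le> 2 * (?P * norm f + (\<Sum>j<n. (2 * cmod z * norm f * ?P) * s 0))"
    by (intro mult_left_mono add_mono mult_right_mono norm_pert_det_le small sum_mono c sf) auto
  finally show ?thesis by (simp add: algebra_simps f_def)
qed

private lemma regular_if_pert_det:
  assumes small: "cmod z * s n \<le> 1 / 2" and nz: "pert_det n z \<noteq> 0"
  shows "regular T z"
    and "norm x \<le> 2 * (1 + 2 * cmod z * real n * s 0) * det_bound n (cmod z) / cmod (pert_det n z) * norm (x - z *\<^sub>C T x)"
proof -
  show bound: "norm x \<le> 2 * (1 + 2 * cmod z * real n * s 0) * det_bound n (cmod z) / cmod (pert_det n z) * norm (x - z *\<^sub>C T x)" for x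
    using norm_le_pert[OF small, of x] nz by (simp add: field_simps)
  note reg = regular_tail_op[OF small]
  note U = cbounded_linear_simps[OF cbounded_linear_resolvent_op[OF cbounded_linear_tail_op reg]]
  have "\<exists>x. x - z *\<^sub>C T x = f" for f
  proof -
    obtain c where c: "\<And>i. i < n \<Longrightarrow> (\<Sum>j<n. pert n z i j * c j) = z * cinner (U n z f) (v i)"
      using cdet_nonzero_solvable[of n "pert n z" "\<lambda>i. z * cinner (U n z f) (v i)"] nz by (auto simp: pert_det_def)
    define x where "x = U n z (f + (\<Sum>j<n. c j *\<^sub>C T (v j)))"
    \<comment> \<open>Consistency: the matrix equation says that the numbers \<open>c i\<close> are
      the coefficients of the vector \<open>x\<close> built from them.\<close>
    have ci: "c i = z * cinner x (v i)" if "i < n" for i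
    proof -
      have "(\<Sum>j<n. pert n z i j * c j) = c i - (\<Sum>j<n. z * cinner (U n z (T (v j))) (v i) * c j)"
        using that by (simp add: pert_def left_diff_distrib sum_subtractf if_distrib[of "\<lambda>x. x * _"] cong: if_cong)
      hence "c i = z * cinner (U n z f) (v i) + (\<Sum>j<n. z * cinner (U n z (T (v j))) (v i) * c j)"
        using c[OF that] by simp
      also have "\<dots> = z * cinner x (v i)"
        by (simp add: x_def U cinner_add_left cinner.sum_left cinner_scaleC_left distrib_left sum_distrib_left mult_ac)
      finally show ?thesis .
    qed
    have "x - z *\<^sub>C tail_op n x = f + (\<Sum>j<n. c j *\<^sub>C T (v j))"
      unfolding x_def by (rule resolvent_op_eq[OF cbounded_linear_tail_op reg])
    also have "(\<Sum>j<n. c j *\<^sub>C T (v j)) = (\<Sum>j<n. (z * cinner x (v j)) *\<^sub>C T (v j))"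
      by (rule sum.cong) (auto simp: ci)
    finally have "x - z *\<^sub>C T x = f"
      by (simp add: tail_op_eq scaleC.diff_right scaleC.sum_right scaleC_scaleC)
    thus ?thesis by blast
  qed
  thus "regular T z" unfolding regular_def surj_def using bound by metis
qed

text \<open>The solvability argument with \<open>f = 0\<close>; a non-zero entry \<open>c k\<close>
  of the kernel vector equals \<open>z * cinner x (v k)\<close>, so \<open>x\<close> does not
  vanish.\<close>

private lemma eigenvector_if_pert_det_0:
  assumes small: "cmod z * s n \<le> 1 / 2" and z: "pert_det n z = 0"
  shows "\<exists>x. x \<noteq> 0 \<and> x = z *\<^sub>C T x"
proof -
  note reg = regular_tail_op[OF small]
  note U = cbounded_linear_simps[OF cbounded_linear_resolvent_op[OF cbounded_linear_tail_op reg]]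
  obtain c k where c: "k < n" "c k \<noteq> 0" "\<And>i. i < n \<Longrightarrow> (\<Sum>j<n. pert n z i j * c j) = 0"
    using cdet_zero_kernel[of n "pert n z"] z by (auto simp: pert_det_def)
  define x where "x = U n z (\<Sum>j<n. c j *\<^sub>C T (v j))"
  have ci: "c i = z * cinner x (v i)" if "i < n" for i
  proof -
    have "(\<Sum>j<n. pert n z i j * c j) = c i - (\<Sum>j<n. z * cinner (U n z (T (v j))) (v i) * c j)"
      using that by (simp add: pert_def left_diff_distrib sum_subtractf if_distrib[of "\<lambda>x. x * _"] cong: if_cong)
    hence "c i = (\<Sum>j<n. z * cinner (U n z (T (v j))) (v i) * c j)"
      using c(3)[OF that] by simp
    also have "\<dots> = z * cinner x (v i)"
      by (simp add: x_def U cinner.sum_left cinner_scaleC_left sum_distrib_left mult_ac)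
    finally show ?thesis .
  qed
  have "x - z *\<^sub>C tail_op n x = (\<Sum>j<n. c j *\<^sub>C T (v j))"
    unfolding x_def by (rule resolvent_op_eq[OF cbounded_linear_tail_op reg])
  also have "(\<Sum>j<n. c j *\<^sub>C T (v j)) = (\<Sum>j<n. (z * cinner x (v j)) *\<^sub>C T (v j))"
    by (rule sum.cong) (auto simp: ci)
  finally have "x = z *\<^sub>C T x"
    by (simp add: tail_op_eq scaleC.diff_right scaleC.sum_right scaleC_scaleC)
  moreover have "x \<noteq> 0" using ci[OF c(1)] c(2) by (auto simp: cinner.zero_left)
  ultimately show ?thesis by blast
qed

private lemma ex_truncation: "\<exists>n. \<rho> * s n < 1 / 2"
proof -
  have "(\<lambda>n. \<rho> * s n) \<longlonglongrightarrow> \<rho> * 0" by (intro tendsto_intros sf)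
  hence "\<forall>\<^sub>F n in sequentially. \<rho> * s n < 1 / 2" by (intro order_tendstoD(2)) auto
  thus ?thesis by (meson eventually_sequentially order_refl)
qed

text \<open>For fixed \<open>z\<close> some truncation is admissible, and then
  \<open>pert_det n z\<close> decides: if it is non-zero, \<open>z\<close> is regular, and if it is
  zero, there is a non-zero solution of \<open>x = z *\<^sub>C T x\<close>.\<close>

theorem fredholm_alternative:
  assumes "\<And>x. x = z *\<^sub>C T x \<Longrightarrow> x = 0"
  shows "regular T z"
proof -
  obtain n where "cmod z * s n < 1 / 2" using ex_truncation by blast
  thus ?thesis using regular_if_pert_det(1)[of z n] eigenvector_if_pert_det_0[of z n] assms by force
qed

private lemma holomorphic_pert_det: "pert_det n holomorphic_on {z. cmod z * s n \<le> 1 / 2}"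
  unfolding pert_det_def
  by (rule holomorphic_on_cdet)
    (auto simp: pert_def intro!: holomorphic_intros holomorphic_on_resolvent_op cbounded_linear_tail_op regular_tail_op)

private lemma pert_det_0: "pert_det n 0 = 1"
proof -
  have "pert_det n 0 = (\<Prod>i<n. pert n 0 i i)"
    unfolding pert_det_def by (rule cdet_diagonal) (auto simp: pert_def)
  thus ?thesis by (simp add: pert_def)
qed

text \<open>One \<open>n\<close> serves a whole disc, and the singular points there are among the
  zeros of a holomorphic function with value 1 at 0. The constant case is separated since finiteness
  of zeros presupposes a non-constant function; \<open>\<bar>R\<bar> + 1\<close> provides an open
  set around the closed disc.\<close>

theorem finite_singular_points: "finite {z. cmod z \<le> R \<and> \<not> regular T z}"
proof -
  obtain n where n: "(\<bar>R\<bar> + 1) * s n < 1 / 2" using ex_truncation by blast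
  have le: "cmod z * s n \<le> 1 / 2" if "cmod z \<le> \<bar>R\<bar> + 1" for z
    using mult_right_mono[OF that sf(2)[of n]] n by linarith
  have "finite {z \<in> cball 0 \<bar>R\<bar>. pert_det n z = 0}"
  proof (cases "pert_det n constant_on ball 0 (\<bar>R\<bar> + 1)")
    case True
    have "pert_det n z = 1" if "cmod z \<le> \<bar>R\<bar>" for z
    proof -
      have "z \<in> ball 0 (\<bar>R\<bar> + 1)" "0 \<in> ball (0::complex) (\<bar>R\<bar> + 1)" using that by auto
      thus ?thesis using True pert_det_0[of n] unfolding constant_on_def by metis
    qed
    hence "{z \<in> cball 0 \<bar>R\<bar>. pert_det n z = 0} = {}" by auto
    thus ?thesis by (metis finite.emptyI)
  next
    case False
    thus ?thesis
    proof (rule holomorphic_compact_finite_zeros[rotated -1])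
      show "pert_det n holomorphic_on ball 0 (\<bar>R\<bar> + 1)"
        using le by (intro holomorphic_on_subset[OF holomorphic_pert_det] subsetI CollectI) simp
    qed auto
  qed
  moreover have "{z. cmod z \<le> R \<and> \<not> regular T z} \<subseteq> {z \<in> cball 0 \<bar>R\<bar>. pert_det n z = 0}"
  proof
    fix z assume "z \<in> {z. cmod z \<le> R \<and> \<not> regular T z}"
    hence z: "cmod z \<le> \<bar>R\<bar>" "\<not> regular T z" by auto
    hence "cmod z * s n \<le> 1 / 2" by (intro le) simp
    with z show "z \<in> {z \<in> cball 0 \<bar>R\<bar>. pert_det n z = 0}" using regular_if_pert_det(1) by auto
  qed
  ultimately show ?thesis using finite_subset by blast
qed

text \<open>The factor 16 is 2 * 8: a column costs \<open>1 + 2 * cmod z * s j\<close>, and the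
  minimum modulus theorem asks for the bound up to radius \<open>8 * \<rho>\<close>. In the
  exponent, 55 = 54 + 1, the 54 from the lower bound for the determinant and the 1 from the
  numerators.\<close>

theorem resolvent_circle_bound:
  assumes \<rho>: "0 < \<rho>" and n: "16 * \<rho> * s n < 1"
  defines "Q \<equiv> (\<Sum>j<n. ln (1 + 16 * \<rho> * s j))"
  shows "\<exists>\<rho>'. \<rho> \<le> \<rho>' \<and> \<rho>' \<le> 2 * \<rho> \<and> (\<forall>z. cmod z = \<rho>' \<longrightarrow> regular T z \<and>
    (\<forall>x. norm x \<le> 2 * (1 + 4 * \<rho> * real n * s 0) * exp (2 + 55 * Q) * norm (x - z *\<^sub>C T x)))"
proof -
  \<comment> \<open>Holomorphy is required on an open disc reaching beyond radius
    \<open>8 * \<rho>\<close>; the strict inequality \<open>16 * \<rho> * s n < 1\<close> leaves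
    room for it.\<close>
  obtain R' where R': "8 * \<rho> < R'" "R' * s n \<le> 1 / 2"
  proof (cases "s n = 0")
    case True
    then show ?thesis using that[of "8 * \<rho> + 1"] by simp
  next
    case False
    then show ?thesis using that[of "1 / (2 * s n)"] n sf(2)[of n] by (simp add: field_simps)
  qed
  have le: "cmod z * s n \<le> 1 / 2" if "cmod z \<le> R'" for z
    using mult_right_mono[OF that sf(2)[of n]] R' by linarith
  define M where "M = det_bound n (8 * \<rho>)"
  have pos: "0 < 1 + 16 * \<rho> * s j" for j using \<rho> sf(2)[of j] by (simp add: add_pos_nonneg)
  have lnM: "ln M = Q"
    unfolding M_def det_bound_def Q_def using pos by (subst ln_prod) (auto simp: less_imp_neq[THEN not_sym])
  have M1: "1 \<le> M" unfolding M_def using \<rho> by (intro det_bound_ge_1) simp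
  have mono: "det_bound n a \<le> M" if "0 \<le> a" "a \<le> 8 * \<rho>" for a
    unfolding M_def det_bound_def
  proof (intro prod_mono conjI)
    fix j
    have "2 * a * s j \<le> 2 * (8 * \<rho>) * s j" using that sf(2) by (intro mult_right_mono) auto
    thus "1 + 2 * a * s j \<le> 1 + 2 * (8 * \<rho>) * s j" by simp
    show "0 \<le> 1 + 2 * a * s j" using that sf(2) by simp
  qed
  have "\<exists>\<rho>'. \<rho> \<le> \<rho>' \<and> \<rho>' \<le> 2 * \<rho> \<and> (\<forall>z. cmod z = \<rho>' \<longrightarrow> exp (- 2 - 54 * ln M) \<le> cmod (pert_det n z))"
  proof (rule circle_lower_bound[where D = "pert_det n" and R' = R' and M = M])
    show "pert_det n holomorphic_on ball 0 R'"
      using le by (intro holomorphic_on_subset[OF holomorphic_pert_det] subsetI CollectI) simp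
    show "cmod (pert_det n z) \<le> M" if "cmod z \<le> 8 * \<rho>" for z
      using norm_pert_det_le[OF le] mono[of "cmod z"] that R' by (meson dual_order.trans less_imp_le norm_ge_zero)
  qed (use R' \<rho> pert_det_0 in auto)
  then obtain \<rho>' where \<rho>': "\<rho> \<le> \<rho>'" "\<rho>' \<le> 2 * \<rho>" "\<And>z. cmod z = \<rho>' \<Longrightarrow> exp (- 2 - 54 * Q) \<le> cmod (pert_det n z)"
    unfolding lnM by blast
  show ?thesis
  proof (intro exI[of _ \<rho>'] conjI allI impI)
    fix z assume z: "cmod z = \<rho>'"
    have zn: "cmod z * s n \<le> 1 / 2" by (rule le) (use z \<rho>' R' \<rho> in simp)
    have d: "exp (- 2 - 54 * Q) \<le> cmod (pert_det n z)" by (rule \<rho>'(3)[OF z])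
    have "0 < cmod (pert_det n z)" using d exp_gt_zero[of "- 2 - 54 * Q"] by linarith
    hence nz: "pert_det n z \<noteq> 0" by simp
    show "regular T z" by (rule regular_if_pert_det(1)[OF zn nz])
    fix x
    have "2 * (1 + 2 * cmod z * real n * s 0) * det_bound n (cmod z) / cmod (pert_det n z)
        \<le> 2 * (1 + 4 * \<rho> * real n * s 0) * M / exp (- 2 - 54 * Q)"
    proof (intro frac_le mult_mono d)
      have "2 * cmod z \<le> 4 * \<rho>" using z \<rho>' by simp
      hence "2 * cmod z * (real n * s 0) \<le> 4 * \<rho> * (real n * s 0)" using sf(2)[of 0] by (intro mult_right_mono) auto
      thus "1 + 2 * cmod z * real n * s 0 \<le> 1 + 4 * \<rho> * real n * s 0" by (simp add: mult_ac)
      show "det_bound n (cmod z) \<le> M" by (rule mono) (use z \<rho>' \<rho> in auto)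
      show "0 \<le> 2 * (1 + 4 * \<rho> * real n * s 0) * M" "0 \<le> 2 * (1 + 4 * \<rho> * real n * s 0)"
        using M1 \<rho> sf(2)[of 0] by (auto intro!: mult_nonneg_nonneg add_nonneg_nonneg)
      show "0 \<le> det_bound n (cmod z)" using det_bound_ge_1[of "cmod z" n] by simp
      show "0 \<le> 1 + 2 * cmod z * real n * s 0" using sf(2)[of 0] by simp
    qed auto
    also have "M = exp Q" using M1 by (simp add: lnM[symmetric])
    also have "2 * (1 + 4 * \<rho> * real n * s 0) * exp Q / exp (- 2 - 54 * Q) = 2 * (1 + 4 * \<rho> * real n * s 0) * exp (2 + 55 * Q)"
    proof -
      have "exp Q / exp (- 2 - 54 * Q) = exp (2 + 55 * Q)" by (simp flip: exp_diff)
      thus ?thesis by (metis times_divide_eq_right)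
    qed
    finally show "norm x \<le> 2 * (1 + 4 * \<rho> * real n * s 0) * exp (2 + 55 * Q) * norm (x - z *\<^sub>C T x)"
      by (intro order_trans[OF regular_if_pert_det(2)[OF zn nz]] mult_right_mono) auto
  qed (use \<rho>' in auto)
qed

end


section \<open>Growth of the resolvent on a sequence of circles\<close>

lemma sum_inverse_sqrt_le: "(\<Sum>j<n. real (Suc j) powr (- 1 / 2)) \<le> 2 * sqrt (real n)"
proof (induction n)
  case (Suc n)
  define a b where "a = sqrt (real n)" and "b = sqrt (real (Suc n))"
  have b: "0 < b" "b\<^sup>2 = a\<^sup>2 + 1" by (simp_all add: a_def b_def)
  have "0 \<le> (b - a)\<^sup>2" by simp
  hence "1 \<le> b * (2 * (b - a))" using b by (simp add: power2_eq_square algebra_simps)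
  hence "1 / b \<le> 2 * (b - a)" using b by (simp add: pos_divide_le_eq mult.commute)
  moreover have "real (Suc n) powr (- 1 / 2) = 1 / b"
    using powr_minus_divide[of "real (Suc n)" "1 / 2"] by (simp add: b_def powr_half_sqrt)
  ultimately show ?case using Suc by (simp add: a_def b_def)
qed simp

text \<open>With \<open>n\<close> about \<open>\<epsilon> \<rho>\<^sup>\<alpha>\<close> and \<open>\<beta> = \<alpha>/2\<close>, the estimate \<open>ln (1 + y) \<le> (1 + y)\<^sup>\<beta> / \<beta>\<close> loses nothing essential,
  since \<open>\<Sum> j\<^sup>-\<^sup>1\<^sup>/\<^sup>2\<close> up to \<open>n\<close> is of order \<open>\<surd>n\<close>.\<close>

lemma log_sum_small:
  fixes s :: "nat \<Rightarrow> real"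
  assumes s0: "\<And>n. 0 \<le> s n" and so: "s \<in> o(\<lambda>n. real (Suc n) powr (- 1 / \<alpha>))"
    and \<alpha>: "0 < \<alpha>" and \<eta>: "0 < \<eta>"
  shows "\<forall>\<^sub>F \<rho> in at_top. \<exists>n. 16 * \<rho> * s n < 1 \<and> real n \<le> \<eta> * \<rho> powr \<alpha> \<and>
    (\<Sum>j<n. ln (1 + 16 * \<rho> * s j)) \<le> \<eta> * \<rho> powr \<alpha>"
proof -
  have bound: "\<exists>J. \<forall>n\<ge>J. s n \<le> \<delta> * real (Suc n) powr (- 1 / \<alpha>)" if "0 < \<delta>" for \<delta>
    using landau_o.smallD[OF so that] s0 unfolding eventually_sequentially by simp
  obtain J0 where J0: "\<And>n. J0 \<le> n \<Longrightarrow> s n \<le> 1 * real (Suc n) powr (- 1 / \<alpha>)" using bound[of 1] by auto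
  \<comment> \<open>A little-o constant is valid only from some index on, but the sum starts at
    \<open>j = 0\<close>; \<open>M0\<close> gives a bound of the same shape for all indices.\<close>
  define M0 where "M0 = 1 + (\<Sum>j<J0. s j * real (Suc j) powr (1 / \<alpha>))"
  have M0: "0 < M0" unfolding M0_def using s0 by (intro add_pos_nonneg sum_nonneg mult_nonneg_nonneg) auto
  have sM: "s n \<le> M0 * real (Suc n) powr (- 1 / \<alpha>)" for n
  proof (cases "n < J0")
    case True
    have "s n * real (Suc n) powr (1 / \<alpha>) \<le> (\<Sum>j<J0. s j * real (Suc j) powr (1 / \<alpha>))"
      using True s0 by (intro member_le_sum) auto
    hence "s n * real (Suc n) powr (1 / \<alpha>) \<le> M0" by (simp add: M0_def)
    hence "s n * real (Suc n) powr (1 / \<alpha>) * real (Suc n) powr (- 1 / \<alpha>) \<le> M0 * real (Suc n) powr (- 1 / \<alpha>)"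
      by (intro mult_right_mono) auto
    thus ?thesis by (simp add: mult.assoc flip: powr_add)
  next
    case False
    have "s n \<le> 1 * real (Suc n) powr (- 1 / \<alpha>)" using J0 False by simp
    also have "\<dots> \<le> M0 * real (Suc n) powr (- 1 / \<alpha>)"
      unfolding M0_def using s0 by (intro mult_right_mono) (auto intro!: sum_nonneg)
    finally show ?thesis .
  qed
  define \<beta> where "\<beta> = \<alpha> / 2"
  have \<beta>: "0 < \<beta>" using \<alpha> by (simp add: \<beta>_def)
  define K where "K = 2 powr \<beta> / \<beta>"
  define L where "L = 2 * (16 * M0) powr \<beta>"
  have K: "0 < K" and L: "0 \<le> L" using \<beta> by (simp_all add: K_def L_def)
  \<comment> \<open>The sum will be at most
    \<open>K * (\<epsilon> + L * sqrt \<epsilon>) * X\<close>; with \<open>\<epsilon> = e^2\<close>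
    and \<open>e \<le> 1\<close> this is at most \<open>K * (1 + L) * e * X\<close>, hence the last
    entry of the minimum.\<close>
  define e where "e = min 1 (min \<eta> (\<eta> / (K * (1 + L))))"
  have e: "0 < e" "e \<le> 1" "e \<le> \<eta>" using \<eta> K L by (auto simp: e_def)
  have "e \<le> \<eta> / (K * (1 + L))" by (simp add: e_def)
  moreover have "0 < K * (1 + L)" using K L by simp
  ultimately have e4: "K * (1 + L) * e \<le> \<eta>" by (metis pos_le_divide_eq mult.commute)
  define \<epsilon> where "\<epsilon> = e\<^sup>2"
  have \<epsilon>: "0 < \<epsilon>" "\<epsilon> \<le> e" "sqrt \<epsilon> = e" using e by (auto simp: \<epsilon>_def power2_eq_square mult_le_cancel_left1)
  \<comment> \<open>Makes \<open>(16 * \<delta> * \<rho>) powr \<alpha>\<close> equal to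
    \<open>\<epsilon> / 2 * X\<close>, the lower bound for \<open>n\<close>, so that smallness of
    \<open>s n\<close> yields \<open>16 * \<rho> * s n < 1\<close>.\<close>
  define \<delta> where "\<delta> = (\<epsilon> / 2) powr (1 / \<alpha>) / 16"
  have \<delta>: "0 < \<delta>" using \<epsilon> by (simp add: \<delta>_def)
  have \<delta>\<alpha>: "(16 * \<delta>) powr \<alpha> = \<epsilon> / 2" using \<epsilon> \<alpha> by (simp add: \<delta>_def powr_powr)
  obtain J where J: "\<And>n. J \<le> n \<Longrightarrow> s n \<le> \<delta> * real (Suc n) powr (- 1 / \<alpha>)" using bound[OF \<delta>] by auto
  have lim: "filterlim (\<lambda>\<rho>. \<rho> powr \<alpha>) at_top at_top" using \<alpha> by real_asymp
  have "\<forall>\<^sub>F \<rho> in at_top. (real J + 1) * 2 / \<epsilon> \<le> \<rho> powr \<alpha>"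
    using lim by (auto simp: filterlim_at_top)
  moreover have "\<forall>\<^sub>F \<rho>::real in at_top. 0 < \<rho>" by (rule eventually_gt_at_top)
  ultimately show ?thesis
  proof eventually_elim
    case (elim \<rho>)
    define X where "X = \<rho> powr \<alpha>"
    have X: "0 < X" using elim by (simp add: X_def)
    \<comment> \<open>Lies between \<open>\<epsilon> / 2 * X\<close> and
      \<open>\<epsilon> * X\<close>; the rounding error is absorbed because
      \<open>\<epsilon> / 2 * X\<close> is at least 1 by \<open>JX\<close>.\<close>
    define n where "n = nat \<lceil>\<epsilon> / 2 * X\<rceil>"
    have JX: "real J + 1 \<le> \<epsilon> / 2 * X" using elim(1) \<epsilon> by (simp add: X_def field_simps)
    have n1: "\<epsilon> / 2 * X \<le> real n" unfolding n_def by linarith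
    have n2: "real n \<le> \<epsilon> * X"
    proof -
      have "real n \<le> \<epsilon> / 2 * X + 1" unfolding n_def using X \<epsilon> by (simp add: of_nat_nat)
      thus ?thesis using JX by simp
    qed
    have "J \<le> n" using JX n1 by linarith
    have "16 * \<rho> * s n < 1"
    proof -
      have "(16 * \<delta> * \<rho>) powr \<alpha> = \<epsilon> / 2 * X"
        using \<delta> elim by (simp add: powr_mult \<delta>\<alpha>[symmetric] X_def)
      also have "\<dots> < real (Suc n)" using n1 by simp
      finally have "((16 * \<delta> * \<rho>) powr \<alpha>) powr (1 / \<alpha>) < real (Suc n) powr (1 / \<alpha>)"
        using \<alpha> by (intro powr_less_mono2) auto
      hence *: "16 * \<delta> * \<rho> < real (Suc n) powr (1 / \<alpha>)" using \<alpha> \<delta> elim by (simp add: powr_powr)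
      have "16 * \<rho> * s n \<le> 16 * \<rho> * (\<delta> * real (Suc n) powr (- 1 / \<alpha>))"
        using J[OF \<open>J \<le> n\<close>] elim by (intro mult_left_mono) auto
      also have "\<dots> = (16 * \<delta> * \<rho>) * real (Suc n) powr (- 1 / \<alpha>)" by simp
      also have "\<dots> < real (Suc n) powr (1 / \<alpha>) * real (Suc n) powr (- 1 / \<alpha>)"
        using * by (intro mult_strict_right_mono) auto
      also have "\<dots> = 1" by (simp flip: powr_add)
      finally show ?thesis .
    qed
    moreover have "(\<Sum>j<n. ln (1 + 16 * \<rho> * s j)) \<le> \<eta> * X"
    proof -
      have ln_le: "ln (1 + 16 * \<rho> * s j) \<le> K * (1 + (16 * M0) powr \<beta> * sqrt X * real (Suc j) powr (- 1 / 2))" for j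
      proof -
        define y where "y = 16 * \<rho> * s j"
        have y: "0 \<le> y" using elim s0 by (simp add: y_def)
        have "ln (1 + y) = ln ((1 + y) powr \<beta>) / \<beta>" using y \<beta> by (simp add: ln_powr)
        also have "\<dots> \<le> (1 + y) powr \<beta> / \<beta>"
          using y \<beta> ln_le_minus_one[of "(1 + y) powr \<beta>"] by (intro divide_right_mono) auto
        also have "(1 + y) powr \<beta> \<le> 2 powr \<beta> * (1 + y powr \<beta>)"
        proof (cases "y \<le> 1")
          case True
          have "(1 + y) powr \<beta> \<le> 2 powr \<beta>" using True y \<beta> by (intro powr_mono2) auto
          also have "\<dots> \<le> 2 powr \<beta> * (1 + y powr \<beta>)" by (simp add: mult_le_cancel_left1)
          finally show ?thesis .
        next
          case False
          have "(1 + y) powr \<beta> \<le> (2 * y) powr \<beta>" using False y \<beta> by (intro powr_mono2) auto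
          also have "\<dots> = 2 powr \<beta> * y powr \<beta>" using y by (simp add: powr_mult)
          also have "\<dots> \<le> 2 powr \<beta> * (1 + y powr \<beta>)" by (intro mult_left_mono) auto
          finally show ?thesis .
        qed
        also have "y powr \<beta> \<le> (16 * \<rho> * (M0 * real (Suc j) powr (- 1 / \<alpha>))) powr \<beta>"
          unfolding y_def using sM[of j] s0[of j] elim \<beta> by (intro powr_mono2 mult_left_mono) auto
        also have "\<dots> = (16 * M0) powr \<beta> * sqrt X * real (Suc j) powr (- 1 / 2)"
        proof -
          have "\<rho> powr \<beta> = sqrt X"
            unfolding X_def \<beta>_def using elim by (simp add: powr_half_sqrt[symmetric] powr_powr)
          moreover have "(real (Suc j) powr (- 1 / \<alpha>)) powr \<beta> = real (Suc j) powr (- 1 / 2)"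
            using \<alpha> by (simp add: powr_powr \<beta>_def)
          moreover have "16 * \<rho> * (M0 * real (Suc j) powr (- 1 / \<alpha>)) = (16 * M0) * \<rho> * real (Suc j) powr (- 1 / \<alpha>)" by simp
          ultimately show ?thesis using M0 elim by (simp only: powr_mult)
        qed
        finally show ?thesis using \<beta> by (simp add: y_def K_def field_simps)
      qed
      have "(\<Sum>j<n. ln (1 + 16 * \<rho> * s j))
          \<le> (\<Sum>j<n. K * (1 + (16 * M0) powr \<beta> * sqrt X * real (Suc j) powr (- 1 / 2)))"
        by (intro sum_mono ln_le)
      also have "\<dots> = K * (real n + (16 * M0) powr \<beta> * sqrt X * (\<Sum>j<n. real (Suc j) powr (- 1 / 2)))"
        by (simp add: sum_distrib_left[symmetric] sum.distrib)
      also have "\<dots> \<le> K * (\<epsilon> * X + (16 * M0) powr \<beta> * sqrt X * (2 * sqrt (\<epsilon> * X)))"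
      proof (intro mult_left_mono add_mono n2)
        have "2 * sqrt (real n) \<le> 2 * sqrt (\<epsilon> * X)" using n2 by simp
        thus "(\<Sum>j<n. real (Suc j) powr (- 1 / 2)) \<le> 2 * sqrt (\<epsilon> * X)" using sum_inverse_sqrt_le order_trans by blast
      qed (use K X in auto)
      also have "\<dots> = K * (\<epsilon> + L * e) * X"
        using X \<epsilon>(3) by (simp add: L_def real_sqrt_mult algebra_simps)
      also have "\<dots> \<le> (K * (1 + L) * e) * X"
        using \<epsilon>(2) K X by (intro mult_right_mono) (auto simp: algebra_simps)
      also have "\<dots> \<le> \<eta> * X" using e4 X by (intro mult_right_mono) auto
      finally show ?thesis .
    qed
    moreover have "real n \<le> \<eta> * X" using n2 \<epsilon>(2) e(3) X by (meson dual_order.trans less_imp_le mult_right_mono)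
    ultimately show ?case unfolding X_def by blast
  qed
qed

theorem resolvent_growth:
  assumes T: "compact_operator T" and so: "singular_number T \<in> o(\<lambda>n. real (Suc n) powr (- 1 / \<alpha>))"
    and \<alpha>: "0 < \<alpha>" and \<eta>: "0 < \<eta>"
  shows "\<exists>\<rho>\<ge>R0. \<forall>z. cmod z = \<rho> \<longrightarrow> regular T z \<and> (\<forall>x. norm x \<le> exp (\<eta> * \<rho> powr \<alpha>) * norm (x - z *\<^sub>C T x))"
proof -
  obtain s v where sys: "singular_system T s v" using singular_system_exists[OF T] by blast
  have s: "singular_number T = s" by (rule singular_number_eq[OF T sys])
  note sf = singular_system_facts[OF T sys]
  \<comment> \<open>\<open>55 * \<eta>'\<close> is half of \<open>\<eta>\<close>; the other half
    absorbs the polynomial prefactor and \<open>exp 2\<close> for large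
    \<open>\<rho>\<close>.\<close>
  define \<eta>' where "\<eta>' = \<eta> / 110"
  have \<eta>': "0 < \<eta>'" using \<eta> by (simp add: \<eta>'_def)
  define c where "c = 4 * \<eta>' * s 0"
  have c: "0 \<le> c" using \<eta>' sf(2) by (simp add: c_def)
  have "((\<lambda>\<rho>. 2 * (1 + c * \<rho> * \<rho> powr \<alpha>) * exp 2 / exp (55 * \<eta>' * \<rho> powr \<alpha>)) \<longlongrightarrow> 0) at_top"
    using \<alpha> \<eta>' by real_asymp
  hence "\<forall>\<^sub>F \<rho> in at_top. 2 * (1 + c * \<rho> * \<rho> powr \<alpha>) * exp 2 / exp (55 * \<eta>' * \<rho> powr \<alpha>) < 1"
    by (intro order_tendstoD(2)) auto
  moreover have "\<forall>\<^sub>F \<rho> in at_top. max 1 R0 \<le> \<rho>" by (rule eventually_ge_at_top)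
  moreover note log_sum_small[OF sf(2) so[unfolded s] \<alpha> \<eta>']
  ultimately have "\<forall>\<^sub>F \<rho>::real in at_top. \<exists>\<rho>'\<ge>R0. \<forall>z. cmod z = \<rho>' \<longrightarrow> regular T z \<and> (\<forall>x. norm x \<le> exp (\<eta> * \<rho>' powr \<alpha>) * norm (x - z *\<^sub>C T x))"
  proof eventually_elim
    case (elim \<rho>)
    have \<rho>: "0 < \<rho>" "R0 \<le> \<rho>" using elim(2) by auto
    obtain n where n: "16 * \<rho> * s n < 1" "real n \<le> \<eta>' * \<rho> powr \<alpha>" "(\<Sum>j<n. ln (1 + 16 * \<rho> * s j)) \<le> \<eta>' * \<rho> powr \<alpha>"
      using elim(3) by blast
    define Q where "Q = (\<Sum>j<n. ln (1 + 16 * \<rho> * s j))"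
    obtain \<rho>' where \<rho>': "\<rho> \<le> \<rho>'" "\<rho>' \<le> 2 * \<rho>" "\<And>z. cmod z = \<rho>' \<Longrightarrow> regular T z"
      "\<And>z x. cmod z = \<rho>' \<Longrightarrow> norm x \<le> 2 * (1 + 4 * \<rho> * real n * s 0) * exp (2 + 55 * Q) * norm (x - z *\<^sub>C T x)"
      using resolvent_circle_bound[OF T sys \<rho>(1) n(1)] unfolding Q_def by blast
    have "2 * (1 + 4 * \<rho> * real n * s 0) * exp (2 + 55 * Q) \<le> exp (\<eta> * \<rho>' powr \<alpha>)"
    proof -
      have "4 * \<rho> * s 0 * real n \<le> 4 * \<rho> * s 0 * (\<eta>' * \<rho> powr \<alpha>)"
        using \<rho> sf(2)[of 0] n(2) by (intro mult_left_mono) auto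
      hence 1: "2 * (1 + 4 * \<rho> * real n * s 0) \<le> 2 * (1 + c * \<rho> * \<rho> powr \<alpha>)" by (simp add: c_def mult_ac)
      have 2: "exp (2 + 55 * Q) \<le> exp (2 + 55 * (\<eta>' * \<rho> powr \<alpha>))" using n(3) by (simp add: Q_def)
      have "2 * (1 + 4 * \<rho> * real n * s 0) * exp (2 + 55 * Q) \<le> 2 * (1 + c * \<rho> * \<rho> powr \<alpha>) * exp (2 + 55 * (\<eta>' * \<rho> powr \<alpha>))"
        using 1 2 c \<rho> sf(2)[of 0] by (intro mult_mono) auto
      also have "\<dots> = (2 * (1 + c * \<rho> * \<rho> powr \<alpha>) * exp 2) * exp (55 * \<eta>' * \<rho> powr \<alpha>)" by (simp add: exp_add mult_ac)
      also have "\<dots> \<le> exp (55 * \<eta>' * \<rho> powr \<alpha>) * exp (55 * \<eta>' * \<rho> powr \<alpha>)"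
        using elim(1) by (intro mult_right_mono) (auto simp: field_simps)
      also have "\<dots> = exp (\<eta> * \<rho> powr \<alpha>)" by (simp add: \<eta>'_def flip: exp_add)
      also have "\<dots> \<le> exp (\<eta> * \<rho>' powr \<alpha>)" using \<rho>' \<rho> \<alpha> \<eta> by (simp add: powr_mono2)
      finally show ?thesis .
    qed
    hence "norm x \<le> exp (\<eta> * \<rho>' powr \<alpha>) * norm (x - z *\<^sub>C T x)" if "cmod z = \<rho>'" for z x
      using \<rho>'(4)[OF that, of x] by (meson mult_right_mono norm_ge_zero order_trans)
    thus ?case using \<rho>'(1,3) \<rho>(2) by (intro exI[of _ \<rho>']) auto
  qed
  from eventually_happens[OF this] show ?thesis by simp
qed

section \<open>Integrals along the sector contour\<close>

lemma has_vector_contour_integral_cinner: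
  assumes "has_vector_contour_integral F I \<gamma>"
  shows "((\<lambda>z. cinner (F z) y) has_contour_integral cinner I y) \<gamma>"
  using has_integral_linear[OF assms[unfolded has_vector_contour_integral_def] cinner.bounded_linear_left, of y]
  by (simp add: has_contour_integral_def o_def cinner_scaleC_left mult.commute)

lemma has_vector_contour_integral_linepath:
  assumes "continuous_on (closed_segment a b) F"
  shows "\<exists>I. has_vector_contour_integral F I (linepath a b)"
proof -
  have "continuous_on {0..1} (\<lambda>s. (b - a) *\<^sub>C F (linepath a b s))"
    by (intro scaleC.continuous_on continuous_intros continuous_on_compose2[OF assms])
      (auto simp: linepath_in_path)
  hence "(\<lambda>s. (b - a) *\<^sub>C F (linepath a b s)) integrable_on {0..1}" by (rule integrable_continuous_real)
  then obtain I where "((\<lambda>s. (b - a) *\<^sub>C F (linepath a b s)) has_integral I) {0..1}" by blast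
  hence "has_vector_contour_integral F I (linepath a b)"
    unfolding has_vector_contour_integral_def
    by (rule has_integral_eq[rotated]) (simp add: vector_derivative_linepath_within)
  thus ?thesis ..
qed

lemma has_vector_contour_integral_part_circlepath:
  assumes "continuous_on (path_image (part_circlepath z r a b)) F"
  shows "\<exists>I. has_vector_contour_integral F I (part_circlepath z r a b)"
proof -
  define d where "d s = \<i> * r * (of_real b - of_real a) * exp (\<i> * linepath a b s)" for s
  have "continuous_on {0..1} (\<lambda>s. d s *\<^sub>C F (part_circlepath z r a b s))"
    unfolding d_def
    by (intro scaleC.continuous_on continuous_intros continuous_on_compose2[OF assms]
        path_part_circlepath[unfolded path_def]) (auto simp: path_image_def)
  hence "(\<lambda>s. d s *\<^sub>C F (part_circlepath z r a b s)) integrable_on {0..1}" by (rule integrable_continuous_real)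
  then obtain I where "((\<lambda>s. d s *\<^sub>C F (part_circlepath z r a b s)) has_integral I) {0..1}" by blast
  hence "has_vector_contour_integral F I (part_circlepath z r a b)"
    unfolding has_vector_contour_integral_def
    by (rule has_integral_eq[rotated]) (simp add: vector_derivative_part_circlepath01 d_def)
  thus ?thesis ..
qed

lemma vector_derivative_affine_reparam:
  fixes p h :: "real \<Rightarrow> 'b::real_normed_vector"
  assumes h: "(h has_vector_derivative h') (at (2 * x + c))" and S: "open S" "x \<in> S"
    and eq: "\<And>t. t \<in> S \<Longrightarrow> p t = h (2 * t + c)" and x: "0 < x" "x < 1"
  shows "vector_derivative p (at x within {0..1}) = 2 *\<^sub>R h'"
proof -
  have "((\<lambda>t. 2 * t + c) has_vector_derivative 2) (at x)"
    by (auto intro!: derivative_eq_intros simp: has_real_derivative_iff_has_vector_derivative[symmetric])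
  from vector_diff_chain_at[OF this, of h h'] h have "((\<lambda>t. h (2 * t + c)) has_vector_derivative 2 *\<^sub>R h') (at x)"
    by (simp add: o_def)
  hence "(p has_vector_derivative 2 *\<^sub>R h') (at x)"
    by (rule has_vector_derivative_transform_within_open[OF _ S]) (simp add: eq)
  thus ?thesis using x by (intro vector_derivative_at_within_ivl) auto
qed

text \<open>Each half of \<open>g1 +++ g2\<close> runs at double speed; the factor 2 in the
  derivative cancels the 1/2 from the substitution, away from finitely many points.\<close>

lemma has_vector_contour_integral_join:
  assumes I1: "has_vector_contour_integral F I1 g1" and I2: "has_vector_contour_integral F I2 g2"
    and "valid_path g1" "valid_path g2"
  shows "has_vector_contour_integral F (I1 + I2) (g1 +++ g2)"
proof -
  define p where "p = g1 +++ g2"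
  define d where "d g s = vector_derivative g (at s within {0..1::real})" for g :: "real \<Rightarrow> complex" and s
  obtain s1 s2 where s1: "finite s1" "\<And>x. x \<in> {0..1} - s1 \<Longrightarrow> g1 differentiable at x"
      and s2: "finite s2" "\<And>x. x \<in> {0..1} - s2 \<Longrightarrow> g2 differentiable at x"
    using assms(3,4) by (auto simp: valid_path_def piecewise_C1_differentiable_on_def C1_differentiable_on_eq)
  have deriv: "(g has_vector_derivative d g x) (at x)" if "g differentiable at x" "0 \<le> x" "x \<le> 1" for g x
  proof -
    have g: "(g has_vector_derivative vector_derivative g (at x)) (at x)"
      using that(1) by (simp add: vector_derivative_works)
    have "d g x = vector_derivative g (at x)"
      unfolding d_def by (rule vector_derivative_at_within_ivl[OF g]) (use that in auto)
    thus ?thesis using g by simp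
  qed
  have "((\<lambda>s. d g1 (2 * s) *\<^sub>C F (g1 (2 * s))) has_integral (1 / 2) *\<^sub>R I1) {0..1/2}"
    using has_integral_affinity01[OF I1[unfolded has_vector_contour_integral_def], where m = 2 and c = 0]
    by (simp add: d_def image_affinity_atLeastAtMost_div_diff)
  from has_integral_cmul[OF this, of 2]
  have i1: "((\<lambda>s. 2 *\<^sub>R (d g1 (2 * s) *\<^sub>C F (g1 (2 * s)))) has_integral I1) {0..1/2}" by simp
  have "((\<lambda>s. d g2 (2 * s - 1) *\<^sub>C F (g2 (2 * s - 1))) has_integral (1 / 2) *\<^sub>R I2) {1/2..1}"
    using has_integral_affinity01[OF I2[unfolded has_vector_contour_integral_def], where m = 2 and c = "-1"]
    by (simp add: d_def image_affinity_atLeastAtMost_div)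
  from has_integral_cmul[OF this, of 2]
  have i2: "((\<lambda>s. 2 *\<^sub>R (d g2 (2 * s - 1) *\<^sub>C F (g2 (2 * s - 1)))) has_integral I2) {1/2..1}" by simp
  have "((\<lambda>s. d p s *\<^sub>C F (p s)) has_integral I1) {0..1/2}"
  proof (rule has_integral_spike_finite[OF _ _ i1])
    show "finite (insert 0 (insert (1/2) ((\<lambda>s. 2 * s + 0) -` s1)))"
      using s1 by (auto intro!: finite_vimageI inj_onI)
    fix x assume x: "x \<in> {0..1/2} - insert 0 (insert (1/2) ((\<lambda>s. 2 * s + 0) -` s1))"
    have "d p x = 2 *\<^sub>R d g1 (2 * x)"
      unfolding d_def[of p]
      by (rule vector_derivative_affine_reparam[of g1 _ x 0 "{..<1/2}"])
        (use x s1 in \<open>auto intro!: deriv simp: p_def joinpaths_def\<close>)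
    thus "d p x *\<^sub>C F (p x) = 2 *\<^sub>R (d g1 (2 * x) *\<^sub>C F (g1 (2 * x)))"
      using x by (simp add: p_def joinpaths_def scaleR_eq_scaleC scaleC_scaleC scaleR_conv_of_real)
  qed
  moreover have "((\<lambda>s. d p s *\<^sub>C F (p s)) has_integral I2) {1/2..1}"
  proof (rule has_integral_spike_finite[OF _ _ i2])
    show "finite (insert 1 (insert (1/2) ((\<lambda>s. 2 * s - 1) -` s2)))"
      using s2 by (auto intro!: finite_vimageI inj_onI)
    fix x assume x: "x \<in> {1/2..1} - insert 1 (insert (1/2) ((\<lambda>s. 2 * s - 1) -` s2))"
    have "d p x = 2 *\<^sub>R d g2 (2 * x + - 1)"
      unfolding d_def[of p]
      by (rule vector_derivative_affine_reparam[of g2 _ x "-1" "{1/2<..}"])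
        (use x s2 in \<open>auto intro!: deriv simp: p_def joinpaths_def\<close>)
    thus "d p x *\<^sub>C F (p x) = 2 *\<^sub>R (d g2 (2 * x - 1) *\<^sub>C F (g2 (2 * x - 1)))"
      using x by (simp add: p_def joinpaths_def scaleR_eq_scaleC scaleC_scaleC scaleR_conv_of_real)
  qed
  ultimately have "((\<lambda>s. d p s *\<^sub>C F (p s)) has_integral I1 + I2) {0..1}"
    by (rule has_integral_combine[rotated 2]) auto
  thus ?thesis by (simp add: has_vector_contour_integral_def p_def d_def)
qed

definition sector_contour :: "real \<Rightarrow> real \<Rightarrow> complex set" where
  "sector_contour r \<psi> = {of_real x * cis \<phi> | x \<phi>. r \<le> x \<and> \<bar>\<phi>\<bar> = \<psi>} \<union> {of_real r * cis \<phi> | \<phi>. \<bar>\<phi>\<bar> \<le> \<psi>}"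

lemma closed_segment_ray:
  assumes "z \<in> closed_segment (of_real a * cis \<phi>) (of_real b * cis \<phi>)" "a \<le> b"
  shows "\<exists>x. a \<le> x \<and> x \<le> b \<and> z = of_real x * cis \<phi>"
proof -
  obtain u where u: "0 \<le> u" "u \<le> 1" "z = (1 - u) *\<^sub>R (of_real a * cis \<phi>) + u *\<^sub>R (of_real b * cis \<phi>)"
    using assms(1) unfolding closed_segment_def by auto
  define x where "x = a + u * (b - a)"
  have "z = of_real x * cis \<phi>" by (simp add: u(3) x_def scaleR_conv_of_real algebra_simps)
  moreover have "a \<le> x" using u assms(2) by (simp add: x_def)
  moreover have "x \<le> b" using mult_right_mono[OF u(2), of "b - a"] assms(2) by (simp add: x_def)
  ultimately show ?thesis by blast
qed

lemma part_circlepath_endpoints: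
  "pathstart (part_circlepath 0 r a b) = of_real r * cis a" "pathfinish (part_circlepath 0 r a b) = of_real r * cis b"
  by (simp_all add: cis_conv_exp)

lemma truncated_contour_endpoints:
  "pathstart (truncated_contour r \<psi> R) = of_real R * cis (- \<psi>)"
  "pathfinish (truncated_contour r \<psi> R) = of_real R * cis \<psi>"
  by (simp_all add: truncated_contour_def)

lemma valid_path_truncated_contour: "valid_path (truncated_contour r \<psi> R)"
  unfolding truncated_contour_def
  by (intro valid_path_join) (simp_all add: cis_conv_exp)

lemma path_image_arc:
  assumes "\<bar>a\<bar> \<le> \<psi>" "\<bar>b\<bar> \<le> \<psi>" "z \<in> path_image (part_circlepath 0 r a b)"
  shows "\<exists>\<phi>. \<bar>\<phi>\<bar> \<le> \<psi> \<and> z = of_real r * cis \<phi>"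
proof -
  obtain \<phi> where "\<phi> \<in> closed_segment a b" "z = of_real r * cis \<phi>"
    using assms(3) unfolding path_image_part_circlepath' by auto
  thus ?thesis using assms(1,2) by (intro exI[of _ \<phi>]) (auto simp: closed_segment_eq_real_ivl split: if_splits)
qed

lemma path_image_truncated_contour:
  assumes "0 \<le> \<psi>" "r \<le> R" "z \<in> path_image (truncated_contour r \<psi> R)"
  shows "(\<exists>x \<phi>. r \<le> x \<and> x \<le> R \<and> \<bar>\<phi>\<bar> = \<psi> \<and> z = of_real x * cis \<phi>) \<or> (\<exists>\<phi>. \<bar>\<phi>\<bar> \<le> \<psi> \<and> z = of_real r * cis \<phi>)"
proof -
  have "z \<in> closed_segment (of_real r * cis (- \<psi>)) (of_real R * cis (- \<psi>)) \<or>
      z \<in> path_image (part_circlepath 0 r (- \<psi>) \<psi>) \<or>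
      z \<in> closed_segment (of_real r * cis \<psi>) (of_real R * cis \<psi>)"
    using assms(3) path_image_join_subset unfolding truncated_contour_def
    by (metis (no_types, lifting) UnE closed_segment_commute path_image_linepath subsetD)
  thus ?thesis
  proof (elim disjE)
    assume "z \<in> closed_segment (of_real r * cis (- \<psi>)) (of_real R * cis (- \<psi>))"
    from closed_segment_ray[OF this assms(2)] obtain x where x: "r \<le> x" "x \<le> R" "z = of_real x * cis (- \<psi>)" by blast
    show ?thesis by (intro disjI1 exI[of _ x] exI[of _ "- \<psi>"]) (use x assms(1) in auto)
  next
    assume "z \<in> path_image (part_circlepath 0 r (- \<psi>) \<psi>)"
    thus ?thesis using path_image_arc[of "- \<psi>" \<psi> \<psi> z r] assms(1) by auto
  next
    assume "z \<in> closed_segment (of_real r * cis \<psi>) (of_real R * cis \<psi>)"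
    from closed_segment_ray[OF this assms(2)] obtain x where x: "r \<le> x" "x \<le> R" "z = of_real x * cis \<psi>" by blast
    show ?thesis by (intro disjI1 exI[of _ x] exI[of _ "\<psi>"]) (use x assms(1) in auto)
  qed
qed

lemma path_image_truncated_contour_subset:
  assumes "0 \<le> \<psi>" "r \<le> R"
  shows "path_image (truncated_contour r \<psi> R) \<subseteq> sector_contour r \<psi>"
  using path_image_truncated_contour[OF assms] unfolding sector_contour_def by blast

lemma truncated_contour_integral_exists:
  assumes "0 \<le> \<psi>" "r \<le> R" and F: "continuous_on (sector_contour r \<psi>) F"
  shows "\<exists>I. has_vector_contour_integral F I (truncated_contour r \<psi> R)"
proof -
  note sub = path_image_truncated_contour_subset[OF assms(1,2)]
  have "path_image (truncated_contour r \<psi> R) =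
      closed_segment (of_real R * cis (- \<psi>)) (of_real r * cis (- \<psi>)) \<union>
      path_image (part_circlepath 0 r (- \<psi>) \<psi>) \<union> closed_segment (of_real r * cis \<psi>) (of_real R * cis \<psi>)"
    unfolding truncated_contour_def by (simp add: path_image_join part_circlepath_endpoints Un_assoc del: pathstart_part_circlepath pathfinish_part_circlepath)
  hence c: "continuous_on (closed_segment (of_real R * cis (- \<psi>)) (of_real r * cis (- \<psi>))) F"
      "continuous_on (path_image (part_circlepath 0 r (- \<psi>) \<psi>)) F"
      "continuous_on (closed_segment (of_real r * cis \<psi>) (of_real R * cis \<psi>)) F"
    using sub by (auto intro!: continuous_on_subset[OF F])
  obtain I1 where "has_vector_contour_integral F I1 (linepath (of_real R * cis (- \<psi>)) (of_real r * cis (- \<psi>)))"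
    using has_vector_contour_integral_linepath[OF c(1)] by blast
  moreover obtain I2 where "has_vector_contour_integral F I2 (part_circlepath 0 r (- \<psi>) \<psi>)"
    using has_vector_contour_integral_part_circlepath[OF c(2)] by blast
  moreover obtain I3 where "has_vector_contour_integral F I3 (linepath (of_real r * cis \<psi>) (of_real R * cis \<psi>))"
    using has_vector_contour_integral_linepath[OF c(3)] by blast
  ultimately have "has_vector_contour_integral F (I1 + (I2 + I3)) (truncated_contour r \<psi> R)"
    unfolding truncated_contour_def
    by (intro has_vector_contour_integral_join valid_path_join) (simp_all add: cis_conv_exp)
  thus ?thesis ..
qed

text \<open>The decay is assumed in the form \<open>C / x^2\<close> because its integral
  \<open>C * (1 / a - 1 / b)\<close> telescopes over consecutive radii.\<close>

lemma ray_integral_bound: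
  fixes a b \<phi> :: real
  assumes ab: "0 < a" "a \<le> b" and G: "continuous_on (closed_segment (of_real a * cis \<phi>) (of_real b * cis \<phi>)) G"
    and bound: "\<And>x. a \<le> x \<Longrightarrow> x \<le> b \<Longrightarrow> cmod (G (of_real x * cis \<phi>)) \<le> C / x\<^sup>2"
  shows "cmod (contour_integral (linepath (of_real a * cis \<phi>) (of_real b * cis \<phi>)) G) \<le> C * (1 / a - 1 / b)"
proof -
  define l where "l = linepath (of_real a * cis \<phi>) (of_real b * cis \<phi>)"
  define X where "X s = a + s * (b - a)" for s
  have l: "l s = of_real (X s) * cis \<phi>" for s
    by (simp add: l_def X_def linepath_def scaleR_conv_of_real algebra_simps)
  have X: "a \<le> X s" "X s \<le> b" if "0 \<le> s" "s \<le> 1" for s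
    using that ab mult_right_mono[of s 1 "b - a"] by (auto simp: X_def)
  have int: "(\<lambda>s. G (l s) * (of_real b * cis \<phi> - of_real a * cis \<phi>)) integrable_on {0..1}"
    unfolding l_def
    by (intro integrable_continuous_real continuous_intros continuous_on_compose2[OF G]) (auto simp: linepath_in_path)
  have "((\<lambda>s. C * (b - a) / (X s)\<^sup>2) has_integral (- C / X 1 - (- C / X 0))) {0..1}"
  proof (rule fundamental_theorem_of_calculus)
    fix s :: real assume s: "s \<in> {0..1}"
    hence "X s \<noteq> 0" using X(1)[of s] ab by auto
    hence "((\<lambda>s. - C / X s) has_real_derivative C * (b - a) / (X s)\<^sup>2) (at s)"
      unfolding X_def by (auto intro!: derivative_eq_intros simp: power2_eq_square)
    thus "((\<lambda>s. - C / X s) has_vector_derivative C * (b - a) / (X s)\<^sup>2) (at s within {0..1})"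
      using has_real_derivative_iff_has_vector_derivative has_vector_derivative_at_within by blast
  qed simp
  hence gi: "((\<lambda>s. C * (b - a) / (X s)\<^sup>2) has_integral (C * (1 / a - 1 / b))) {0..1}"
    by (simp add: X_def algebra_simps)
  have "norm (integral {0..1} (\<lambda>s. G (l s) * (of_real b * cis \<phi> - of_real a * cis \<phi>))) \<le> integral {0..1} (\<lambda>s. C * (b - a) / (X s)\<^sup>2)"
  proof (rule integral_norm_bound_integral[OF int])
    show "(\<lambda>s. C * (b - a) / (X s)\<^sup>2) integrable_on {0..1}" using gi by blast
    fix s :: real assume s: "s \<in> {0..1}"
    have "cmod (of_real b * cis \<phi> - of_real a * cis \<phi>) = b - a"
      using ab by (simp add: norm_mult flip: left_diff_distrib of_real_diff)
    moreover have "cmod (G (l s)) \<le> C / (X s)\<^sup>2" unfolding l using s X by (intro bound) auto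
    ultimately show "norm (G (l s) * (of_real b * cis \<phi> - of_real a * cis \<phi>)) \<le> C * (b - a) / (X s)\<^sup>2"
      unfolding norm_mult using mult_right_mono[of "cmod (G (l s))" "C / (X s)\<^sup>2" "b - a"] ab by simp
  qed
  also have "integral {0..1} (\<lambda>s. C * (b - a) / (X s)\<^sup>2) = C * (1 / a - 1 / b)" using gi by blast
  finally show ?thesis by (simp add: contour_integral_integral l_def)
qed

text \<open>The inner arc and the ray segments up to \<open>R\<close> cancel; two ray pieces between
  the radii remain, whence the factor 2.\<close>

lemma truncated_contour_integral_diff:
  fixes G :: "complex \<Rightarrow> complex"
  assumes "0 \<le> \<psi>" "0 < r" "r < R" "R \<le> R'" and G: "continuous_on (sector_contour r \<psi>) G"
    and bound: "\<And>x \<phi>. r \<le> x \<Longrightarrow> \<bar>\<phi>\<bar> = \<psi> \<Longrightarrow> cmod (G (of_real x * cis \<phi>)) \<le> C / x\<^sup>2"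
  shows "cmod (contour_integral (truncated_contour r \<psi> R') G - contour_integral (truncated_contour r \<psi> R) G)
    \<le> 2 * C * (1 / R - 1 / R')"
proof -
  have seg: "continuous_on (closed_segment (of_real a * cis \<phi>) (of_real b * cis \<phi>)) G"
    if "r \<le> a" "a \<le> b" "\<bar>\<phi>\<bar> = \<psi>" for a b \<phi>
  proof (rule continuous_on_subset[OF G], rule subsetI)
    fix z assume "z \<in> closed_segment (of_real a * cis \<phi>) (of_real b * cis \<phi>)"
    from closed_segment_ray[OF this that(2)] obtain x where "a \<le> x" "z = of_real x * cis \<phi>" by blast
    thus "z \<in> sector_contour r \<psi>" unfolding sector_contour_def using that by (intro UnI1 CollectI exI[of _ x] exI[of _ \<phi>]) auto
  qed
  define l where "l \<phi> a b = contour_integral (linepath (of_real a * cis \<phi>) (of_real b * cis \<phi>)) G" for \<phi> a b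
  have rev: "l \<phi> b a = - l \<phi> a b" for \<phi> a b
    unfolding l_def using contour_integral_reversepath[of "linepath (of_real a * cis \<phi>) (of_real b * cis \<phi>)" G] by simp
  have arc: "G contour_integrable_on part_circlepath 0 r (- \<psi>) \<psi>"
  proof (intro contour_integrable_continuous_part_circlepath continuous_on_subset[OF G] subsetI)
    fix z assume "z \<in> path_image (part_circlepath 0 r (- \<psi>) \<psi>)"
    thus "z \<in> sector_contour r \<psi>"
      using path_image_arc[of "- \<psi>" \<psi> \<psi> z r] assms(1) unfolding sector_contour_def by auto
  qed
  have eq: "contour_integral (truncated_contour r \<psi> \<rho>) G
      = l (- \<psi>) \<rho> r + (contour_integral (part_circlepath 0 r (- \<psi>) \<psi>) G + l \<psi> r \<rho>)" if "r \<le> \<rho>" for \<rho>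
  proof -
    have 1: "G contour_integrable_on linepath (of_real \<rho> * cis (- \<psi>)) (of_real r * cis (- \<psi>))"
      using seg[of r \<rho> "- \<psi>"] that assms(1)
      by (intro contour_integrable_continuous_linepath) (simp add: closed_segment_commute)
    have 3: "G contour_integrable_on linepath (of_real r * cis \<psi>) (of_real \<rho> * cis \<psi>)"
      using seg[of r \<rho> \<psi>] that assms(1) by (intro contour_integrable_continuous_linepath) simp
    have v: "valid_path (part_circlepath 0 r (- \<psi>) \<psi> +++ linepath (of_real r * cis \<psi>) (of_real \<rho> * cis \<psi>))"
      by (intro valid_path_join) (simp_all add: cis_conv_exp)
    show ?thesis unfolding truncated_contour_def l_def
      using 1 3 arc v by (simp add: contour_integrable_joinI)
  qed
  have split: "l \<phi> r R' = l \<phi> r R + l \<phi> R R'" if "\<bar>\<phi>\<bar> = \<psi>" for \<phi>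
    unfolding l_def
  proof (rule contour_integral_split_linepath[OF seg])
    define t where "t = (R - r) / (R' - r)"
    have "t * (R' - r) = R - r" using assms(3,4) by (simp add: t_def)
    hence "R = (1 - t) * r + t * R'" by (simp add: algebra_simps)
    hence "complex_of_real R = of_real ((1 - t) * r + t * R')" by simp
    hence "of_real R * cis \<phi> = (1 - t) *\<^sub>R (of_real r * cis \<phi>) + t *\<^sub>R (of_real R' * cis \<phi>)"
      by (simp only: scaleR_conv_of_real of_real_add of_real_mult) (simp add: algebra_simps)
    moreover have "0 \<le> t" "t \<le> 1" using assms(3,4) by (auto simp: t_def field_simps)
    ultimately show "of_real R * cis \<phi> \<in> closed_segment (of_real r * cis \<phi>) (of_real R' * cis \<phi>)"
      unfolding closed_segment_def by blast
  qed (use assms that in auto)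
  have le: "cmod (l \<phi> R R') \<le> C * (1 / R - 1 / R')" if "\<bar>\<phi>\<bar> = \<psi>" for \<phi>
    unfolding l_def by (rule ray_integral_bound) (use assms that bound seg in auto)
  have "contour_integral (truncated_contour r \<psi> R') G - contour_integral (truncated_contour r \<psi> R) G
     = l \<psi> R R' - l (- \<psi>) R R'"
    using assms(1-4) by (simp add: eq split rev[of _ "R'" r] rev[of _ R r])
  also have "cmod \<dots> \<le> C * (1 / R - 1 / R') + C * (1 / R - 1 / R')"
    using le[of \<psi>] le[of "- \<psi>"] assms(1) by (intro order_trans[OF norm_triangle_ineq4] add_mono) auto
  finally show ?thesis by simp
qed

section \<open>The closed contour and its winding number\<close>

text \<open>The outer arc is run with decreasing argument, so the curve goes clockwise around the
  region; hence the winding number \<open>- 1\<close>.\<close>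

definition closed_contour :: "real \<Rightarrow> real \<Rightarrow> real \<Rightarrow> real \<Rightarrow> complex" where
  "closed_contour r \<psi> R = truncated_contour r \<psi> R +++ part_circlepath 0 R \<psi> (- \<psi>)"

lemma valid_path_closed_contour: "valid_path (closed_contour r \<psi> R)"
  unfolding closed_contour_def
  by (intro valid_path_join valid_path_truncated_contour valid_path_part_circlepath)
    (simp add: truncated_contour_endpoints part_circlepath_endpoints del: pathstart_part_circlepath)

lemma closed_contour_closed: "pathfinish (closed_contour r \<psi> R) = pathstart (closed_contour r \<psi> R)"
  unfolding closed_contour_def
  by (simp add: truncated_contour_endpoints part_circlepath_endpoints del: pathfinish_part_circlepath)

lemma path_image_closed_contour:
  assumes "0 \<le> \<psi>" "r \<le> R" "z \<in> path_image (closed_contour r \<psi> R)"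
  shows "(\<exists>x \<phi>. r \<le> x \<and> x \<le> R \<and> \<bar>\<phi>\<bar> = \<psi> \<and> z = of_real x * cis \<phi>) \<or> (\<exists>\<phi>. \<bar>\<phi>\<bar> \<le> \<psi> \<and> z = of_real r * cis \<phi>)
    \<or> (\<exists>\<phi>. \<bar>\<phi>\<bar> \<le> \<psi> \<and> z = of_real R * cis \<phi>)"
proof -
  have "z \<in> path_image (truncated_contour r \<psi> R) \<or> z \<in> path_image (part_circlepath 0 R \<psi> (- \<psi>))"
    using assms(3) unfolding closed_contour_def by (metis path_image_join_subset subsetD UnE)
  thus ?thesis
    using path_image_truncated_contour[OF assms(1,2), of z] path_image_arc[of \<psi> \<psi> "- \<psi>" z R] assms(1) by auto
qed

lemma cis_in_halfplane:
  assumes "0 < x" "\<bar>\<phi>\<bar> < pi / 2"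
  shows "0 < Re (of_real x * cis \<phi>)"
  using assms cos_gt_zero_pi[of \<phi>] by (simp add: abs_less_iff)

lemma path_image_closed_contour_subset:
  assumes "0 \<le> \<psi>" "\<psi> < pi / 2" "0 < r" "r \<le> R"
  shows "path_image (closed_contour r \<psi> R) \<subseteq> {z. 0 < Re z} \<inter> cball 0 R"
proof
  fix z assume "z \<in> path_image (closed_contour r \<psi> R)"
  from path_image_closed_contour[OF assms(1,4) this] obtain x \<phi> where "r \<le> x" "x \<le> R" "\<bar>\<phi>\<bar> \<le> \<psi>" "z = of_real x * cis \<phi>"
    using assms by (metis order_refl)
  thus "z \<in> {z. 0 < Re z} \<inter> cball 0 R"
    using cis_in_halfplane[of x \<phi>] assms by (auto simp: norm_mult)
qed

lemma contour_integral_closed_contour: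
  assumes "G contour_integrable_on (truncated_contour r \<psi> R)" "G contour_integrable_on (part_circlepath 0 R \<psi> (- \<psi>))"
  shows "contour_integral (closed_contour r \<psi> R) G =
    contour_integral (truncated_contour r \<psi> R) G + contour_integral (part_circlepath 0 R \<psi> (- \<psi>)) G"
  unfolding closed_contour_def
  by (rule contour_integral_join[OF assms valid_path_truncated_contour valid_path_part_circlepath])

lemma cis_divide_polar:
  "x \<noteq> 0 \<Longrightarrow> (of_real y * cis a) / (of_real x * cis b) = of_real (y / x) * cis (a - b)"
  by (simp add: cis_divide[symmetric])

text \<open>Along the truncated contour \<open>Ln (1 - w/l)\<close> is a primitive of \<open>1/(w - l)\<close>, along the outer arc
  \<open>Ln (w/l - 1)\<close> is one; at the two common end points they differ by \<open>-i\<pi>\<close> and \<open>i\<pi>\<close>.\<close>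

lemma winding_number_closed_contour:
  assumes \<psi>: "\<psi> < pi / 2" and r: "0 < r" and x: "r < x" "x < R" and \<phi>: "\<bar>\<phi>\<bar> < \<psi>"
  shows "of_real x * cis \<phi> \<notin> path_image (closed_contour r \<psi> R)"
    and "winding_number (closed_contour r \<psi> R) (of_real x * cis \<phi>) = - 1"
proof -
  define l where "l = of_real x * cis \<phi>"
  have x0: "0 < x" using r x by simp
  have l0: "l \<noteq> 0" using x0 by (simp add: l_def)
  have \<psi>0: "0 \<le> \<psi>" "r \<le> R" using \<phi> x by auto
  have quot: "of_real y * cis a / l = of_real (y / x) * cis (a - \<phi>)" for y a
    unfolding l_def using x0 by (intro cis_divide_polar) simp
  have sin_pos: "0 < sin (a - \<phi>)" if "a = \<psi>" for a
    using that \<phi> \<psi> by (intro sin_gt_zero) (auto simp: abs_less_iff)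
  have sin_neg: "sin (a - \<phi>) < 0" if "a = - \<psi>" for a
  proof -
    have "0 < sin (\<phi> - a)" using that \<phi> \<psi> by (intro sin_gt_zero) (auto simp: abs_less_iff)
    thus ?thesis using sin_minus[of "\<phi> - a"] by simp
  qed
  have ImR: "Im (of_real y * cis a / l) = (y / x) * sin (a - \<phi>)" for y a unfolding quot by simp
  have ray: "Im (of_real y * cis a / l) \<noteq> 0" if "0 < y" "\<bar>a\<bar> = \<psi>" for y a
  proof -
    have "a = \<psi> \<or> a = - \<psi>" using that by linarith
    hence "sin (a - \<phi>) \<noteq> 0" using sin_pos[of a] sin_neg[of a] by auto
    thus ?thesis unfolding ImR using that x0 by simp
  qed
  have small: "cmod (of_real r * cis a / l) < 1" for a
    using r x by (simp add: quot norm_mult norm_divide)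
  have large: "1 < cmod (of_real R * cis a / l)" for a
    using r x by (simp add: quot norm_mult norm_divide)
  show notin: "of_real x * cis \<phi> \<notin> path_image (closed_contour r \<psi> R)"
  proof
    assume "of_real x * cis \<phi> \<in> path_image (closed_contour r \<psi> R)"
    from path_image_closed_contour[OF \<psi>0 this] show False
      unfolding l_def[symmetric]
    proof (elim disjE exE conjE)
      fix y a assume "l = of_real y * cis a" "\<bar>a\<bar> = \<psi>" "r \<le> y"
      thus False using ray[of y a] l0 r by simp
    next
      fix a assume "l = of_real r * cis a"
      thus False using small[of a] l0 by simp
    next
      fix a assume "l = of_real R * cis a"
      thus False using large[of a] l0 by simp
    qed
  qed
  define wp wm where "wp = of_real R * cis \<psi> / l - 1" and "wm = of_real R * cis (- \<psi>) / l - 1"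
  have Imp: "0 < Im wp" and Imm: "Im wm < 0"
  proof -
    have R: "0 < R / x" using x x0 by simp
    have "0 < R / x * sin (\<psi> - \<phi>)" by (intro mult_pos_pos R sin_pos) simp
    thus "0 < Im wp" unfolding wp_def minus_complex.simps ImR by simp
    have "R / x * sin (- \<psi> - \<phi>) < 0" by (intro mult_pos_neg R sin_neg) simp
    thus "Im wm < 0" unfolding wm_def minus_complex.simps ImR by simp
  qed
  have 1: "((\<lambda>w. 1 / (w - l)) has_contour_integral
      Ln (1 - pathfinish (truncated_contour r \<psi> R) / l) - Ln (1 - pathstart (truncated_contour r \<psi> R) / l)) (truncated_contour r \<psi> R)"
  proof (rule contour_integral_primitive[where S = "{w. 1 - w / l \<notin> \<real>\<^sub>\<le>\<^sub>0}"])
    fix w assume w: "w \<in> {w. 1 - w / l \<notin> \<real>\<^sub>\<le>\<^sub>0}"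
    hence "1 - w / l \<noteq> 0" by auto
    hence "w \<noteq> l" using l0 by auto
    have "((\<lambda>w. Ln (1 - w / l)) has_field_derivative (- 1 / l) / (1 - w / l)) (at w within {w. 1 - w / l \<notin> \<real>\<^sub>\<le>\<^sub>0})"
      using w l0 by (auto intro!: derivative_eq_intros simp: inverse_eq_divide mult.commute)
    moreover have "(- 1 / l) / (1 - w / l) = 1 / (w - l)" using l0 \<open>w \<noteq> l\<close> by (simp add: divide_simps)
    ultimately show "((\<lambda>w. Ln (1 - w / l)) has_field_derivative 1 / (w - l)) (at w within {w. 1 - w / l \<notin> \<real>\<^sub>\<le>\<^sub>0})" by simp
  next
    show "path_image (truncated_contour r \<psi> R) \<subseteq> {w. 1 - w / l \<notin> \<real>\<^sub>\<le>\<^sub>0}"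
    proof
      fix w assume "w \<in> path_image (truncated_contour r \<psi> R)"
      from path_image_truncated_contour[OF \<psi>0 this] show "w \<in> {w. 1 - w / l \<notin> \<real>\<^sub>\<le>\<^sub>0}"
      proof (elim disjE exE conjE)
        fix y a assume "w = of_real y * cis a" "\<bar>a\<bar> = \<psi>" "r \<le> y"
        thus ?thesis using ray[of y a] r by (auto simp: complex_nonpos_Reals_iff)
      next
        fix a assume "w = of_real r * cis a"
        hence "Re (w / l) < 1" using small[of a] complex_Re_le_cmod[of "w / l"] by simp
        thus ?thesis by (auto simp: complex_nonpos_Reals_iff)
      qed
    qed
  qed (rule valid_path_truncated_contour)
  have 2: "((\<lambda>w. 1 / (w - l)) has_contour_integral
      Ln (pathfinish (part_circlepath 0 R \<psi> (- \<psi>)) / l - 1) - Ln (pathstart (part_circlepath 0 R \<psi> (- \<psi>)) / l - 1)) (part_circlepath 0 R \<psi> (- \<psi>))"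
  proof (rule contour_integral_primitive[where S = "{w. w / l - 1 \<notin> \<real>\<^sub>\<le>\<^sub>0}"])
    fix w assume w: "w \<in> {w. w / l - 1 \<notin> \<real>\<^sub>\<le>\<^sub>0}"
    hence "w / l - 1 \<noteq> 0" by auto
    hence "w \<noteq> l" using l0 by auto
    have "((\<lambda>w. Ln (w / l - 1)) has_field_derivative (1 / l) / (w / l - 1)) (at w within {w. w / l - 1 \<notin> \<real>\<^sub>\<le>\<^sub>0})"
      using w l0 by (auto intro!: derivative_eq_intros simp: inverse_eq_divide mult.commute)
    moreover have "(1 / l) / (w / l - 1) = 1 / (w - l)" using l0 \<open>w \<noteq> l\<close> by (simp add: divide_simps)
    ultimately show "((\<lambda>w. Ln (w / l - 1)) has_field_derivative 1 / (w - l)) (at w within {w. w / l - 1 \<notin> \<real>\<^sub>\<le>\<^sub>0})" by simp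
  next
    show "path_image (part_circlepath 0 R \<psi> (- \<psi>)) \<subseteq> {w. w / l - 1 \<notin> \<real>\<^sub>\<le>\<^sub>0}"
    proof
      fix w assume "w \<in> path_image (part_circlepath 0 R \<psi> (- \<psi>))"
      then obtain a where a: "\<bar>a\<bar> \<le> \<psi>" "w = of_real R * cis a" using path_image_arc[of \<psi> \<psi> "- \<psi>" w R] \<psi>0 by auto
      show "w \<in> {w. w / l - 1 \<notin> \<real>\<^sub>\<le>\<^sub>0}"
      proof (rule CollectI, rule notI)
        assume "w / l - 1 \<in> \<real>\<^sub>\<le>\<^sub>0"
        hence im: "Im (w / l) = 0" and re: "Re (w / l) \<le> 1" by (auto simp: complex_nonpos_Reals_iff)
        have "R / x \<noteq> 0" using x r by simp
        hence "sin (a - \<phi>) = 0" using im unfolding a(2) ImR by (metis mult_eq_0_iff)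
        moreover have "- pi < a - \<phi>" "a - \<phi> < pi" using a(1) \<phi> \<psi> by linarith+
        ultimately have "a - \<phi> = 0" by (rule sin_eq_0_pi[rotated 2])
        hence "w / l = of_real (R / x)" unfolding a(2) quot by simp
        hence "R / x \<le> 1" using re by simp
        thus False using x x0 by simp
      qed
    qed
  qed simp
  have "wp \<noteq> 0" "wm \<noteq> 0" using Imp Imm by auto
  have "Ln (- wp) = Ln wp - \<i> * pi" using \<open>wp \<noteq> 0\<close> Ln_minus[of wp] Imp by auto
  moreover have "Ln (- wm) = Ln wm + \<i> * pi" using \<open>wm \<noteq> 0\<close> Ln_minus[of wm] Imm by auto
  moreover have "((\<lambda>w. 1 / (w - l)) has_contour_integral (Ln (- wp) - Ln (- wm)) + (Ln wm - Ln wp)) (closed_contour r \<psi> R)"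
    unfolding closed_contour_def
    using has_contour_integral_join[OF 1 2 valid_path_truncated_contour valid_path_part_circlepath]
    by (simp add: truncated_contour_endpoints part_circlepath_endpoints wp_def wm_def
        del: pathstart_part_circlepath pathfinish_part_circlepath)
  ultimately have "contour_integral (closed_contour r \<psi> R) (\<lambda>w. 1 / (w - l)) = - (2 * pi * \<i>)"
    by (simp add: contour_integral_unique)
  thus "winding_number (closed_contour r \<psi> R) (of_real x * cis \<phi>) = - 1"
    using winding_number_valid_path[OF valid_path_closed_contour notin] by (simp add: l_def)
qed

text \<open>The right half-plane serves as the domain: it is convex, it contains the whole contour
  because \<open>\<psi> < pi / 2\<close>, and the principal power is holomorphic on it.\<close>

lemma closed_contour_cauchy_formula:
  assumes \<psi>: "\<psi> < pi / 2" and r: "0 < r" and x: "r < x" "x < R" and \<phi>: "\<bar>\<phi>\<bar> < \<psi>"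
    and F: "F holomorphic_on {z. 0 < Re z}"
  defines "l \<equiv> of_real x * cis \<phi>"
  shows "contour_integral (closed_contour r \<psi> R) (\<lambda>z. F z / (z - l) ^ Suc n) = - 2 * pi * \<i> * ((deriv ^^ n) F l / fact n)"
proof -
  let ?S = "{z. 0 < Re z}"
  have S: "open ?S" "connected ?S" "convex ?S"
    by (simp_all add: open_halfspace_Re_gt convex_halfspace_Re_gt convex_connected)
  have "l \<in> ?S" using cis_in_halfplane[of x \<phi>] r x \<phi> \<psi> by (simp add: l_def)
  have sub: "path_image (closed_contour r \<psi> R) \<subseteq> ?S"
    using path_image_closed_contour_subset[of \<psi> r R] \<psi> r x \<phi> by auto
  have "contour_integral (closed_contour r \<psi> R) (\<lambda>z. F z / (z - l) ^ Suc n) =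
      2 * pi * \<i> * (\<Sum>p\<in>{l}. winding_number (closed_contour r \<psi> R) p * residue (\<lambda>z. F z / (z - l) ^ Suc n) p)"
  proof (rule Residue_theorem[OF S(1,2)])
    show "(\<lambda>z. F z / (z - l) ^ Suc n) holomorphic_on ?S - {l}"
      by (intro holomorphic_intros holomorphic_on_subset[OF F]) auto
    show "path_image (closed_contour r \<psi> R) \<subseteq> ?S - {l}"
      using sub winding_number_closed_contour(1)[OF \<psi> r x \<phi>] by (auto simp: l_def)
    show "\<forall>z. z \<notin> ?S \<longrightarrow> winding_number (closed_contour r \<psi> R) z = 0"
      using winding_number_zero_outside[OF valid_path_imp_path[OF valid_path_closed_contour] S(3) closed_contour_closed _ sub]
      by blast
  qed (auto simp: valid_path_closed_contour closed_contour_closed)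
  also have "\<dots> = 2 * pi * \<i> * (- 1 * ((deriv ^^ n) F l / fact n))"
    using winding_number_closed_contour(2)[OF \<psi> r x \<phi>] residue_holomorphic_over_power[OF S(1) \<open>l \<in> ?S\<close> F, of n]
    by (simp add: l_def)
  finally show ?thesis by simp
qed

section \<open>Derivatives under inversion\<close>

lemma higher_deriv_times_ident:
  assumes "g holomorphic_on S" "open S" "z \<in> S"
  shows "(deriv ^^ Suc n) (\<lambda>w. w * g w) z = z * (deriv ^^ Suc n) g z + of_nat (Suc n) * (deriv ^^ n) g z"
  using assms(3)
proof (induction n arbitrary: z)
  case 0
  have "g field_differentiable at z" using assms 0 by (metis holomorphic_on_open field_differentiable_def)
  thus ?case by (simp add: deriv_mult field_differentiable_ident)
next
  case (Suc n)
  have hol: "(deriv ^^ k) g holomorphic_on S" for k by (rule holomorphic_higher_deriv[OF assms(1,2)])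
  have fd: "((deriv ^^ k) g has_field_derivative (deriv ^^ Suc k) g z) (at z)" for k
    using holomorphic_derivI[OF hol assms(2) Suc.prems] by simp
  have "(deriv ^^ Suc (Suc n)) (\<lambda>w. w * g w) z = deriv ((deriv ^^ Suc n) (\<lambda>w. w * g w)) z" by simp
  also have "\<dots> = deriv (\<lambda>z. z * (deriv ^^ Suc n) g z + of_nat (Suc n) * (deriv ^^ n) g z) z"
    by (rule complex_derivative_transform_within_open[OF _ _ assms(2) Suc.prems Suc.IH])
      (auto intro!: holomorphic_intros hol holomorphic_higher_deriv assms simp del: funpow.simps)
  also have "\<dots> = z * (deriv ^^ Suc (Suc n)) g z + of_nat (Suc (Suc n)) * (deriv ^^ Suc n) g z"
    by (rule DERIV_imp_deriv) (auto intro!: derivative_eq_intros fd simp: algebra_simps simp del: funpow.simps)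
  finally show ?case .
qed

text \<open>Residues at \<open>1 / \<mu> q\<close> produce derivatives in \<open>z\<close> of
  \<open>z ^ n / z * \<Phi> z\<close>, whereas the coefficients of the series are derivatives in
  \<open>\<zeta> = 1 / z\<close>; this identity matches the two. The quotient
  \<open>z ^ n / z\<close> stands for the power \<open>n - 1\<close>, which is negative for
  \<open>n = 0\<close>.\<close>

lemma higher_deriv_inversion:
  assumes \<Phi>: "\<Phi> holomorphic_on {z. 0 < Re z}" and \<zeta>: "0 < Re \<zeta>"
  shows "(deriv ^^ n) (\<lambda>\<zeta>. \<Phi> (inverse \<zeta>)) \<zeta> =
    (- 1) ^ n * inverse \<zeta> ^ Suc n * (deriv ^^ n) (\<lambda>z. z ^ n / z * \<Phi> z) (inverse \<zeta>)"
  using \<zeta>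
proof (induction n arbitrary: \<zeta>)
  case 0
  then show ?case by auto
next
  case (Suc n)
  let ?S = "{z. 0 < Re z}"
  define h where "h z = z ^ n / z * \<Phi> z" for z
  have S: "open ?S" by (simp add: open_halfspace_Re_gt)
  have h: "h holomorphic_on ?S" unfolding h_def by (intro holomorphic_intros \<Phi>) auto
  have inv: "0 < Re (inverse z)" if "0 < Re z" for z
    using that by (simp add: add_pos_nonneg)
  define z where "z = inverse \<zeta>"
  have z: "0 < Re z" "\<zeta> \<noteq> 0" "z \<noteq> 0" using Suc.prems inv[of \<zeta>] by (auto simp: z_def)
  have fd: "((deriv ^^ n) h has_field_derivative (deriv ^^ Suc n) h z) (at z)"
    using holomorphic_derivI[OF holomorphic_higher_deriv[OF h S] S, of z n] z by simp
  have i: "(inverse has_field_derivative - (z\<^sup>2)) (at \<zeta>)"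
    using DERIV_inverse[OF z(2)] by (simp add: z_def power2_eq_square)
  have "((\<lambda>\<zeta>. inverse \<zeta> ^ Suc n) has_field_derivative of_nat (Suc n) * z ^ n * (- (z\<^sup>2))) (at \<zeta>)"
    using DERIV_power_Suc[OF i, of n] by (simp add: z_def mult_ac)
  moreover have "((\<lambda>\<zeta>. (deriv ^^ n) h (inverse \<zeta>)) has_field_derivative (deriv ^^ Suc n) h z * (- (z\<^sup>2))) (at \<zeta>)"
    by (rule DERIV_chain2[OF fd[unfolded z_def] i[unfolded z_def], folded z_def])
  ultimately have "((\<lambda>\<zeta>. (- 1) ^ n * (inverse \<zeta> ^ Suc n * (deriv ^^ n) h (inverse \<zeta>))) has_field_derivative
     (- 1) ^ n * ((of_nat (Suc n) * z ^ n * (- (z\<^sup>2))) * (deriv ^^ n) h z + (((deriv ^^ Suc n) h z) * (- (z\<^sup>2))) * z ^ Suc n)) (at \<zeta>)"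
    unfolding z_def by (intro DERIV_cmult DERIV_mult)
  moreover have "(deriv ^^ Suc n) (\<lambda>\<zeta>. \<Phi> (inverse \<zeta>)) \<zeta> = deriv (\<lambda>\<zeta>. (- 1) ^ n * (inverse \<zeta> ^ Suc n * (deriv ^^ n) h (inverse \<zeta>))) \<zeta>"
  proof -
    have "(deriv ^^ Suc n) (\<lambda>\<zeta>. \<Phi> (inverse \<zeta>)) \<zeta> = deriv ((deriv ^^ n) (\<lambda>\<zeta>. \<Phi> (inverse \<zeta>))) \<zeta>" by simp
    also have "\<dots> = deriv (\<lambda>\<zeta>. (- 1) ^ n * (inverse \<zeta> ^ Suc n * (deriv ^^ n) h (inverse \<zeta>))) \<zeta>"
    proof (rule deriv_cong_ev)
      have "\<forall>\<^sub>F w in nhds \<zeta>. w \<in> ?S" using Suc.prems S by (intro eventually_nhds_in_open) auto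
      thus "\<forall>\<^sub>F w in nhds \<zeta>. (deriv ^^ n) (\<lambda>\<zeta>. \<Phi> (inverse \<zeta>)) w = (- 1) ^ n * (inverse w ^ Suc n * (deriv ^^ n) h (inverse w))"
        by eventually_elim (use Suc.IH in \<open>simp add: h_def[abs_def] mult.assoc\<close>)
    qed simp
    finally show ?thesis .
  qed
  ultimately have "(deriv ^^ Suc n) (\<lambda>\<zeta>. \<Phi> (inverse \<zeta>)) \<zeta> =
     (- 1) ^ n * ((of_nat (Suc n) * z ^ n * (- (z\<^sup>2))) * (deriv ^^ n) h z + (((deriv ^^ Suc n) h z) * (- (z\<^sup>2))) * z ^ Suc n)"
    using DERIV_imp_deriv by simp
  also have "\<dots> = (- 1) ^ Suc n * z ^ Suc (Suc n) * (z * (deriv ^^ Suc n) h z + of_nat (Suc n) * (deriv ^^ n) h z)"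
    by (simp add: power2_eq_square algebra_simps)
  also have "z * (deriv ^^ Suc n) h z + of_nat (Suc n) * (deriv ^^ n) h z = (deriv ^^ Suc n) (\<lambda>w. w * h w) z"
    using higher_deriv_times_ident[OF h S, of z n] z by simp
  also have "(\<lambda>w. w * h w) = (\<lambda>z. z ^ Suc n / z * \<Phi> z)" by (auto simp: h_def fun_eq_iff)
  finally show ?case by (simp add: z_def)
qed

section \<open>The sector condition\<close>

text \<open>For a unit vector the right side is at least \<open>cmod (1 - z * w)\<close> with
  \<open>w = cinner (B v) v\<close>. The product \<open>z * w\<close> has argument within
  \<open>\<theta>\<close> of \<open>\<phi>\<close>, so it lies beyond a line through 0 that keeps
  the distance \<open>sin (\<psi> - \<theta>)\<close> from the point 1.\<close>

lemma sector_resolvent_bound: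
  assumes B: "cbounded_linear B" and num: "numerical_range B \<subseteq> sector \<theta>"
    and \<theta>: "0 \<le> \<theta>" "\<theta> < \<psi>" "\<psi> < pi / 2" and x: "0 \<le> x" and \<phi>: "\<bar>\<phi>\<bar> = \<psi>"
  shows "sin (\<psi> - \<theta>) * norm v \<le> norm (v - (of_real x * cis \<phi>) *\<^sub>C B v)"
proof -
  define z where "z = of_real x * cis \<phi>"
  note B' = cbounded_linear_simps[OF B]
  have unit: "sin (\<psi> - \<theta>) \<le> norm (v - z *\<^sub>C B v)" if v: "norm v = 1" for v
  proof -
    define w where "w = cinner (B v) v"
    define \<beta> where "\<beta> = Arg w"
    have "w \<in> sector \<theta>" using num v unfolding numerical_range_def w_def by blast
    hence \<beta>: "\<bar>\<beta>\<bar> \<le> \<theta>" by (simp add: sector_def \<beta>_def)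
    have w: "w = of_real (cmod w) * cis \<beta>"
      unfolding \<beta>_def by (metis rcis_cmod_Arg rcis_def)
    define \<sigma> :: real where "\<sigma> = (if 0 \<le> \<phi> then 1 else - 1)"
    have \<sigma>: "\<phi> = \<sigma> * \<psi>" using \<phi> by (auto simp: \<sigma>_def)
    \<comment> \<open>The unit normal of that line: up to the sign \<open>\<sigma>\<close>, it turns
      arguments between \<open>\<psi> - \<theta>\<close> and \<open>\<psi> + \<theta>\<close> into
      arguments between \<open>pi / 2\<close> and \<open>pi / 2 + 2 * \<theta>\<close>, where the
      real part is not positive.\<close>
    define u where "u = cis (\<sigma> * (pi / 2 - \<psi> + \<theta>))"
    have "Re u = cos (pi / 2 - (\<psi> - \<theta>))"
      by (simp add: u_def \<sigma>_def) (simp add: cos_diff cos_add algebra_simps)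
    hence Reu: "Re u = sin (\<psi> - \<theta>)" by (simp add: cos_diff)
    have "u * (z * w) = of_real (x * cmod w) * cis (\<sigma> * (pi / 2 + \<theta>) + \<beta>)"
    proof -
      have "cis (\<sigma> * (pi / 2 - \<psi> + \<theta>)) * cis (\<sigma> * \<psi>) * cis \<beta> = cis (\<sigma> * (pi / 2 + \<theta>) + \<beta>)"
        unfolding cis_mult by (rule arg_cong[of _ _ cis]) (simp add: algebra_simps)
      thus ?thesis by (subst w) (simp add: z_def u_def \<sigma> mult_ac)
    qed
    hence "Re (u * (z * w)) = x * cmod w * cos (\<sigma> * (pi / 2 + \<theta>) + \<beta>)" by simp
    also have "cos (\<sigma> * (pi / 2 + \<theta>) + \<beta>) = - sin (\<theta> + \<sigma> * \<beta>)"
    proof (cases "0 \<le> \<phi>")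
      case True
      hence "\<sigma> * (pi / 2 + \<theta>) + \<beta> = pi / 2 + (\<theta> + \<sigma> * \<beta>)" by (simp add: \<sigma>_def)
      thus ?thesis by (simp add: cos_add)
    next
      case False
      hence "\<sigma> * (pi / 2 + \<theta>) + \<beta> = - (pi / 2 + (\<theta> + \<sigma> * \<beta>))" by (simp add: \<sigma>_def)
      hence "cos (\<sigma> * (pi / 2 + \<theta>) + \<beta>) = cos (pi / 2 + (\<theta> + \<sigma> * \<beta>))" by (metis cos_minus)
      thus ?thesis by (simp add: cos_add)
    qed
    also have "x * cmod w * (- sin (\<theta> + \<sigma> * \<beta>)) \<le> 0"
    proof -
      have "\<bar>\<sigma> * \<beta>\<bar> \<le> \<theta>" using \<beta> by (simp add: \<sigma>_def abs_mult)
      hence "0 \<le> sin (\<theta> + \<sigma> * \<beta>)" using \<theta> by (intro sin_ge_zero) auto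
      thus ?thesis using x by simp
    qed
    finally have "sin (\<psi> - \<theta>) \<le> Re (u * (1 - z * w))" using Reu by (simp add: right_diff_distrib)
    also have "\<dots> \<le> cmod (u * (1 - z * w))" by (rule complex_Re_le_cmod)
    also have "\<dots> = cmod (1 - z * w)" by (simp add: norm_mult u_def)
    also have "1 - z * w = cinner (v - z *\<^sub>C B v) v"
      using v by (simp add: cinner.diff_left cinner_scaleC_left cinner_self w_def)
    also have "cmod \<dots> \<le> norm (v - z *\<^sub>C B v) * norm v" by (rule cmod_cinner_le)
    finally show ?thesis using v by simp
  qed
  show ?thesis
  proof (cases "v = 0")
    case False
    define c where "c = complex_of_real (inverse (norm v))"
    have c: "cmod c * norm v = 1" using False by (simp add: c_def norm_inverse)
    have "sin (\<psi> - \<theta>) \<le> norm (c *\<^sub>C v - z *\<^sub>C B (c *\<^sub>C v))" by (rule unit) (simp add: c)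
    also have "c *\<^sub>C v - z *\<^sub>C B (c *\<^sub>C v) = c *\<^sub>C (v - z *\<^sub>C B v)"
      by (simp add: B' scaleC.diff_right scaleC_scaleC mult.commute)
    also have "norm \<dots> = cmod c * norm (v - z *\<^sub>C B v)" by simp
    finally have "sin (\<psi> - \<theta>) * norm v \<le> cmod c * norm (v - z *\<^sub>C B v) * norm v" by (intro mult_right_mono) auto
    also have "\<dots> = (cmod c * norm v) * norm (v - z *\<^sub>C B v)" by (simp only: mult_ac)
    finally show ?thesis by (simp add: c z_def)
  qed (simp add: B' scaleC.zero_right)
qed

lemma eigenvalue_in_sector:
  assumes B: "cbounded_linear B" and num: "numerical_range B \<subseteq> sector \<theta>" and z: "z \<in> eigenvalues B"
  shows "\<bar>Arg z\<bar> \<le> \<theta>"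
proof -
  obtain x where x: "x \<noteq> 0" "B x = z *\<^sub>C x" using z unfolding eigenvalues_def by blast
  define v where "v = complex_of_real (inverse (norm x)) *\<^sub>C x"
  have v: "norm v = 1" using x by (simp add: v_def norm_inverse norm_divide)
  have "B v = z *\<^sub>C v"
    unfolding v_def by (simp add: cbounded_linear_simps[OF B] x scaleC_scaleC mult.commute)
  hence "cinner (B v) v = z" using v by (simp add: cinner_scaleC_left cinner_self)
  thus ?thesis using num v unfolding numerical_range_def sector_def by blast
qed

section \<open>Root vectors\<close>

lemma compact_operator_compose:
  assumes B: "compact_operator B" and P: "cbounded_linear P"
  shows "compact_operator (B \<circ> P)"
  unfolding compact_operator_def
proof (intro conjI allI impI)
  show "Vector_Spaces.linear scaleC scaleC (B \<circ> P)"
    using cbounded_linear_compose[OF compact_operator_cbounded_linear[OF B] P] by (simp add: cbounded_linear_def)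
  fix S :: "'a set" assume "bounded S"
  hence "bounded (P ` S)" using P bounded_linear_image by (auto simp: cbounded_linear_def)
  hence "compact (closure (B ` (P ` S)))" using B unfolding compact_operator_def by blast
  thus "compact (closure ((B \<circ> P) ` S))" by (simp add: image_comp)
qed

lemma sum_root_chain_reindex:
  fixes F :: "nat \<Rightarrow> nat \<Rightarrow> 'b::comm_monoid_add"
  shows "(\<Sum>i=0..k. \<Sum>n=0..i. F i n) = (\<Sum>j=0..k. \<Sum>n=0..k - j. F (j + n) n)"
  unfolding sum.Sigma[OF finite_atLeastAtMost ballI[OF finite_atLeastAtMost]]
    by (rule sum.reindex_bij_witness[where i = "\<lambda>(j, n). (j + n, n)" and j = "\<lambda>(i, n). (i - n, n)"]) auto

context
  fixes B :: "'a::chilbert_space \<Rightarrow> 'a"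
    and \<mu> :: "nat \<Rightarrow> complex" and m :: "nat \<Rightarrow> nat" and k :: "nat \<Rightarrow> nat \<Rightarrow> nat"
    and e g :: "nat \<Rightarrow> nat \<Rightarrow> nat \<Rightarrow> 'a"
  assumes compB: "compact_operator B" and rvs: "root_vector_system B \<mu> m k e g"
begin

private lemmas B' = compact_operator_cbounded_linear[OF compB]
private lemmas B_simps = cbounded_linear_simps[OF B']

private abbreviation "c \<equiv> root_coeff k e g"

private lemmas rvs_conjs = rvs[unfolded root_vector_system_def, THEN conjunct1]
  rvs[unfolded root_vector_system_def, THEN conjunct2, THEN conjunct1]
  rvs[unfolded root_vector_system_def, THEN conjunct2, THEN conjunct2, THEN conjunct1]
  rvs[unfolded root_vector_system_def, THEN conjunct2, THEN conjunct2, THEN conjunct2, THEN conjunct1]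
  rvs[unfolded root_vector_system_def, THEN conjunct2, THEN conjunct2, THEN conjunct2, THEN conjunct2, THEN conjunct1]
  rvs[unfolded root_vector_system_def, THEN conjunct2, THEN conjunct2, THEN conjunct2, THEN conjunct2, THEN conjunct2]

lemma root_system_bij: "bij_betw \<mu> {q. 1 \<le> q \<and> \<mu> q \<noteq> 0} (eigenvalues B - {0})"
  by (rule rvs_conjs(1))

lemma root_system_decreasing: "1 \<le> q \<Longrightarrow> norm (\<mu> (Suc q)) \<le> norm (\<mu> q)"
  using rvs_conjs(2) by blast

lemma root_system_index:
  assumes "1 \<le> q" "\<xi> \<in> {1..m q}"
  shows "\<mu> q \<noteq> 0"
proof
  assume "\<mu> q = 0"
  moreover have "m q = (if \<mu> q = 0 then 0 else complex_vector.dim (eigenspace B (\<mu> q)))"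
    using rvs_conjs(3) assms(1) by blast
  ultimately show False using assms(2) by simp
qed

private lemma biorth:
  assumes "1 \<le> q" "\<xi> \<in> {1..m q}" "i \<le> k q \<xi>" "1 \<le> q'" "\<xi>' \<in> {1..m q'}" "j \<le> k q' \<xi>'"
  shows "cinner (e q \<xi> i) (g q' \<xi>' j) \<noteq> 0 \<longleftrightarrow> q' = q \<and> \<xi>' = \<xi> \<and> j = k q \<xi> - i"
proof -
  have "\<forall>q\<ge>1. \<forall>\<xi>\<in>{1..m q}. \<forall>i\<in>{0..k q \<xi>}. \<forall>q'\<ge>1. \<forall>\<xi>'\<in>{1..m q'}. \<forall>j\<in>{0..k q' \<xi>'}.
        cinner (e q \<xi> i) (g q' \<xi>' j) \<noteq> 0 \<longleftrightarrow> q' = q \<and> \<xi>' = \<xi> \<and> j = k q \<xi> - i"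
    by (rule rvs_conjs(6))
  moreover have "i \<in> {0..k q \<xi>}" "j \<in> {0..k q' \<xi>'}" using assms by auto
  ultimately show ?thesis using assms by blast
qed

private lemma chains:
  assumes "1 \<le> q" "\<xi> \<in> {1..m q}"
  shows "jordan_chain B (\<mu> q) (k q \<xi>) (e q \<xi>)" "jordan_chain (cadjoint B) (cnj (\<mu> q)) (k q \<xi>) (g q \<xi>)"
  using rvs_conjs(5) assms by blast+

private lemma B_e:
  assumes "1 \<le> q" "\<xi> \<in> {1..m q}" "i \<le> k q \<xi>"
  shows "B (e q \<xi> i) = \<mu> q *\<^sub>C e q \<xi> i + (if i = 0 then 0 else e q \<xi> (i - 1))"
  using chains(1)[OF assms(1,2)] assms(3) unfolding jordan_chain_def by (cases i) auto

private lemma adj_g: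
  assumes "1 \<le> q" "\<xi> \<in> {1..m q}" "i \<le> k q \<xi>"
  shows "cadjoint B (g q \<xi> i) = cnj (\<mu> q) *\<^sub>C g q \<xi> i + (if i = 0 then 0 else g q \<xi> (i - 1))"
  using chains(2)[OF assms(1,2)] assms(3) unfolding jordan_chain_def by (cases i) auto

text \<open>Evaluating \<open>cinner (B (e q \<xi> (Suc i))) (g q \<xi> (k q \<xi> - i))\<close>
  directly and through the adjoint gives the two sides. With the pairings constant along a chain,
  the quotients \<open>root_coeff\<close> shift with factor exactly 1 under
  \<open>B\<close>.\<close>

private lemma norming_const:
  assumes q: "1 \<le> q" "\<xi> \<in> {1..m q}" and i: "Suc i \<le> k q \<xi>"
  shows "cinner (e q \<xi> (Suc i)) (g q \<xi> (k q \<xi> - Suc i)) = cinner (e q \<xi> i) (g q \<xi> (k q \<xi> - i))"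
proof -
  have z: "cinner (e q \<xi> (Suc i)) (g q \<xi> (k q \<xi> - i)) = 0"
    using biorth[OF q, of "Suc i" q \<xi> "k q \<xi> - i"] q i by auto
  have "cinner (B (e q \<xi> (Suc i))) (g q \<xi> (k q \<xi> - i)) = cinner (e q \<xi> i) (g q \<xi> (k q \<xi> - i))"
    using B_e[OF q i] z by (simp add: cinner_add_left cinner_scaleC_left)
  moreover have "cinner (B (e q \<xi> (Suc i))) (g q \<xi> (k q \<xi> - i)) = cinner (e q \<xi> (Suc i)) (g q \<xi> (k q \<xi> - Suc i))"
    using adj_g[OF q, of "k q \<xi> - i"] z i by (simp add: cadjoint[OF B'] cinner_add_right cinner_scaleC_right)
  ultimately show ?thesis by simp
qed

private lemma root_coeff_add: "c (x + y) q \<xi> i = c x q \<xi> i + c y q \<xi> i"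
  and root_coeff_scale: "c (a *\<^sub>C x) q \<xi> i = a * c x q \<xi> i"
  by (simp_all add: root_coeff_def cinner_add_left cinner_scaleC_left add_divide_distrib)

private lemma root_coeff_B:
  assumes q: "1 \<le> q" "\<xi> \<in> {1..m q}" and i: "i \<le> k q \<xi>"
  shows "c (B f) q \<xi> i = \<mu> q * c f q \<xi> i + (if i < k q \<xi> then c f q \<xi> (Suc i) else 0)"
proof -
  have "cinner (B f) (g q \<xi> (k q \<xi> - i)) = \<mu> q * cinner f (g q \<xi> (k q \<xi> - i)) +
      (if i < k q \<xi> then cinner f (g q \<xi> (k q \<xi> - Suc i)) else 0)"
    unfolding cadjoint[OF B'] adj_g[OF q diff_le_self]
    using i by (auto simp: cinner_add_right cinner_scaleC_right cinner.zero_right)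
  moreover have "i < k q \<xi> \<Longrightarrow> cinner (e q \<xi> (Suc i)) (g q \<xi> (k q \<xi> - Suc i)) = cinner (e q \<xi> i) (g q \<xi> (k q \<xi> - i))"
    using norming_const[OF q, of i] by simp
  ultimately show ?thesis by (auto simp: root_coeff_def add_divide_distrib)
qed

private lemma root_coeff_e:
  assumes "1 \<le> q" "\<xi> \<in> {1..m q}" "i \<le> k q \<xi>" "1 \<le> q'" "\<xi>' \<in> {1..m q'}" "j \<le> k q' \<xi>'"
  shows "c (e q' \<xi>' j) q \<xi> i = (if q' = q \<and> \<xi>' = \<xi> \<and> j = i then 1 else 0)"
proof -
  have "cinner (e q \<xi> i) (g q \<xi> (k q \<xi> - i)) \<noteq> 0" using biorth[OF assms(1-3) assms(1,2)] by simp
  moreover have "cinner (e q' \<xi>' j) (g q \<xi> (k q \<xi> - i)) \<noteq> 0 \<longleftrightarrow> q = q' \<and> \<xi> = \<xi>' \<and> k q \<xi> - i = k q' \<xi>' - j"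
    using biorth[OF assms(4-6) assms(1,2), of "k q \<xi> - i"] by simp
  ultimately show ?thesis using assms(3,6) by (auto simp: root_coeff_def)
qed

text \<open>The spectral projection onto the first \<open>N\<close> root subspaces, written through
  the biorthogonal system instead of a contour integral of the resolvent.\<close>

definition root_projection_on :: "nat \<Rightarrow> 'a \<Rightarrow> 'a" where
  "root_projection_on N f = (\<Sum>q = 1..N. \<Sum>\<xi> = 1..m q. \<Sum>i = 0..k q \<xi>. c f q \<xi> i *\<^sub>C e q \<xi> i)"

private abbreviation "P \<equiv> root_projection_on"

private lemma root_coeff_bound: "\<exists>K\<ge>0. \<forall>f. cmod (c f q \<xi> i) \<le> K * norm f"
proof -
  define d where "d = cinner (e q \<xi> i) (g q \<xi> (k q \<xi> - i))"
  have "cmod (c f q \<xi> i) \<le> (norm (g q \<xi> (k q \<xi> - i)) / cmod d) * norm f" for f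
    using divide_right_mono[OF cmod_cinner_le[of f "g q \<xi> (k q \<xi> - i)"], of "cmod d"]
    by (simp add: root_coeff_def d_def[symmetric] norm_divide mult.commute)
  thus ?thesis by (intro exI[of _ "norm (g q \<xi> (k q \<xi> - i)) / cmod d"]) auto
qed

lemma cbounded_linear_root_projection: "cbounded_linear (P N)"
proof -
  obtain K where K: "\<And>q \<xi> i. 0 \<le> K q \<xi> i" "\<And>q \<xi> i f. cmod (c f q \<xi> i) \<le> K q \<xi> i * norm f"
    using root_coeff_bound by metis
  show ?thesis
  proof (rule cbounded_linearI[where K = "\<Sum>q = 1..N. \<Sum>\<xi> = 1..m q. \<Sum>i = 0..k q \<xi>. K q \<xi> i * norm (e q \<xi> i)"])
    show "P N (x + y) = P N x + P N y" for x y
      by (simp add: root_projection_on_def root_coeff_add scaleC_add_left sum.distrib)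
    show "P N (a *\<^sub>C x) = a *\<^sub>C P N x" for a x
      by (simp add: root_projection_on_def root_coeff_scale scaleC_scaleC scaleC.sum_right)
    show "norm (P N x) \<le> (\<Sum>q = 1..N. \<Sum>\<xi> = 1..m q. \<Sum>i = 0..k q \<xi>. K q \<xi> i * norm (e q \<xi> i)) * norm x" for x
      unfolding root_projection_on_def sum_distrib_right
    proof (intro sum_norm_le)
      fix q \<xi> i
      show "norm (c x q \<xi> i *\<^sub>C e q \<xi> i) \<le> K q \<xi> i * norm (e q \<xi> i) * norm x"
        using mult_right_mono[OF K(2)[of x q \<xi> i] norm_ge_zero[of "e q \<xi> i"]] by (simp add: mult_ac)
    qed
  qed
qed

private lemmas P_simps = cbounded_linear_simps[OF cbounded_linear_root_projection]

text \<open>\<open>B\<close> sends each chain vector to a multiple of itself plus its predecessor,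
  and by \<open>root_coeff_B\<close> the coefficients shift correspondingly.\<close>

lemma root_projection_commutes: "B (P N f) = P N (B f)"
proof -
  have "(\<Sum>i = 0..k q \<xi>. c f q \<xi> i *\<^sub>C B (e q \<xi> i)) = (\<Sum>i = 0..k q \<xi>. c (B f) q \<xi> i *\<^sub>C e q \<xi> i)"
    if q: "1 \<le> q" "\<xi> \<in> {1..m q}" for q \<xi>
  proof -
    let ?l = "k q \<xi>"
    have "(\<Sum>i = 0..?l. c f q \<xi> i *\<^sub>C B (e q \<xi> i)) =
        (\<Sum>i = 0..?l. (\<mu> q * c f q \<xi> i) *\<^sub>C e q \<xi> i) + (\<Sum>i = 0..?l. if i = 0 then 0 else c f q \<xi> i *\<^sub>C e q \<xi> (i - 1))"
      unfolding sum.distrib[symmetric]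
      by (rule sum.cong) (auto simp: B_e[OF q] scaleC_add_right scaleC_scaleC mult.commute scaleC.zero_right)
    also have "(\<Sum>i = 0..?l. if i = 0 then 0 else c f q \<xi> i *\<^sub>C e q \<xi> (i - 1)) = (\<Sum>i<?l. c f q \<xi> (Suc i) *\<^sub>C e q \<xi> i)"
      by (simp add: atMost_atLeast0[symmetric] sum.atMost_shift)
    also have "\<dots> = (\<Sum>i = 0..?l. (if i < ?l then c f q \<xi> (Suc i) else 0) *\<^sub>C e q \<xi> i)"
      by (rule sum.mono_neutral_cong_left) (auto simp: scaleC.zero_left)
    also have "(\<Sum>i = 0..?l. (\<mu> q * c f q \<xi> i) *\<^sub>C e q \<xi> i) + \<dots> = (\<Sum>i = 0..?l. c (B f) q \<xi> i *\<^sub>C e q \<xi> i)"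
      unfolding sum.distrib[symmetric] by (rule sum.cong) (simp_all add: root_coeff_B[OF q] scaleC_add_left)
    finally show ?thesis .
  qed
  thus ?thesis by (simp add: root_projection_on_def B_simps)
qed

private lemma root_projection_e:
  assumes "1 \<le> q" "q \<le> N" "\<xi> \<in> {1..m q}" "i \<le> k q \<xi>"
  shows "P N (e q \<xi> i) = e q \<xi> i"
proof -
  have "P N (e q \<xi> i) = (\<Sum>q' = 1..N. \<Sum>\<xi>' = 1..m q'. \<Sum>j = 0..k q' \<xi>'.
      if q' = q then (if \<xi>' = \<xi> then (if j = i then e q \<xi> i else 0) else 0) else 0)"
    unfolding root_projection_on_def
  proof (intro sum.cong refl)
    fix q' \<xi>' j assume "q' \<in> {1..N}" "\<xi>' \<in> {1..m q'}" "j \<in> {0..k q' \<xi>'}"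
    thus "c (e q \<xi> i) q' \<xi>' j *\<^sub>C e q' \<xi>' j =
        (if q' = q then (if \<xi>' = \<xi> then (if j = i then e q \<xi> i else 0) else 0) else 0)"
      using root_coeff_e[of q' \<xi>' j q \<xi> i] assms by (auto simp: scaleC.zero_left scaleC_one)
  qed
  also have "\<dots> = (\<Sum>q' = 1..N. if q' = q then e q \<xi> i else 0)"
  proof (intro sum.cong refl)
    fix q'
    show "(\<Sum>\<xi>' = 1..m q'. \<Sum>j = 0..k q' \<xi>'. if q' = q then (if \<xi>' = \<xi> then (if j = i then e q \<xi> i else 0) else 0) else 0)
        = (if q' = q then e q \<xi> i else 0)"
    proof (cases "q' = q")
      case True
      have "(\<Sum>\<xi>' = 1..m q. \<Sum>j = 0..k q \<xi>'. if \<xi>' = \<xi> then (if j = i then e q \<xi> i else 0) else 0)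
          = (\<Sum>\<xi>' = 1..m q. if \<xi>' = \<xi> then e q \<xi> i else 0)"
        using assms(4) by (intro sum.cong refl) auto
      thus ?thesis using True assms(3) by simp
    qed simp
  qed
  also have "\<dots> = e q \<xi> i" using assms(1,2) by simp
  finally show ?thesis .
qed

lemma root_projection_idem: "P N (P N f) = P N f"
proof -
  have "P N (P N f) = (\<Sum>q = 1..N. \<Sum>\<xi> = 1..m q. \<Sum>i = 0..k q \<xi>. c f q \<xi> i *\<^sub>C P N (e q \<xi> i))"
    by (subst (2) root_projection_on_def) (simp add: P_simps)
  also have "\<dots> = P N f"
    unfolding root_projection_on_def[of N f] by (intro sum.cong refl) (simp add: root_projection_e)
  finally show ?thesis .
qed

private lemma root_projection_eigenvector:
  assumes q: "1 \<le> q" "q \<le> N" "\<mu> q \<noteq> 0" and w: "B w = \<mu> q *\<^sub>C w"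
  shows "P N w = w"
proof -
  have "((\<lambda>y. B y - \<mu> q *\<^sub>C y) ^^ 1) w = 0" using w by simp
  hence "w \<in> root_subspace B (\<mu> q)" unfolding root_subspace_def by blast
  moreover have "jordan_basis B (\<mu> q) (m q) (k q) (e q)"
    using rvs_conjs(4) q by blast
  ultimately have "w \<in> complex_vector.span ((\<lambda>(\<xi>, i). e q \<xi> i) ` (SIGMA \<xi>:{1..m q}. {0..k q \<xi>}))"
    by (simp add: jordan_basis_def Let_def)
  thus ?thesis
  proof (induction rule: complex_vector.span_induct_alt)
    case base
    show ?case by (simp add: P_simps)
  next
    case (step a x y)
    then obtain \<xi> i where "x = e q \<xi> i" "\<xi> \<in> {1..m q}" "i \<le> k q \<xi>" by auto
    thus ?case using step root_projection_e[OF q(1,2)] by (simp add: P_simps)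
  qed
qed

text \<open>Vanishes on the range of the projection and agrees with \<open>B\<close> on its kernel:
  the first \<open>N\<close> characteristic numbers disappear while compactness is kept.\<close>

definition deflated :: "nat \<Rightarrow> 'a \<Rightarrow> 'a" where
  "deflated N = B \<circ> (\<lambda>x. x - P N x)"

lemma compact_operator_deflated: "compact_operator (deflated N)"
  unfolding deflated_def
proof (rule compact_operator_compose[OF compB])
  obtain K where K: "0 < K" "\<And>x. norm (P N x) \<le> K * norm x"
    using cbounded_linear_bound[OF cbounded_linear_root_projection] by blast
  show "cbounded_linear (\<lambda>x. x - P N x)"
  proof (rule cbounded_linearI[where K = "1 + K"])
    show "norm (x - P N x) \<le> (1 + K) * norm x" for x
      using norm_triangle_ineq4[of x "P N x"] K(2)[of x] by (simp add: distrib_right)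
  qed (simp_all add: P_simps scaleC.diff_right)
qed

text \<open>A solution of \<open>x = z *\<^sub>C deflated N x\<close> satisfies
  \<open>P N x = 0\<close> because the projection commutes with \<open>B\<close>. If non-zero, it is
  thus an eigenvector of \<open>B\<close>, and not for one of the first \<open>N\<close>
  eigenvalues, whose eigenvectors the projection fixes.\<close>

lemma regular_deflated:
  assumes z: "\<And>q. N < q \<Longrightarrow> \<mu> q \<noteq> 0 \<Longrightarrow> z \<noteq> 1 / \<mu> q"
  shows "regular (deflated N) z"
proof -
  obtain s v where sys: "singular_system (deflated N) s v"
    using singular_system_exists[OF compact_operator_deflated] by blast
  show ?thesis
  proof (rule fredholm_alternative[OF compact_operator_deflated sys])
    fix x assume x: "x = z *\<^sub>C deflated N x"
    have "P N x = z *\<^sub>C P N (B (x - P N x))" by (subst x) (simp add: P_simps deflated_def)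
    also have "P N (B (x - P N x)) = B (P N (x - P N x))" by (simp add: root_projection_commutes)
    also have "P N (x - P N x) = 0" by (simp add: P_simps root_projection_idem)
    finally have Px: "P N x = 0" by (simp add: B_simps scaleC.zero_right)
    hence xB: "x = z *\<^sub>C B x" using x by (simp add: deflated_def)
    show "x = 0"
    proof (rule ccontr)
      assume "x \<noteq> 0"
      hence "z \<noteq> 0" using xB by (auto simp: scaleC.zero_left)
      have Bx: "B x = (1 / z) *\<^sub>C x"
        using \<open>z \<noteq> 0\<close> by (subst (2) xB) (simp add: scaleC_scaleC scaleC_one)
      hence "1 / z \<in> eigenvalues B - {0}" using \<open>x \<noteq> 0\<close> \<open>z \<noteq> 0\<close> unfolding eigenvalues_def by auto
      then obtain q where q: "1 \<le> q" "\<mu> q \<noteq> 0" "1 / z = \<mu> q"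
        using root_system_bij unfolding bij_betw_def by (metis (mono_tags, lifting) imageE mem_Collect_eq)
      hence "z = 1 / \<mu> q" by (metis div_by_1 divide_divide_eq_right mult_1)
      hence "q \<le> N" using z[of q] q(2) by (meson not_le)
      hence "P N x = x" using root_projection_eigenvector[OF q(1) _ q(2)] Bx q(3) by simp
      thus False using Px \<open>x \<noteq> 0\<close> by simp
    qed
  qed
qed

text \<open>Hence the resolvent of \<open>B\<close> applied to \<open>f - P N f\<close> continues holomorphically across the first \<open>N\<close>
  characteristic numbers.\<close>

lemma resolvent_deflated:
  assumes reg: "regular B z" "regular (deflated N) z"
  shows "resolvent_op B z (f - P N f) = resolvent_op (deflated N) z (f - P N f)"
proof (rule resolvent_op_unique[OF B' reg(1)])
  define x where "x = resolvent_op (deflated N) z (f - P N f)"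
  have x: "x - z *\<^sub>C deflated N x = f - P N f"
    unfolding x_def by (rule resolvent_op_eq[OF compact_operator_cbounded_linear[OF compact_operator_deflated] reg(2)])
  have "P N (deflated N x) = 0"
    by (simp add: deflated_def root_projection_commutes[symmetric] P_simps root_projection_idem B_simps)
  hence "P N x = P N (f - P N f)" using arg_cong[OF x, of "P N"] by (simp add: P_simps scaleC.zero_right)
  hence "P N x = 0" by (simp add: P_simps root_projection_idem)
  thus "x - z *\<^sub>C B x = f - P N f" using x by (simp add: deflated_def)
qed

text \<open>Back substitution: on a chain \<open>I - zB\<close> is triangular with
  \<open>1 - z * \<mu> q\<close> on the diagonal and \<open>- z\<close> beside it, so each step
  along the chain costs a factor \<open>z / (1 - z * \<mu> q)\<close>.\<close>

lemma resolvent_root_vector: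
  assumes reg: "regular B z" and z: "1 - z * \<mu> q \<noteq> 0" and q: "1 \<le> q" "\<xi> \<in> {1..m q}" and i: "i \<le> k q \<xi>"
  shows "resolvent_op B z (e q \<xi> i) = (\<Sum>n=0..i. (z ^ n / (1 - z * \<mu> q) ^ Suc n) *\<^sub>C e q \<xi> (i - n))"
  using i
proof (induction i)
  case 0
  let ?a = "1 - z * \<mu> q"
  have "(1 / ?a) *\<^sub>C e q \<xi> 0 - z *\<^sub>C B ((1 / ?a) *\<^sub>C e q \<xi> 0) = (1 / ?a - z * (1 / ?a) * \<mu> q) *\<^sub>C e q \<xi> 0"
    using B_e[OF q, of 0] by (simp add: B_simps scaleC_scaleC scaleC.diff_left)
  also have "1 / ?a - z * (1 / ?a) * \<mu> q = 1" using z by (simp add: divide_simps)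
  finally have "(1 / ?a) *\<^sub>C e q \<xi> 0 - z *\<^sub>C B ((1 / ?a) *\<^sub>C e q \<xi> 0) = e q \<xi> 0"
    by (simp only: scaleC_one)
  from resolvent_op_unique[OF B' reg this] show ?case by simp
next
  case (Suc i)
  let ?a = "1 - z * \<mu> q"
  define x where "x = resolvent_op B z (e q \<xi> i)"
  have x: "z *\<^sub>C B x = x - e q \<xi> i" using resolvent_op_eq[OF B' reg, of "e q \<xi> i"] by (simp add: x_def algebra_simps)
  define w where "w = (1 / ?a) *\<^sub>C (e q \<xi> (Suc i) + z *\<^sub>C x)"
  have "w - z *\<^sub>C B w = (1 / ?a) *\<^sub>C (e q \<xi> (Suc i) + z *\<^sub>C x - z *\<^sub>C (\<mu> q *\<^sub>C e q \<xi> (Suc i) + e q \<xi> i) - z *\<^sub>C (z *\<^sub>C B x))"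
    using B_e[OF q Suc.prems] by (simp add: w_def B_simps scaleC.diff_right scaleC_add_right scaleC_scaleC mult_ac)
  also have "e q \<xi> (Suc i) + z *\<^sub>C x - z *\<^sub>C (\<mu> q *\<^sub>C e q \<xi> (Suc i) + e q \<xi> i) - z *\<^sub>C (z *\<^sub>C B x) = ?a *\<^sub>C e q \<xi> (Suc i)"
    unfolding x by (simp add: scaleC.diff_right scaleC.diff_left scaleC_add_right scaleC_scaleC scaleC_one)
  finally have "w - z *\<^sub>C B w = e q \<xi> (Suc i)" using z by (simp add: scaleC_scaleC scaleC_one)
  hence "resolvent_op B z (e q \<xi> (Suc i)) = w" by (rule resolvent_op_unique[OF B' reg])
  also have "w = (1 / ?a) *\<^sub>C e q \<xi> (Suc i) + (\<Sum>n=0..i. (z / ?a * (z ^ n / ?a ^ Suc n)) *\<^sub>C e q \<xi> (i - n))"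
    using Suc by (simp add: w_def x_def scaleC_add_right scaleC.sum_right scaleC_scaleC)
  also have "\<dots> = (\<Sum>n=0..Suc i. (z ^ n / ?a ^ Suc n) *\<^sub>C e q \<xi> (Suc i - n))"
    by (simp add: sum.atLeast0_atMost_Suc_shift del: sum.cl_ivl_Suc)
  finally show ?case .
qed

end

section \<open>The closed contour integral of the resolvent\<close>

lemma regular_if_not_characteristic:
  assumes B: "compact_operator B" and z: "z \<notin> characteristic_numbers B"
  shows "regular B z"
proof -
  obtain s v where sys: "singular_system B s v" using singular_system_exists[OF B] by blast
  show ?thesis
  proof (rule fredholm_alternative[OF B sys], rule ccontr)
    fix x assume x: "x = z *\<^sub>C B x" "x \<noteq> 0"
    hence "z \<noteq> 0" by (auto simp: scaleC.zero_left)
    have "B x = (1 / z) *\<^sub>C x" using \<open>z \<noteq> 0\<close> by (subst (2) x(1)) (simp add: scaleC_scaleC scaleC_one)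
    hence "1 / z \<in> eigenvalues B" using x(2) unfolding eigenvalues_def by blast
    hence "1 / (1 / z) \<in> characteristic_numbers B" using \<open>z \<noteq> 0\<close> unfolding characteristic_numbers_def by force
    thus False using z by simp
  qed
qed

lemma not_regular_characteristic:
  assumes B: "cbounded_linear B" and "\<zeta> \<in> eigenvalues B" "\<zeta> \<noteq> 0"
  shows "\<not> regular B (1 / \<zeta>)"
proof
  assume reg: "regular B (1 / \<zeta>)"
  obtain x where x: "x \<noteq> 0" "B x = \<zeta> *\<^sub>C x" using assms(2) unfolding eigenvalues_def by blast
  have "x - (1 / \<zeta>) *\<^sub>C B x = 0 - (1 / \<zeta>) *\<^sub>C B 0"
    using assms(3) by (simp add: x scaleC_scaleC scaleC_one cbounded_linear_simps[OF B] scaleC.zero_right)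
  thus False using regular_inj[OF B reg] x(1) by blast
qed

lemma regular_on_ray:
  assumes B: "compact_operator B" and num: "numerical_range B \<subseteq> sector \<theta>"
    and \<theta>: "0 \<le> \<theta>" "\<theta> < \<psi>" "\<psi> < pi / 2" and x: "0 \<le> x" and \<phi>: "\<bar>\<phi>\<bar> = \<psi>"
  shows "regular B (of_real x * cis \<phi>)"
    and "norm (resolvent_op B (of_real x * cis \<phi>) f) \<le> norm f / sin (\<psi> - \<theta>)"
proof -
  note B' = compact_operator_cbounded_linear[OF B]
  have s: "0 < sin (\<psi> - \<theta>)" using \<theta> by (intro sin_gt_zero) auto
  note bound = sector_resolvent_bound[OF B' num \<theta> x \<phi>]
  obtain s' v where sys: "singular_system B s' v" using singular_system_exists[OF B] by blast
  show reg: "regular B (of_real x * cis \<phi>)"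
  proof (rule fredholm_alternative[OF B sys])
    fix w assume "w = (of_real x * cis \<phi>) *\<^sub>C B w"
    hence "sin (\<psi> - \<theta>) * norm w \<le> 0" using bound[of w] by simp
    thus "w = 0" using s by (simp add: mult_le_0_iff)
  qed
  show "norm (resolvent_op B (of_real x * cis \<phi>) f) \<le> norm f / sin (\<psi> - \<theta>)"
    using bound[of "resolvent_op B (of_real x * cis \<phi>) f", unfolded resolvent_op_eq[OF B' reg]] s
    by (simp add: pos_le_divide_eq mult.commute)
qed

text \<open>The partial sum of the blocks in the form in which residues deliver it: the exponentials
  in \<open>root_coeff_t\<close> and \<open>H_coeff\<close> cancel and leave plain derivatives of
  \<open>\<Phi> (inverse \<zeta>)\<close>.\<close>

definition root_sum ::
    "(nat \<Rightarrow> complex) \<Rightarrow> (nat \<Rightarrow> nat) \<Rightarrow> (nat \<Rightarrow> nat \<Rightarrow> nat) \<Rightarrow> (nat \<Rightarrow> nat \<Rightarrow> nat \<Rightarrow> 'a::chilbert_space) \<Rightarrow>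
     (nat \<Rightarrow> nat \<Rightarrow> nat \<Rightarrow> 'a) \<Rightarrow> (complex \<Rightarrow> complex) \<Rightarrow> 'a \<Rightarrow> nat \<Rightarrow> 'a" where
  "root_sum \<mu> m k e g \<Phi> f N = (\<Sum>q = 1..N. \<Sum>\<xi> = 1..m q. \<Sum>j = 0..k q \<xi>.
     (\<Sum>n=0..k q \<xi> - j. (deriv ^^ n) (\<lambda>\<zeta>. \<Phi> (inverse \<zeta>)) (\<mu> q) / fact n * root_coeff k e g f q \<xi> (j + n)) *\<^sub>C e q \<xi> j)"

context
  fixes B :: "'a::chilbert_space \<Rightarrow> 'a"
    and \<mu> :: "nat \<Rightarrow> complex" and m :: "nat \<Rightarrow> nat" and k :: "nat \<Rightarrow> nat \<Rightarrow> nat"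
    and e g :: "nat \<Rightarrow> nat \<Rightarrow> nat \<Rightarrow> 'a" and \<theta> \<psi> r :: real
  assumes compB: "compact_operator B" and rvs: "root_vector_system B \<mu> m k e g"
    and num: "numerical_range B \<subseteq> sector \<theta>" and angles: "0 \<le> \<theta>" "\<theta> < \<psi>" "\<psi> < pi / 2"
    and r: "0 < r" "characteristic_numbers B \<inter> cball 0 r = {}"
begin

private lemmas bounded_B = compact_operator_cbounded_linear[OF compB]

private lemma eigenvalue_mu:
  assumes "1 \<le> q" "\<mu> q \<noteq> 0"
  shows "\<mu> q \<in> eigenvalues B"
  using bij_betwE[OF root_system_bij[OF compB rvs]] assms by blast

private lemma mu_decreasing: "p \<le> q \<Longrightarrow> 1 \<le> p \<Longrightarrow> norm (\<mu> q) \<le> norm (\<mu> p)"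
proof (induction q rule: dec_induct)
  case (step q)
  thus ?case using root_system_decreasing[OF compB rvs, of q] by simp
qed simp

private lemma mu_polar:
  assumes "1 \<le> q" "\<mu> q \<noteq> 0"
  shows "1 / \<mu> q = of_real (1 / norm (\<mu> q)) * cis (- Arg (\<mu> q))" "\<bar>- Arg (\<mu> q)\<bar> < \<psi>" "r < 1 / norm (\<mu> q)"
    "0 < Re (\<mu> q)"
proof -
  have \<mu>: "\<mu> q = of_real (norm (\<mu> q)) * cis (Arg (\<mu> q))" by (metis rcis_cmod_Arg rcis_def)
  have "1 / (complex_of_real a * cis b) = of_real (1 / a) * cis (- b)" for a b
    unfolding divide_inverse inverse_mult_distrib cis_inverse of_real_mult of_real_inverse by simp
  thus "1 / \<mu> q = of_real (1 / norm (\<mu> q)) * cis (- Arg (\<mu> q))" using \<mu> by metis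
  have le: "\<bar>Arg (\<mu> q)\<bar> \<le> \<theta>" by (rule eigenvalue_in_sector[OF bounded_B num eigenvalue_mu[OF assms]])
  thus "\<bar>- Arg (\<mu> q)\<bar> < \<psi>" using angles by simp
  have "1 / \<mu> q \<in> characteristic_numbers B"
    using eigenvalue_mu[OF assms] assms(2) unfolding characteristic_numbers_def by blast
  hence "1 / \<mu> q \<notin> cball 0 r" using r(2) by blast
  thus "r < 1 / norm (\<mu> q)" by (simp add: norm_divide)
  have "0 < Re (of_real (norm (\<mu> q)) * cis (Arg (\<mu> q)))"
    by (rule cis_in_halfplane) (use assms le angles in auto)
  thus "0 < Re (\<mu> q)" using \<mu> by simp
qed

lemma regular_sector_contour:
  assumes "z \<in> sector_contour r \<psi>"
  shows "regular B z"
  using assms unfolding sector_contour_def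
proof (elim UnE CollectE exE conjE)
  fix x \<phi> assume "z = of_real x * cis \<phi>" "r \<le> x" "\<bar>\<phi>\<bar> = \<psi>"
  thus ?thesis using regular_on_ray(1)[OF compB num angles, of x \<phi>] r by simp
next
  fix \<phi> assume "z = of_real r * cis \<phi>"
  hence "z \<in> cball 0 r" using r by (simp add: norm_mult)
  thus ?thesis using regular_if_not_characteristic[OF compB] r(2) by blast
qed

lemma root_system_halfplane: "1 \<le> q \<Longrightarrow> \<mu> q \<noteq> 0 \<Longrightarrow> 0 < Re (\<mu> q)"
  by (rule mu_polar(4))

section \<open>Residues inside one closed contour\<close>

context
  fixes R :: real and N :: nat
  assumes R: "r < R" and reg: "\<And>z. cmod z = R \<Longrightarrow> regular B z"
    and sep: "\<And>q. 1 \<le> q \<Longrightarrow> \<mu> q \<noteq> 0 \<Longrightarrow> q \<le> N \<longleftrightarrow> 1 / norm (\<mu> q) < R"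
begin

private lemma regular_closed_contour:
  assumes "z \<in> path_image (closed_contour r \<psi> R)"
  shows "regular B z"
proof -
  have "0 \<le> \<psi>" "r \<le> R" using angles R by auto
  from path_image_closed_contour[OF this assms]
  consider "z \<in> sector_contour r \<psi>" | \<phi> where "z = of_real R * cis \<phi>"
    unfolding sector_contour_def by blast
  thus ?thesis
  proof cases
    case 2
    hence "cmod z = R" using r R by (simp add: norm_mult)
    thus ?thesis by (rule reg)
  qed (rule regular_sector_contour)
qed

private lemma path_image_closed_contour_halfplane:
  "path_image (closed_contour r \<psi> R) \<subseteq> {z. 0 < Re z} \<inter> cball 0 R"
  by (rule path_image_closed_contour_subset) (use angles r R in auto)

private lemma deflated_integral:
  assumes F: "F holomorphic_on {z. 0 < Re z}"
  shows "((\<lambda>z. F z * cinner (resolvent_op (deflated B m k e g N) z h) y) has_contour_integral 0) (closed_contour r \<psi> R)"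
proof -
  \<comment> \<open>By \<open>reg\<close> the circle of radius \<open>R\<close> itself carries no
    characteristic number, so those with index above \<open>N\<close> stay outside a strictly larger
    disc. If \<open>\<mu> (Suc N) = 0\<close>, none are left and any larger radius serves.\<close>
  obtain R1 where R1: "R < R1" "\<And>q. N < q \<Longrightarrow> \<mu> q \<noteq> 0 \<Longrightarrow> R1 \<le> 1 / norm (\<mu> q)"
  proof (cases "\<mu> (Suc N) = 0")
    case True
    have "\<mu> q = 0" if "N < q" for q
      using mu_decreasing[of "Suc N" q] that True by simp
    thus ?thesis using that[of "R + 1"] by simp
  next
    case False
    have "R \<le> 1 / norm (\<mu> (Suc N))" using sep[of "Suc N"] False by simp
    moreover have "R \<noteq> 1 / norm (\<mu> (Suc N))"
      using reg[of "1 / \<mu> (Suc N)"] not_regular_characteristic[OF bounded_B eigenvalue_mu[of "Suc N"] False] False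
      by (auto simp: norm_divide)
    moreover have "1 / norm (\<mu> (Suc N)) \<le> 1 / norm (\<mu> q)" if "N < q" "\<mu> q \<noteq> 0" for q
      using mu_decreasing[of "Suc N" q] that False by (intro divide_left_mono mult_pos_pos) auto
    ultimately show ?thesis using that[of "1 / norm (\<mu> (Suc N))"] by simp
  qed
  let ?S = "{z. 0 < Re z} \<inter> ball 0 R1"
  have "regular (deflated B m k e g N) z" if "z \<in> ?S" for z
  proof (rule regular_deflated[OF compB rvs])
    fix q assume "N < q" "\<mu> q \<noteq> 0"
    thus "z \<noteq> 1 / \<mu> q" using R1(2)[of q] that by (auto simp: norm_divide)
  qed
  hence "(\<lambda>z. F z * cinner (resolvent_op (deflated B m k e g N) z h) y) holomorphic_on ?S"
    by (intro holomorphic_on_mult holomorphic_on_subset[OF F]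
        holomorphic_on_resolvent_op[OF compact_operator_cbounded_linear[OF compact_operator_deflated[OF compB rvs]]]) auto
  thus ?thesis
  proof (rule Cauchy_theorem_convex_simple)
    show "convex ?S" by (intro convex_Int convex_halfspace_Re_gt convex_ball)
    show "path_image (closed_contour r \<psi> R) \<subseteq> ?S" using path_image_closed_contour_halfplane R1(1) by auto
  qed (simp_all add: valid_path_closed_contour closed_contour_closed)
qed

private lemma root_vector_integral:
  assumes \<Phi>: "\<Phi> holomorphic_on {z. 0 < Re z}" and q: "1 \<le> q" "q \<le> N" "\<xi> \<in> {1..m q}" and i: "i \<le> k q \<xi>"
  shows "((\<lambda>z. \<Phi> z / z * cinner (resolvent_op B z (e q \<xi> i)) y) has_contour_integral
    2 * pi * \<i> * (\<Sum>n=0..i. (deriv ^^ n) (\<lambda>\<zeta>. \<Phi> (inverse \<zeta>)) (\<mu> q) / fact n * cinner (e q \<xi> (i - n)) y))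
    (closed_contour r \<psi> R)"
proof -
  have \<mu>0: "\<mu> q \<noteq> 0" by (rule root_system_index[OF compB rvs q(1,3)])
  define l where "l = 1 / \<mu> q"
  define x where "x = 1 / norm (\<mu> q)"
  define \<phi> where "\<phi> = - Arg (\<mu> q)"
  have l: "l = of_real x * cis \<phi>" "\<bar>\<phi>\<bar> < \<psi>" "r < x" "0 < Re (\<mu> q)"
    using mu_polar[OF q(1) \<mu>0] by (simp_all add: l_def x_def \<phi>_def)
  have x: "x < R" using sep[OF q(1) \<mu>0] q(2) by (simp add: x_def)
  have l0: "l \<noteq> 0" "inverse (\<mu> q) = l" "\<mu> q = inverse l" using \<mu>0 by (auto simp: l_def divide_inverse)
  have notin: "l \<notin> path_image (closed_contour r \<psi> R)"
    unfolding l(1) by (rule winding_number_closed_contour(1)[OF angles(3) r(1) l(3) x l(2)])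
  have step: "((\<lambda>z. \<Phi> z / z * (z ^ n / (1 - z * \<mu> q) ^ Suc n * w)) has_contour_integral
      2 * pi * \<i> * ((deriv ^^ n) (\<lambda>\<zeta>. \<Phi> (inverse \<zeta>)) (\<mu> q) / fact n * w)) (closed_contour r \<psi> R)" for n w
  proof -
    define h where "h z = z ^ n / z * \<Phi> z" for z
    have h: "h holomorphic_on {z. 0 < Re z}" unfolding h_def by (intro holomorphic_intros \<Phi>) auto
    have "(\<lambda>z. h z / (z - l) ^ Suc n) contour_integrable_on (closed_contour r \<psi> R)"
    proof (rule contour_integrable_holomorphic_simple)
      show "(\<lambda>z. h z / (z - l) ^ Suc n) holomorphic_on {z. 0 < Re z} - {l}"
        by (intro holomorphic_intros holomorphic_on_subset[OF h]) auto
      show "open ({z. 0 < Re z} - {l})" by (intro open_delete open_halfspace_Re_gt)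
      show "path_image (closed_contour r \<psi> R) \<subseteq> {z. 0 < Re z} - {l}"
        using path_image_closed_contour_halfplane notin by auto
    qed (rule valid_path_closed_contour)
    hence "((\<lambda>z. h z / (z - l) ^ Suc n) has_contour_integral - 2 * pi * \<i> * ((deriv ^^ n) h l / fact n)) (closed_contour r \<psi> R)"
      using has_contour_integral_integral closed_contour_cauchy_formula[OF angles(3) r(1) l(3) x l(2) h, of n] l(1) by metis
    \<comment> \<open>With \<open>l = 1 / \<mu> q\<close> one has
      \<open>1 - z * \<mu> q = (z - l) / (- l)\<close>, which accounts for the power of
      \<open>- l\<close>.\<close>
    from has_contour_integral_lmul[OF this, of "(- l) ^ Suc n * w"]
    have int: "((\<lambda>z. (- l) ^ Suc n * w * (h z / (z - l) ^ Suc n)) has_contour_integral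
        (- l) ^ Suc n * w * (- 2 * pi * \<i> * ((deriv ^^ n) h l / fact n))) (closed_contour r \<psi> R)" .
    \<comment> \<open>The minus sign of the clockwise contour cancels the one by which
      \<open>(- l) ^ Suc n\<close> differs from the factor in the inversion formula.\<close>
    have val: "(- l) ^ Suc n * w * (- 2 * pi * \<i> * ((deriv ^^ n) h l / fact n)) =
        2 * pi * \<i> * ((deriv ^^ n) (\<lambda>\<zeta>. \<Phi> (inverse \<zeta>)) (\<mu> q) / fact n * w)"
    proof -
      have d: "(deriv ^^ n) (\<lambda>\<zeta>. \<Phi> (inverse \<zeta>)) (\<mu> q) = (- 1) ^ n * l ^ Suc n * (deriv ^^ n) h l"
        unfolding higher_deriv_inversion[OF \<Phi> l(4)] l0(2) h_def[abs_def] ..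
      have "(- l) ^ Suc n = (- 1) ^ Suc n * l ^ Suc n" by (rule power_minus)
      hence s: "(- l) ^ Suc n = - ((- 1) ^ n * l ^ Suc n)" by simp
      show ?thesis unfolding d s by (simp add: mult_ac)
    qed
    have "((\<lambda>z. (- l) ^ Suc n * w * (h z / (z - l) ^ Suc n)) has_contour_integral
        2 * pi * \<i> * ((deriv ^^ n) (\<lambda>\<zeta>. \<Phi> (inverse \<zeta>)) (\<mu> q) / fact n * w)) (closed_contour r \<psi> R)"
      using int unfolding val .
    thus ?thesis
    proof (rule has_contour_integral_eq)
      fix z assume "z \<in> path_image (closed_contour r \<psi> R)"
      hence "z \<noteq> l" using notin by blast
      have "(1 - z * \<mu> q) * (- l) = z - l" using l0 by (simp add: l0(3) algebra_simps)
      hence "(1 - z * \<mu> q) ^ Suc n * (- l) ^ Suc n = (z - l) ^ Suc n" by (metis power_mult_distrib)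
      moreover have "(z - l) ^ Suc n \<noteq> 0" using \<open>z \<noteq> l\<close> by simp
      ultimately have "(- l) ^ Suc n / (z - l) ^ Suc n = 1 / (1 - z * \<mu> q) ^ Suc n"
        by (metis div_by_1 divide_divide_eq_left' mult_eq_0_iff nonzero_mult_div_cancel_right divide_self_if mult.commute)
      hence "h z * w * ((- l) ^ Suc n / (z - l) ^ Suc n) = h z * w * (1 / (1 - z * \<mu> q) ^ Suc n)" by (rule arg_cong)
      thus "(- l) ^ Suc n * w * (h z / (z - l) ^ Suc n) = \<Phi> z / z * (z ^ n / (1 - z * \<mu> q) ^ Suc n * w)"
        by (simp add: h_def mult_ac)
    qed
  qed
  have "((\<lambda>z. \<Sum>n\<in>{0..i}. \<Phi> z / z * (z ^ n / (1 - z * \<mu> q) ^ Suc n * cinner (e q \<xi> (i - n)) y)) has_contour_integral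
     (\<Sum>n\<in>{0..i}. 2 * pi * \<i> * ((deriv ^^ n) (\<lambda>\<zeta>. \<Phi> (inverse \<zeta>)) (\<mu> q) / fact n * cinner (e q \<xi> (i - n)) y))) (closed_contour r \<psi> R)"
    by (intro has_contour_integral_sum step) simp
  hence "((\<lambda>z. \<Phi> z / z * cinner (resolvent_op B z (e q \<xi> i)) y) has_contour_integral
     (\<Sum>n\<in>{0..i}. 2 * pi * \<i> * ((deriv ^^ n) (\<lambda>\<zeta>. \<Phi> (inverse \<zeta>)) (\<mu> q) / fact n * cinner (e q \<xi> (i - n)) y))) (closed_contour r \<psi> R)"
  proof (rule has_contour_integral_eq)
    fix z assume z: "z \<in> path_image (closed_contour r \<psi> R)"
    have "1 - z * \<mu> q \<noteq> 0"
    proof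
      assume "1 - z * \<mu> q = 0"
      hence "z = l" using \<mu>0 by (simp add: l_def eq_divide_eq)
      thus False using z notin by simp
    qed
    thus "(\<Sum>n\<in>{0..i}. \<Phi> z / z * (z ^ n / (1 - z * \<mu> q) ^ Suc n * cinner (e q \<xi> (i - n)) y))
        = \<Phi> z / z * cinner (resolvent_op B z (e q \<xi> i)) y"
      by (simp add: resolvent_root_vector[OF compB rvs regular_closed_contour[OF z] _ q(1,3) i]
          cinner.sum_left cinner_scaleC_left sum_distrib_left del: power_Suc)
  qed
  thus ?thesis by (simp only: sum_distrib_left)
qed

text \<open>Since \<open>z *\<^sub>C B (resolvent_op B z f)\<close> is
  \<open>resolvent_op B z f - f\<close>, the integrand acquires the quotient
  \<open>\<Phi> z / z\<close>. The finite-rank part of \<open>f\<close> gives the residues; the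
  deflated part and the term with \<open>f\<close> itself are holomorphic on convex sets containing
  the contour and integrate to 0.\<close>

lemma closed_contour_resolvent_integral:
  assumes \<Phi>: "\<Phi> holomorphic_on {z. 0 < Re z}"
  shows "((\<lambda>z. \<Phi> z * cinner (B (resolvent_op B z f)) y) has_contour_integral 2 * pi * \<i> * cinner (root_sum \<mu> m k e g \<Phi> f N) y)
    (closed_contour r \<psi> R)"
proof -
  let ?c = "root_coeff k e g f" and ?P = "root_projection_on m k e g N f"
  define D where "D q n = (deriv ^^ n) (\<lambda>\<zeta>. \<Phi> (inverse \<zeta>)) (\<mu> q) / fact n" for q n
  have F: "(\<lambda>z. \<Phi> z / z) holomorphic_on {z. 0 < Re z}" by (intro holomorphic_intros \<Phi>) auto
  have 1: "((\<lambda>z. \<Sum>q\<in>{1..N}. \<Sum>\<xi>\<in>{1..m q}. \<Sum>i\<in>{0..k q \<xi>}. ?c q \<xi> i * (\<Phi> z / z * cinner (resolvent_op B z (e q \<xi> i)) y))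
    has_contour_integral
    (\<Sum>q\<in>{1..N}. \<Sum>\<xi>\<in>{1..m q}. \<Sum>i\<in>{0..k q \<xi>}. ?c q \<xi> i * (2 * pi * \<i> * (\<Sum>n=0..i. D q n * cinner (e q \<xi> (i - n)) y)))) (closed_contour r \<psi> R)"
    unfolding D_def
    by (intro has_contour_integral_sum has_contour_integral_lmul root_vector_integral[OF \<Phi>]) auto
  have val: "(\<Sum>q\<in>{1..N}. \<Sum>\<xi>\<in>{1..m q}. \<Sum>i\<in>{0..k q \<xi>}. ?c q \<xi> i * (2 * pi * \<i> * (\<Sum>n=0..i. D q n * cinner (e q \<xi> (i - n)) y)))
    = 2 * pi * \<i> * cinner (root_sum \<mu> m k e g \<Phi> f N) y"
  proof -
    have "(\<Sum>i\<in>{0..k q \<xi>}. ?c q \<xi> i * (2 * pi * \<i> * (\<Sum>n=0..i. D q n * cinner (e q \<xi> (i - n)) y)))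
       = 2 * pi * \<i> * (\<Sum>j=0..k q \<xi>. (\<Sum>n=0..k q \<xi> - j. D q n * ?c q \<xi> (j + n)) * cinner (e q \<xi> j) y)" for q \<xi>
    proof -
      have "(\<Sum>i=0..k q \<xi>. \<Sum>n=0..i. ?c q \<xi> i * (D q n * cinner (e q \<xi> (i - n)) y))
        = (\<Sum>j=0..k q \<xi>. \<Sum>n=0..k q \<xi> - j. ?c q \<xi> (j + n) * (D q n * cinner (e q \<xi> (j + n - n)) y))"
        by (rule sum_root_chain_reindex)
      moreover have "(\<Sum>i\<in>{0..k q \<xi>}. ?c q \<xi> i * (2 * pi * \<i> * (\<Sum>n=0..i. D q n * cinner (e q \<xi> (i - n)) y)))
        = 2 * pi * \<i> * (\<Sum>i=0..k q \<xi>. \<Sum>n=0..i. ?c q \<xi> i * (D q n * cinner (e q \<xi> (i - n)) y))"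
        by (simp add: sum_distrib_left mult_ac)
      moreover have "2 * pi * \<i> * (\<Sum>j=0..k q \<xi>. \<Sum>n=0..k q \<xi> - j. ?c q \<xi> (j + n) * (D q n * cinner (e q \<xi> (j + n - n)) y))
        = 2 * pi * \<i> * (\<Sum>j=0..k q \<xi>. (\<Sum>n=0..k q \<xi> - j. D q n * ?c q \<xi> (j + n)) * cinner (e q \<xi> j) y)"
        by (simp add: sum_distrib_left sum_distrib_right mult_ac)
      ultimately show ?thesis by (simp only:)
    qed
    thus ?thesis
      by (simp add: root_sum_def D_def cinner.sum_left cinner_scaleC_left sum_distrib_left)
  qed
  have 2: "((\<lambda>z. \<Phi> z / z * cinner (resolvent_op (deflated B m k e g N) z (f - ?P)) y) has_contour_integral 0) (closed_contour r \<psi> R)"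
    by (rule deflated_integral[OF F])
  have 3: "((\<lambda>z. \<Phi> z / z * cinner f y) has_contour_integral 0) (closed_contour r \<psi> R)"
  proof (rule Cauchy_theorem_convex_simple)
    show "(\<lambda>z. \<Phi> z / z * cinner f y) holomorphic_on {z. 0 < Re z}" by (intro holomorphic_intros F)
    show "path_image (closed_contour r \<psi> R) \<subseteq> {z. 0 < Re z}" using path_image_closed_contour_halfplane by auto
  qed (simp_all add: convex_halfspace_Re_gt valid_path_closed_contour closed_contour_closed)
  from has_contour_integral_diff[OF has_contour_integral_add[OF 1 2] 3]
  have "((\<lambda>z. (\<Sum>q\<in>{1..N}. \<Sum>\<xi>\<in>{1..m q}. \<Sum>i\<in>{0..k q \<xi>}. ?c q \<xi> i * (\<Phi> z / z * cinner (resolvent_op B z (e q \<xi> i)) y))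
     + \<Phi> z / z * cinner (resolvent_op (deflated B m k e g N) z (f - ?P)) y - \<Phi> z / z * cinner f y)
    has_contour_integral 2 * pi * \<i> * cinner (root_sum \<mu> m k e g \<Phi> f N) y) (closed_contour r \<psi> R)"
    by (simp only: val add_0_right diff_zero)
  thus ?thesis
  proof (rule has_contour_integral_eq)
    fix z assume z: "z \<in> path_image (closed_contour r \<psi> R)"
    note regz = regular_closed_contour[OF z]
    note U = cbounded_linear_simps[OF cbounded_linear_resolvent_op[OF bounded_B regz]]
    have z0: "z \<noteq> 0" using z path_image_closed_contour_halfplane by auto
    have regd: "regular (deflated B m k e g N) z"
    proof (rule regular_deflated[OF compB rvs])
      fix q assume q: "N < q" "\<mu> q \<noteq> 0"
      thus "z \<noteq> 1 / \<mu> q" using not_regular_characteristic[OF bounded_B eigenvalue_mu[of q] q(2)] regz by auto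
    qed
    have "resolvent_op B z f = resolvent_op B z ?P + resolvent_op B z (f - ?P)" by (simp add: U)
    also have "resolvent_op B z (f - ?P) = resolvent_op (deflated B m k e g N) z (f - ?P)"
      by (rule resolvent_deflated[OF compB rvs regz regd])
    also have "resolvent_op B z ?P = (\<Sum>q = 1..N. \<Sum>\<xi> = 1..m q. \<Sum>i = 0..k q \<xi>. ?c q \<xi> i *\<^sub>C resolvent_op B z (e q \<xi> i))"
      by (simp add: root_projection_on_def[OF compB rvs] U)
    finally have Rf: "resolvent_op B z f = (\<Sum>q = 1..N. \<Sum>\<xi> = 1..m q. \<Sum>i = 0..k q \<xi>. ?c q \<xi> i *\<^sub>C resolvent_op B z (e q \<xi> i))
       + resolvent_op (deflated B m k e g N) z (f - ?P)" .
    have "z *\<^sub>C B (resolvent_op B z f) = resolvent_op B z f - f"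
      using resolvent_op_eq[OF bounded_B regz, of f] by (simp add: algebra_simps)
    hence zB: "z * cinner (B (resolvent_op B z f)) y = cinner (resolvent_op B z f) y - cinner f y"
      by (metis cinner_scaleC_left cinner.diff_left)
    have "\<Phi> z * cinner (B (resolvent_op B z f)) y = \<Phi> z / z * (z * cinner (B (resolvent_op B z f)) y)"
      using z0 by simp
    also have "\<dots> = \<Phi> z / z * (cinner (resolvent_op B z f) y - cinner f y)" by (simp only: zB)
    also have "\<dots> = (\<Sum>q\<in>{1..N}. \<Sum>\<xi>\<in>{1..m q}. \<Sum>i\<in>{0..k q \<xi>}. ?c q \<xi> i * (\<Phi> z / z * cinner (resolvent_op B z (e q \<xi> i)) y))
     + \<Phi> z / z * cinner (resolvent_op (deflated B m k e g N) z (f - ?P)) y - \<Phi> z / z * cinner f y"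
      unfolding Rf cinner_add_left cinner.sum_left cinner_scaleC_left right_diff_distrib distrib_left sum_distrib_left
      by (simp add: mult_ac)
    finally show "(\<Sum>q\<in>{1..N}. \<Sum>\<xi>\<in>{1..m q}. \<Sum>i\<in>{0..k q \<xi>}. ?c q \<xi> i * (\<Phi> z / z * cinner (resolvent_op B z (e q \<xi> i)) y))
     + \<Phi> z / z * cinner (resolvent_op (deflated B m k e g N) z (f - ?P)) y - \<Phi> z / z * cinner f y = \<Phi> z * cinner (B (resolvent_op B z f)) y" by simp
  qed
qed

end

section \<open>Choice of the radii\<close>

text \<open>If \<open>B\<close> has only finitely many eigenvalues, \<open>N\<close> keeps increasing through indices with \<open>\<mu> q = 0\<close>.\<close>

lemma radii_exist:
  assumes \<alpha>: "0 < \<alpha>" and so: "singular_number B \<in> o(\<lambda>n. real (Suc n) powr (- 1 / \<alpha>))"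
  shows "\<exists>N R. N 0 = 0 \<and> strict_mono N \<and> (\<forall>n. R n \<le> R (Suc n)) \<and>
    (\<forall>n\<ge>1. r < R n \<and> real n \<le> R n \<and>
      (\<forall>q\<ge>1. \<mu> q \<noteq> 0 \<longrightarrow> (q \<le> N n \<longleftrightarrow> 1 / norm (\<mu> q) < R n)) \<and>
      (\<forall>z. cmod z = R n \<longrightarrow> regular B z \<and> (\<forall>x. norm x \<le> exp (1 / real n * R n powr \<alpha>) * norm (x - z *\<^sub>C B x))))"
proof -
  define good where "good n N R \<longleftrightarrow> r < R \<and> real n \<le> R \<and>
      (\<forall>q\<ge>1. \<mu> q \<noteq> 0 \<longrightarrow> (q \<le> N \<longleftrightarrow> 1 / norm (\<mu> q) < R)) \<and>
      (\<forall>z. cmod z = R \<longrightarrow> regular B z \<and> (\<forall>x. norm x \<le> exp (1 / real n * R powr \<alpha>) * norm (x - z *\<^sub>C B x)))"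
    for n :: nat and N :: nat and R :: real
  have step: "\<exists>N' R'. good (Suc n) N' R' \<and> N < N' \<and> R \<le> R'" for n N R
  proof -
    \<comment> \<open>The sum is at least each of the first \<open>Suc N\<close> moduli
      \<open>1 / norm (\<mu> q)\<close>, so that \<open>Suc N\<close> can be counted as inside; a
      padded \<open>\<mu> q = 0\<close> contributes 0. The other summands give monotonicity of the
      radii and the lower bounds \<open>r\<close> and \<open>Suc n\<close>.\<close>
    define R0 where "R0 = 1 + \<bar>R\<bar> + r + real (Suc n) + (\<Sum>q = 1..Suc N. 1 / norm (\<mu> q))"
    have "0 < 1 / real (Suc n)" by simp
    then obtain \<rho> where \<rho>: "R0 \<le> \<rho>" "\<And>z. cmod z = \<rho> \<Longrightarrow> regular B z"
        "\<And>z x. cmod z = \<rho> \<Longrightarrow> norm x \<le> exp (1 / real (Suc n) * \<rho> powr \<alpha>) * norm (x - z *\<^sub>C B x)"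
      using resolvent_growth[OF compB so \<alpha>, of "1 / real (Suc n)" R0] by blast
    have sum0: "0 \<le> (\<Sum>q = 1..Suc N. 1 / norm (\<mu> q))" by (intro sum_nonneg) simp
    define A where "A = {q. 1 \<le> q \<and> \<mu> q \<noteq> 0 \<and> 1 / norm (\<mu> q) < \<rho>}"
    have finA: "finite A"
    proof (rule inj_on_finite)
      obtain s v where sys: "singular_system B s v" using singular_system_exists[OF compB] by blast
      show "finite {z. cmod z \<le> \<rho> \<and> \<not> regular B z}" by (rule finite_singular_points[OF compB sys])
      show "inj_on (\<lambda>q. 1 / \<mu> q) A"
      proof (rule inj_onI)
        fix p q assume "p \<in> A" "q \<in> A" "1 / \<mu> p = 1 / \<mu> q"
        thus "p = q" using inj_onD[OF bij_betw_imp_inj_on[OF root_system_bij[OF compB rvs]], of p q]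
          by (auto simp: A_def)
      qed
      show "(\<lambda>q. 1 / \<mu> q) ` A \<subseteq> {z. cmod z \<le> \<rho> \<and> \<not> regular B z}"
        using not_regular_characteristic[OF bounded_B eigenvalue_mu] by (auto simp: A_def norm_divide)
    qed
    \<comment> \<open>The last index inside the circle; \<open>Suc N\<close> is inserted for the
      case \<open>\<mu> (Suc N) = 0\<close>, which the separation condition ignores.\<close>
    define N' where "N' = Max (insert (Suc N) A)"
    have N': "Suc N \<le> N'" "\<And>q. q \<in> A \<Longrightarrow> q \<le> N'"
      unfolding N'_def using finA by (auto intro!: Max_ge)
    have N'_in: "N' \<in> insert (Suc N) A" unfolding N'_def by (rule Max_in) (use finA in auto)
    have "q \<le> N' \<longleftrightarrow> 1 / norm (\<mu> q) < \<rho>" if q: "1 \<le> q" "\<mu> q \<noteq> 0" for q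
    proof
      assume "1 / norm (\<mu> q) < \<rho>"
      thus "q \<le> N'" using N'(2) q by (simp add: A_def)
    next
      assume le: "q \<le> N'"
      show "1 / norm (\<mu> q) < \<rho>"
      proof (cases "q \<le> Suc N")
        case True
        have "1 / norm (\<mu> q) \<le> (\<Sum>q = 1..Suc N. 1 / norm (\<mu> q))"
          using True q by (intro member_le_sum) auto
        thus ?thesis using \<rho>(1) r(1) by (simp add: R0_def)
      next
        case False
        hence "N' \<in> A" using N'_in le by auto
        hence A: "\<mu> N' \<noteq> 0" "1 / norm (\<mu> N') < \<rho>" by (auto simp: A_def)
        have "1 / norm (\<mu> q) \<le> 1 / norm (\<mu> N')"
          using mu_decreasing[OF le q(1)] A q by (intro divide_left_mono) auto
        thus ?thesis using A by simp
      qed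
    qed
    hence "good (Suc n) N' \<rho>" unfolding good_def using \<rho> r(1) sum0 by (auto simp: R0_def)
    moreover have "N < N'" using N'(1) by simp
    moreover have "R \<le> \<rho>" using \<rho>(1) r(1) sum0 by (simp add: R0_def)
    ultimately show ?thesis by blast
  qed
  \<comment> \<open>At stage 0 only \<open>N 0 = 0\<close> is demanded; the exponent
    \<open>1 / real n\<close> makes sense from \<open>n = 1\<close> on.\<close>
  define P where "P n x \<longleftrightarrow> (if n = 0 then fst x = 0 else good n (fst x) (snd x))" for n :: nat and x :: "nat \<times> real"
  have "\<exists>f. \<forall>n. P n (f n) \<and> (fst (f n) < fst (f (Suc n)) \<and> snd (f n) \<le> snd (f (Suc n)))"
  proof (rule dependent_nat_choice)
    show "\<exists>x. P 0 x" by (simp add: P_def)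
    fix x n assume "P n x"
    obtain N' R' where "good (Suc n) N' R'" "fst x < N'" "snd x \<le> R'" using step[of n "fst x" "snd x"] by blast
    thus "\<exists>y. P (Suc n) y \<and> fst x < fst y \<and> snd x \<le> snd y"
      by (intro exI[of _ "(N', R')"]) (simp add: P_def)
  qed
  then obtain F where F: "\<And>n. P n (F n)" "\<And>n. fst (F n) < fst (F (Suc n))" "\<And>n. snd (F n) \<le> snd (F (Suc n))" by blast
  have "good n (fst (F n)) (snd (F n))" if "1 \<le> n" for n using F(1)[of n] that by (simp add: P_def)
  moreover have "fst (F 0) = 0" using F(1)[of 0] by (simp add: P_def)
  moreover have "strict_mono (\<lambda>n. fst (F n))" using F(2) by (intro strict_monoI_Suc)
  ultimately show ?thesis
    using F(3) unfolding good_def by (intro exI[of _ "\<lambda>n. fst (F n)"] exI[of _ "\<lambda>n. snd (F n)"]) blast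
qed

end

section \<open>The exponential factor\<close>

lemma powr_polar:
  assumes "0 < x" "\<bar>\<phi>\<bar> < pi"
  shows "(of_real x * cis \<phi>) powr of_real \<alpha> = of_real (x powr \<alpha>) * cis (\<alpha> * \<phi>)"
proof -
  have "Ln (of_real x * cis \<phi>) = of_real (ln x) + \<i> * of_real \<phi>"
    by (rule Ln_unique) (use assms in \<open>auto simp: exp_add exp_of_real cis_conv_exp abs_less_iff\<close>)
  moreover have "of_real x * cis \<phi> \<noteq> 0" using assms by simp
  ultimately have "(of_real x * cis \<phi>) powr of_real \<alpha> = exp (of_real (\<alpha> * ln x)) * exp (\<i> * of_real (\<alpha> * \<phi>))"
    by (simp add: powr_def exp_add[symmetric] algebra_simps)
  moreover have "exp (of_real (\<alpha> * ln x)) = complex_of_real (x powr \<alpha>)"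
    unfolding exp_of_real using assms by (simp add: powr_def)
  ultimately show ?thesis by (simp only: cis_conv_exp)
qed

text \<open>Cosine decreases on the interval from 0 to \<open>pi\<close>, so the edges of the sector
  give the slowest decay.\<close>

lemma norm_exp_minus_powr_le:
  assumes "0 < x" "\<bar>\<phi>\<bar> \<le> \<psi>" "\<psi> < pi" "0 < \<alpha>" "\<alpha> * \<psi> \<le> pi" "0 \<le> t"
  shows "cmod (exp (- ((of_real x * cis \<phi>) powr of_real \<alpha>) * of_real t)) \<le> exp (- (t * cos (\<alpha> * \<psi>)) * x powr \<alpha>)"
proof -
  have "\<bar>\<alpha> * \<phi>\<bar> \<le> \<alpha> * \<psi>" using assms by (simp add: abs_mult)
  hence "cos (\<alpha> * \<psi>) \<le> cos \<bar>\<alpha> * \<phi>\<bar>" using assms by (intro cos_monotone_0_pi_le) auto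
  hence "cos (\<alpha> * \<psi>) * (t * x powr \<alpha>) \<le> cos (\<alpha> * \<phi>) * (t * x powr \<alpha>)"
    using assms by (intro mult_right_mono) auto
  moreover have "(of_real x * cis \<phi>) powr of_real \<alpha> = of_real (x powr \<alpha>) * cis (\<alpha> * \<phi>)"
    by (rule powr_polar) (use assms in auto)
  hence "Re (- ((of_real x * cis \<phi>) powr of_real \<alpha>) * of_real t) = - (cos (\<alpha> * \<phi>) * (t * x powr \<alpha>))"
    by simp
  ultimately show ?thesis unfolding norm_exp_eq_Re by (simp only: exp_le_cancel_iff) (simp add: mult_ac)
qed

lemma holomorphic_exp_minus_powr:
  "(\<lambda>z. exp (- (z powr of_real \<alpha>) * of_real t)) holomorphic_on {z. 0 < Re z}"
  by (intro holomorphic_intros) (auto simp: complex_nonpos_Reals_iff)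

text \<open>The factor \<open>x\<close> pays for the length of the arcs, and \<open>C / x^2\<close>
  is both summable along radii \<open>R n \<ge> n\<close> and of the form that telescopes along the
  rays.\<close>

lemma exp_minus_powr_decay:
  fixes a \<alpha> r :: real
  assumes "0 < a" "0 < \<alpha>" "0 < r"
  shows "\<exists>C\<ge>0. \<forall>x\<ge>r. x * exp (- a * x powr \<alpha>) \<le> C / x\<^sup>2"
proof -
  have "((\<lambda>x. x ^ 3 * exp (- a * x powr \<alpha>)) \<longlongrightarrow> 0) at_top" using assms by real_asymp
  hence "\<forall>\<^sub>F x in at_top. x ^ 3 * exp (- a * x powr \<alpha>) < 1" by (rule order_tendstoD) simp
  then obtain X where X: "\<And>x. X \<le> x \<Longrightarrow> x ^ 3 * exp (- a * x powr \<alpha>) < 1"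
    unfolding eventually_at_top_linorder by blast
  define C where "C = max 1 (\<bar>X\<bar> ^ 3)"
  have "x * exp (- a * x powr \<alpha>) \<le> C / x\<^sup>2" if x: "r \<le> x" for x
  proof -
    have x0: "0 < x" using x assms by simp
    have "x ^ 3 * exp (- a * x powr \<alpha>) \<le> C"
    proof (cases "X \<le> x")
      case True
      thus ?thesis using X[of x] by (simp add: C_def)
    next
      case False
      have "x ^ 3 * exp (- a * x powr \<alpha>) \<le> \<bar>X\<bar> ^ 3 * 1"
        using False x0 assms by (intro mult_mono power_mono) auto
      thus ?thesis by (simp add: C_def)
    qed
    hence "(x * exp (- a * x powr \<alpha>)) * x\<^sup>2 \<le> C" by (simp add: power3_eq_cube power2_eq_square mult_ac)
    thus ?thesis using x0 by (simp add: pos_le_divide_eq)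
  qed
  thus ?thesis by (intro exI[of _ C]) (auto simp: C_def)
qed

section \<open>Blocks of the root vector series\<close>

text \<open>Derivatives of a holomorphic function are continuous, so the limit in
  \<open>H_coeff\<close> is the value at \<open>\<mu> q\<close>, and the two exponential prefactors
  are inverse to each other.\<close>

lemma root_coeff_t_eq:
  assumes \<Phi>: "(\<lambda>z. exp (- \<phi> z * of_real t)) holomorphic_on {z. 0 < Re z}" and \<mu>: "0 < Re (\<mu> q)"
  shows "root_coeff_t \<phi> \<mu> k e g t f q \<xi> i =
    (\<Sum>n=0..k q \<xi> - i. (deriv ^^ n) (\<lambda>\<zeta>. exp (- \<phi> (inverse \<zeta>) * of_real t)) (\<mu> q) / fact n * root_coeff k e g f q \<xi> (i + n))"
proof -
  let ?h = "\<lambda>\<zeta>. exp (- \<phi> (inverse \<zeta>) * of_real t)" and ?S = "{z. 0 < Re z}"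
  have S: "open ?S" by (rule open_halfspace_Re_gt)
  have sub: "(\<lambda>z. inverse z) ` ?S \<subseteq> ?S" by (auto simp: add_pos_nonneg divide_pos_pos)
  have inv: "(\<lambda>z. inverse z) holomorphic_on ?S" by (intro holomorphic_intros) auto
  have h: "?h holomorphic_on ?S"
    using holomorphic_on_compose_gen[OF inv \<Phi> sub] by (simp only: o_def)
  have "Lim (at (1 / (1 / \<mu> q))) ((deriv ^^ n) ?h) = (deriv ^^ n) ?h (\<mu> q)" for n
  proof -
    have "continuous_on ?S ((deriv ^^ n) ?h)"
      by (intro holomorphic_on_imp_continuous_on holomorphic_higher_deriv h S)
    hence "isCont ((deriv ^^ n) ?h) (\<mu> q)" using S \<mu> by (simp add: continuous_on_eq_continuous_at)
    thus ?thesis by (simp add: isCont_def tendsto_Lim)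
  qed
  hence "H_coeff n \<phi> (1 / \<mu> q) t = exp (\<phi> (1 / \<mu> q) * of_real t) * ((deriv ^^ n) ?h (\<mu> q) / fact n)" for n
    by (simp add: H_coeff_def)
  hence "root_coeff_t \<phi> \<mu> k e g t f q \<xi> i = exp (- \<phi> (1 / \<mu> q) * of_real t) * exp (\<phi> (1 / \<mu> q) * of_real t) *
      (\<Sum>n=0..k q \<xi> - i. (deriv ^^ n) ?h (\<mu> q) / fact n * root_coeff k e g f q \<xi> (i + n))"
    by (simp add: root_coeff_t_def sum_distrib_left mult_ac)
  also have "exp (- \<phi> (1 / \<mu> q) * of_real t) * exp (\<phi> (1 / \<mu> q) * of_real t) = 1"
    by (simp flip: exp_add)
  finally show ?thesis by simp
qed

lemma sum_abel_blocks:
  assumes \<Phi>: "(\<lambda>z. exp (- \<phi> z * of_real t)) holomorphic_on {z. 0 < Re z}"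
    and \<mu>: "\<And>q \<xi>. 1 \<le> q \<Longrightarrow> \<xi> \<in> {1..m q} \<Longrightarrow> 0 < Re (\<mu> q)"
    and N: "N 0 = 0" "strict_mono N"
  shows "(\<Sum>\<nu><n. abel_block \<mu> m k e g N \<nu> \<phi> t f) = root_sum \<mu> m k e g (\<lambda>z. exp (- \<phi> z * of_real t)) f (N n)"
proof (induction n)
  case 0
  show ?case by (simp add: root_sum_def N)
next
  case (Suc n)
  let ?F = "\<lambda>q. \<Sum>\<xi> = 1..m q. \<Sum>j = 0..k q \<xi>.
     (\<Sum>n=0..k q \<xi> - j. (deriv ^^ n) (\<lambda>\<zeta>. exp (- \<phi> (inverse \<zeta>) * of_real t)) (\<mu> q) / fact n * root_coeff k e g f q \<xi> (j + n)) *\<^sub>C e q \<xi> j"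
  have "abel_block \<mu> m k e g N n \<phi> t f = (\<Sum>q = N n + 1..N (Suc n). ?F q)"
    unfolding abel_block_def by (intro sum.cong refl arg_cong2[where f = scaleC] root_coeff_t_eq \<Phi> \<mu>) auto
  moreover have "(\<Sum>q = 1..N (Suc n). ?F q) = (\<Sum>q = 1..N n. ?F q) + (\<Sum>q = N n + 1..N (Suc n). ?F q)"
  proof -
    have "N n \<le> N (Suc n)" using N(2) by (simp add: strict_mono_less_eq)
    thus ?thesis using sum.ub_add_nat[of 1 "N n" ?F "N (Suc n) - N n"] by simp
  qed
  ultimately show ?case using Suc by (simp add: root_sum_def)
qed

section \<open>Convergence\<close>

lemma cauchy_at_top_limit:
  fixes J :: "real \<Rightarrow> 'b::banach"
  assumes J: "\<And>R R'. r < R \<Longrightarrow> R \<le> R' \<Longrightarrow> norm (J R' - J R) \<le> E * (1 / R - 1 / R')" and r: "0 < r" and E: "0 \<le> E"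
  shows "\<exists>I. (J \<longlongrightarrow> I) at_top"
proof -
  have le: "norm (J R' - J R) \<le> E / R" if "r < R" "R \<le> R'" for R R'
  proof -
    have "E * (1 / R - 1 / R') \<le> E * (1 / R)" using that r E by (intro mult_left_mono) auto
    thus ?thesis using J[OF that] by simp
  qed
  have lim0: "((\<lambda>R::real. E / R) \<longlongrightarrow> 0) at_top" by real_asymp
  have "Cauchy (\<lambda>n. J (r + 1 + real n))"
  proof (rule CauchyI')
    fix \<delta> :: real assume "0 < \<delta>"
    have "\<forall>\<^sub>F R in at_top. E / R < \<delta>" using order_tendstoD(2)[OF lim0 \<open>0 < \<delta>\<close>] .
    then obtain X where X: "\<And>R. X \<le> R \<Longrightarrow> E / R < \<delta>" unfolding eventually_at_top_linorder by blast
    obtain M :: nat where M: "X \<le> real M" using real_arch_simple by blast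
    show "\<exists>M. \<forall>m\<ge>M. \<forall>n>m. dist (J (r + 1 + real m)) (J (r + 1 + real n)) < \<delta>"
    proof (intro exI[of _ M] allI impI)
      fix m n assume "M \<le> m" "m < n"
      hence "norm (J (r + 1 + real n) - J (r + 1 + real m)) \<le> E / (r + 1 + real m)" by (intro le) auto
      also have "\<dots> < \<delta>" by (rule X) (use M \<open>M \<le> m\<close> r in linarith)
      finally show "dist (J (r + 1 + real m)) (J (r + 1 + real n)) < \<delta>" by (simp add: dist_norm norm_minus_commute)
    qed
  qed
  then obtain I where I: "(\<lambda>n. J (r + 1 + real n)) \<longlonglongrightarrow> I" using Cauchy_convergent_iff convergent_def by blast
  have bound: "norm (J R - I) \<le> E / R" if R: "r < R" for R
  proof -
    obtain M :: nat where M: "R \<le> real M" using real_arch_simple by blast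
    have "norm (J R - J (r + 1 + real n)) \<le> E / R" if "M \<le> n" for n
    proof -
      have "R \<le> r + 1 + real n" using M r that by linarith
      from le[OF R this] show ?thesis by (simp only: norm_minus_commute)
    qed
    thus ?thesis by (intro Lim_bounded[OF tendsto_norm[OF tendsto_diff[OF tendsto_const I]], of M]) blast
  qed
  have "(J \<longlongrightarrow> I) at_top"
  proof (rule LIM_zero_cancel, rule Lim_null_comparison[OF _ lim0])
    show "\<forall>\<^sub>F R in at_top. norm (J R - I) \<le> E / R"
      using eventually_gt_at_top[of r] by eventually_elim (rule bound)
  qed
  thus ?thesis ..
qed

theorem theorem2:
  fixes B :: "'a::chilbert_space \<Rightarrow> 'a"
    and \<alpha> \<theta> r \<epsilon> :: real
    and \<mu> :: "nat \<Rightarrow> complex"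
    and m :: "nat \<Rightarrow> nat"
    and k :: "nat \<Rightarrow> nat \<Rightarrow> nat"
    and e g :: "nat \<Rightarrow> nat \<Rightarrow> nat \<Rightarrow> 'a"
  assumes "separable_space (euclidean :: 'a topology)"
    and "0 < \<alpha>" and "\<alpha> \<notin> \<int>"
    and "compact_operator B"
    and "B \<in> schatten_star \<alpha>"
    and "0 \<le> \<theta>" and "\<theta> < pi / 2" and "\<theta> < pi / (2 * \<alpha>)"
    and "numerical_range B \<subseteq> sector \<theta>"
    and "singular_number B \<in> o(\<lambda>n. real (Suc n) powr (- 1 / \<alpha>))"
    and "0 < r" and "characteristic_numbers B \<inter> cball 0 r = {}"
    and "0 < \<epsilon>" and "\<theta> + \<epsilon> < min (pi / 2) (pi / (2 * \<alpha>))"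
    and "root_vector_system B \<mu> m k e g"
  shows "\<exists>N :: nat \<Rightarrow> nat. N 0 = 0 \<and> strict_mono N \<and>
    (\<forall>f. \<forall>t>0. \<exists>I.
       has_sector_contour_integral
         (\<lambda>z. exp (- (z powr of_real \<alpha>) * of_real t) *\<^sub>C B (inv (\<lambda>x. x - z *\<^sub>C B x) f))
         I r (\<theta> + \<epsilon>) \<and>
       (\<lambda>\<nu>. abel_block \<mu> m k e g N \<nu> (\<lambda>z. z powr of_real \<alpha>) t f)
         sums ((1 / (2 * of_real pi * \<i>)) *\<^sub>C I) \<and>
       summable (\<lambda>\<nu>. norm (abel_block \<mu> m k e g N \<nu> (\<lambda>z. z powr of_real \<alpha>) t f)))"
proof -
  define \<psi> where "\<psi> = \<theta> + \<epsilon>"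
  note compB = assms(4) and rvs = assms(15) and num = assms(9)
  have angles: "0 \<le> \<theta>" "\<theta> < \<psi>" "\<psi> < pi / 2" using assms(6,13,14) by (auto simp: \<psi>_def)
  have "\<psi> < pi / (2 * \<alpha>)" using assms(14) by (simp add: \<psi>_def)
  hence \<alpha>\<psi>: "\<alpha> * \<psi> < pi / 2" using assms(2) by (simp add: field_simps)
  have \<alpha>\<psi>0: "0 < \<alpha> * \<psi>" using angles assms(2) by simp
  note ctx = compB rvs num angles assms(11,12)
  note B' = compact_operator_cbounded_linear[OF compB]
  obtain K where K: "0 < K" "\<And>x. norm (B x) \<le> K * norm x" using cbounded_linear_bound[OF B'] by blast
  have sin_pos: "0 < sin (\<psi> - \<theta>)" using angles by (intro sin_gt_zero) auto
  obtain N R where NR: "N 0 = 0 \<and> strict_mono N \<and> (\<forall>n. R n \<le> R (Suc n)) \<and>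
    (\<forall>n\<ge>1. r < R n \<and> real n \<le> R n \<and>
      (\<forall>q\<ge>1. \<mu> q \<noteq> 0 \<longrightarrow> (q \<le> N n \<longleftrightarrow> 1 / norm (\<mu> q) < R n)) \<and>
      (\<forall>z. cmod z = R n \<longrightarrow> regular B z \<and> (\<forall>x. norm x \<le> exp (1 / real n * R n powr \<alpha>) * norm (x - z *\<^sub>C B x))))"
    using radii_exist[OF ctx assms(2,10)] by (elim exE)
  have N: "N 0 = 0" "strict_mono N" and R_mono: "R n \<le> R (Suc n)" for n using NR by blast+
  have R: "r < R n" "real n \<le> R n" "1 \<le> q \<Longrightarrow> \<mu> q \<noteq> 0 \<Longrightarrow> q \<le> N n \<longleftrightarrow> 1 / norm (\<mu> q) < R n"
    and Rreg: "cmod z = R n \<Longrightarrow> regular B z"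
      "cmod z = R n \<Longrightarrow> norm x \<le> exp (1 / real n * R n powr \<alpha>) * norm (x - z *\<^sub>C B x)"
    if "1 \<le> n" for n q z x
    using NR that by blast+
  have main: "\<exists>I. has_sector_contour_integral
         (\<lambda>z. exp (- (z powr of_real \<alpha>) * of_real t) *\<^sub>C B (inv (\<lambda>x. x - z *\<^sub>C B x) f)) I r \<psi> \<and>
       (\<lambda>\<nu>. abel_block \<mu> m k e g N \<nu> (\<lambda>z. z powr of_real \<alpha>) t f) sums ((1 / (2 * of_real pi * \<i>)) *\<^sub>C I) \<and>
       summable (\<lambda>\<nu>. norm (abel_block \<mu> m k e g N \<nu> (\<lambda>z. z powr of_real \<alpha>) t f))"
    if t: "0 < t" for f :: 'a and t :: real
  proof -
    define \<Phi> where "\<Phi> z = exp (- (z powr of_real \<alpha>) * of_real t)" for z :: complex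
    \<comment> \<open>The decay rate on the edges of the sector, positive because
      \<open>\<alpha> * \<psi> < pi / 2\<close>.\<close>
    define c0 where "c0 = t * cos (\<alpha> * \<psi>)"
    have c0: "0 < c0" unfolding c0_def by (rule mult_pos_pos[OF t cos_gt_zero[OF \<alpha>\<psi>0 \<alpha>\<psi>]])
    have hol\<Phi>: "\<Phi> holomorphic_on {z. 0 < Re z}"
      unfolding \<Phi>_def[abs_def] by (rule holomorphic_exp_minus_powr)
    have \<Phi>_le: "cmod (\<Phi> (of_real x * cis \<phi>)) \<le> exp (- c0 * x powr \<alpha>)" if "0 < x" "\<bar>\<phi>\<bar> \<le> \<psi>" for x \<phi>
      using norm_exp_minus_powr_le[of x \<phi> \<psi> \<alpha> t] that angles \<alpha>\<psi> assms(2) t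
      by (simp add: \<Phi>_def c0_def)
    define F where "F z = \<Phi> z *\<^sub>C B (resolvent_op B z f)" for z
    define G where "G y z = \<Phi> z * cinner (B (resolvent_op B z f)) y" for y z
    have FG: "cinner (F z) y = G y z" for y z by (simp add: F_def G_def cinner_scaleC_left)
    have halfplane: "sector_contour r \<psi> \<subseteq> {z. 0 < Re z}"
    proof
      fix z assume "z \<in> sector_contour r \<psi>"
      then obtain x \<phi> where "r \<le> x" "\<bar>\<phi>\<bar> \<le> \<psi>" "z = of_real x * cis \<phi>" unfolding sector_contour_def by force
      thus "z \<in> {z. 0 < Re z}" using cis_in_halfplane[of x \<phi>] angles assms(11) by simp
    qed
    have cont: "continuous_on S F" if "S \<subseteq> {z. 0 < Re z}" "\<And>z. z \<in> S \<Longrightarrow> regular B z" for S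
    proof -
      have "continuous_on S (\<lambda>z. B (resolvent_op B z f))"
        using bounded_linear.continuous_on[of B S "\<lambda>z. resolvent_op B z f"] B' continuous_on_resolvent_op[OF B' that(2)]
        by (simp add: cbounded_linear_def)
      thus ?thesis unfolding F_def[abs_def]
        by (intro scaleC.continuous_on holomorphic_on_imp_continuous_on holomorphic_on_subset[OF hol\<Phi>] that)
    qed
    have contG: "continuous_on S (G y)" if "S \<subseteq> {z. 0 < Re z}" "\<And>z. z \<in> S \<Longrightarrow> regular B z" for S y
      using cinner.continuous_on[OF cont[OF that] continuous_on_const[of S y]] by (simp add: FG)
    have regS: "\<And>z. z \<in> sector_contour r \<psi> \<Longrightarrow> regular B z" by (rule regular_sector_contour[OF ctx])
    have "\<exists>I. has_vector_contour_integral F I (truncated_contour r \<psi> \<rho>)" if "r < \<rho>" for \<rho>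
      by (rule truncated_contour_integral_exists) (use that angles cont[OF halfplane regS] in auto)
    then obtain J where J: "\<And>\<rho>. r < \<rho> \<Longrightarrow> has_vector_contour_integral F (J \<rho>) (truncated_contour r \<psi> \<rho>)"
      by metis
    have JG: "(G y has_contour_integral cinner (J \<rho>) y) (truncated_contour r \<psi> \<rho>)" if "r < \<rho>" for \<rho> y
      using has_vector_contour_integral_cinner[OF J[OF that], of y] by (simp add: FG)
    have G_le: "cmod (G y z) \<le> cmod (\<Phi> z) * (K * L) * norm y" if "norm (resolvent_op B z f) \<le> L" for y z L
    proof -
      have "norm (B (resolvent_op B z f)) \<le> K * L"
        by (rule order_trans[OF K(2) mult_left_mono[OF that]]) (use K(1) in simp)
      hence "cmod (cinner (B (resolvent_op B z f)) y) \<le> (K * L) * norm y"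
        by (intro order_trans[OF cmod_cinner_le] mult_right_mono) auto
      hence "cmod (\<Phi> z) * cmod (cinner (B (resolvent_op B z f)) y) \<le> cmod (\<Phi> z) * ((K * L) * norm y)"
        by (intro mult_left_mono) auto
      thus ?thesis by (simp add: G_def norm_mult mult.assoc)
    qed
    obtain C where C: "0 \<le> C" "\<And>x. r \<le> x \<Longrightarrow> x * exp (- c0 * x powr \<alpha>) \<le> C / x\<^sup>2"
      using exp_minus_powr_decay[OF c0 assms(2,11)] by blast
    define L where "L = norm f / sin (\<psi> - \<theta>)"
    have L: "0 \<le> L" using sin_pos by (simp add: L_def)
    define E where "E = C / r * (K * L)"
    have E: "0 \<le> E" using C(1) assms(11) K L by (simp add: E_def)
    have ray: "cmod (G y (of_real x * cis \<phi>)) \<le> (E * norm y) / x\<^sup>2" if "r \<le> x" "\<bar>\<phi>\<bar> = \<psi>" for x \<phi> y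
    proof -
      have x: "0 < x" using that assms(11) by simp
      have "r * exp (- c0 * x powr \<alpha>) \<le> x * exp (- c0 * x powr \<alpha>)" using that by (intro mult_right_mono) auto
      hence "r * exp (- c0 * x powr \<alpha>) \<le> C / x\<^sup>2" using C(2)[OF that(1)] by linarith
      hence "exp (- c0 * x powr \<alpha>) \<le> C / x\<^sup>2 / r" using divide_right_mono[of _ _ r] assms(11) by fastforce
      hence 1: "cmod (\<Phi> (of_real x * cis \<phi>)) \<le> C / x\<^sup>2 / r" using \<Phi>_le[OF x, of \<phi>] that by linarith
      have "norm (resolvent_op B (of_real x * cis \<phi>) f) \<le> L"
        unfolding L_def by (rule regular_on_ray(2)[OF compB num angles]) (use x that in auto)
      from G_le[OF this, of y] have "cmod (G y (of_real x * cis \<phi>)) \<le> cmod (\<Phi> (of_real x * cis \<phi>)) * ((K * L) * norm y)"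
        by (simp add: mult.assoc)
      also have "\<dots> \<le> C / x\<^sup>2 / r * ((K * L) * norm y)" using K L by (intro mult_right_mono 1) auto
      also have "\<dots> = (E * norm y) / x\<^sup>2" by (simp add: E_def mult_ac)
      finally show ?thesis .
    qed
    have Jdiff: "norm (J \<rho>' - J \<rho>) \<le> 2 * E * (1 / \<rho> - 1 / \<rho>')" if "r < \<rho>" "\<rho> \<le> \<rho>'" for \<rho> \<rho>'
    proof (rule norm_le_if_cinner)
      fix y
      have "r < \<rho>'" using that by simp
      have "cmod (contour_integral (truncated_contour r \<psi> \<rho>') (G y) - contour_integral (truncated_contour r \<psi> \<rho>) (G y))
          \<le> 2 * (E * norm y) * (1 / \<rho> - 1 / \<rho>')"
        by (rule truncated_contour_integral_diff) (use that assms(11) angles contG[OF halfplane regS] ray in auto)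
      thus "cmod (cinner (J \<rho>' - J \<rho>) y) \<le> 2 * E * (1 / \<rho> - 1 / \<rho>') * norm y"
        using contour_integral_unique[OF JG[OF that(1), of y]] contour_integral_unique[OF JG[OF \<open>r < \<rho>'\<close>, of y]]
        by (simp add: cinner.diff_left mult_ac)
    next
      have "1 / \<rho>' \<le> 1 / \<rho>" using that assms(11) by (intro divide_left_mono) auto
      thus "0 \<le> 2 * E * (1 / \<rho> - 1 / \<rho>')" using E by simp
    qed
    obtain I where I: "(J \<longlongrightarrow> I) at_top"
      using cauchy_at_top_limit[of r J "2 * E", OF Jdiff assms(11)] E by auto
    have contour: "has_sector_contour_integral (\<lambda>z. exp (- (z powr of_real \<alpha>) * of_real t) *\<^sub>C B (inv (\<lambda>x. x - z *\<^sub>C B x) f)) I r \<psi>"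
      unfolding has_sector_contour_integral_def
      using J I by (intro exI[of _ J]) (auto simp: F_def[abs_def] \<Phi>_def[abs_def] resolvent_op_def)
    define S where "S n = root_sum \<mu> m k e g \<Phi> f (N n)" for n
    define A where "A n = (2 * of_real pi * \<i>) *\<^sub>C S n" for n
    \<comment> \<open>Decay of the exponential, bound for \<open>B\<close> after the resolvent on
      the circle, and arc length \<open>R n * (2 * \<psi>)\<close>.\<close>
    define \<kappa> where "\<kappa> n = exp (- c0 * R n powr \<alpha>) * (K * (exp (1 / real n * R n powr \<alpha>) * norm f)) * R n * (2 * \<psi>)" for n
    have arc: "norm (J (R n) - A n) \<le> \<kappa> n" if n: "1 \<le> n" for n
    proof (rule norm_le_if_cinner)
      have Rn: "r < R n" "0 < R n" using R(1)[OF n] assms(11) by auto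
      show "0 \<le> \<kappa> n" using K Rn angles by (simp add: \<kappa>_def)
      fix y
      have img: "\<exists>\<phi>. \<bar>\<phi>\<bar> \<le> \<psi> \<and> z = of_real (R n) * cis \<phi>" if "z \<in> path_image (part_circlepath 0 (R n) (- \<psi>) \<psi>)" for z
        by (rule path_image_arc[OF _ _ that]) (use angles in auto)
      have int1: "G y contour_integrable_on (part_circlepath 0 (R n) (- \<psi>) \<psi>)"
      proof (intro contour_integrable_continuous_part_circlepath contG subsetI)
        fix z assume "z \<in> path_image (part_circlepath 0 (R n) (- \<psi>) \<psi>)"
        then obtain \<phi> where \<phi>: "\<bar>\<phi>\<bar> \<le> \<psi>" "z = of_real (R n) * cis \<phi>" using img by blast
        show "z \<in> {z. 0 < Re z}" using cis_in_halfplane[of "R n" \<phi>] \<phi> Rn angles by simp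
        show "regular B z" by (rule Rreg(1)[OF n]) (use \<phi> Rn in \<open>simp add: norm_mult\<close>)
      qed
      hence int2: "G y contour_integrable_on (part_circlepath 0 (R n) \<psi> (- \<psi>))"
        using contour_integrable_reversepath[of "part_circlepath 0 (R n) (- \<psi>) \<psi>" "G y"] by simp
      have "(G y has_contour_integral 2 * pi * \<i> * cinner (S n) y) (closed_contour r \<psi> (R n))"
        unfolding G_def S_def
        by (rule closed_contour_resolvent_integral[OF ctx Rn(1) Rreg(1)[OF n] R(3)[OF n] hol\<Phi>]) auto
      hence "2 * pi * \<i> * cinner (S n) y = contour_integral (closed_contour r \<psi> (R n)) (G y)"
        by (simp add: contour_integral_unique)
      also have "\<dots> = contour_integral (truncated_contour r \<psi> (R n)) (G y) + contour_integral (part_circlepath 0 (R n) \<psi> (- \<psi>)) (G y)"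
        by (rule contour_integral_closed_contour[OF _ int2]) (use JG[OF Rn(1)] contour_integrable_on_def in blast)
      also have "contour_integral (truncated_contour r \<psi> (R n)) (G y) = cinner (J (R n)) y"
        by (rule contour_integral_unique[OF JG[OF Rn(1)]])
      also have "contour_integral (part_circlepath 0 (R n) \<psi> (- \<psi>)) (G y) = - contour_integral (part_circlepath 0 (R n) (- \<psi>) \<psi>) (G y)"
        by (rule contour_integral_part_circlepath_reverse)
      \<comment> \<open>Closing the contour adds the outer arc run backwards, so what the truncated
        integral has beyond the residues is the same arc run forwards.\<close>
      finally have "cinner (J (R n) - A n) y = contour_integral (part_circlepath 0 (R n) (- \<psi>) \<psi>) (G y)"
        by (simp add: A_def cinner.diff_left cinner_scaleC_left)
      also have "cmod \<dots> \<le> (exp (- c0 * R n powr \<alpha>) * (K * (exp (1 / real n * R n powr \<alpha>) * norm f)) * norm y) * R n * (\<psi> - - \<psi>)"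
      proof (rule has_contour_integral_bound_part_circlepath[OF has_contour_integral_integral[OF int1]])
        fix z assume "z \<in> path_image (part_circlepath 0 (R n) (- \<psi>) \<psi>)"
        then obtain \<phi> where \<phi>: "\<bar>\<phi>\<bar> \<le> \<psi>" "z = of_real (R n) * cis \<phi>" using img by blast
        have z: "cmod z = R n" using \<phi> Rn by (simp add: norm_mult)
        have "norm (resolvent_op B z f) \<le> exp (1 / real n * R n powr \<alpha>) * norm f"
          using Rreg(2)[OF n z, of "resolvent_op B z f"] by (simp only: resolvent_op_eq[OF B' Rreg(1)[OF n z]])
        from G_le[OF this, of y]
        have "cmod (G y z) \<le> cmod (\<Phi> z) * (K * (exp (1 / real n * R n powr \<alpha>) * norm f) * norm y)"
          by (simp only: mult.assoc)
        also have "\<dots> \<le> exp (- c0 * R n powr \<alpha>) * (K * (exp (1 / real n * R n powr \<alpha>) * norm f) * norm y)"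
          using \<Phi>_le[OF Rn(2) \<phi>(1)] \<phi>(2) K by (intro mult_right_mono) auto
        finally show "cmod (G y z) \<le> exp (- c0 * R n powr \<alpha>) * (K * (exp (1 / real n * R n powr \<alpha>) * norm f)) * norm y"
          by (simp only: mult.assoc)
      qed (use Rn K angles in auto)
      finally show "cmod (cinner (J (R n) - A n) y) \<le> \<kappa> n * norm y" by (simp add: \<kappa>_def mult_ac)
    qed
    have sum_\<kappa>: "summable \<kappa>"
    proof -
      \<comment> \<open>Half of the decay survives as soon as \<open>1 / n \<le> c0 / 2\<close>;
        this threshold depends on \<open>t\<close>, the radii do not.\<close>
      define a where "a = c0 / 2"
      have a: "0 < a" using c0 by (simp add: a_def)
      obtain C' where C': "0 \<le> C'" "\<And>x. r \<le> x \<Longrightarrow> x * exp (- a * x powr \<alpha>) \<le> C' / x\<^sup>2"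
        using exp_minus_powr_decay[OF a assms(2,11)] by blast
      define D where "D = K * norm f * (2 * \<psi>)"
      have D: "0 \<le> D" using K angles by (simp add: D_def)
      obtain n0 :: nat where n0: "1 / a \<le> real n0" using real_arch_simple by blast
      show ?thesis
      proof (rule summable_comparison_test[where g = "\<lambda>n. D * C' * inverse (real n ^ 2)"])
        show "summable (\<lambda>n. D * C' * inverse (real n ^ 2))"
          by (intro summable_mult inverse_power_summable) simp
        show "\<exists>N. \<forall>n\<ge>N. norm (\<kappa> n) \<le> D * C' * inverse (real n ^ 2)"
        proof (intro exI[of _ "max 1 n0"] allI impI)
          fix n assume "max 1 n0 \<le> n"
          hence n: "1 \<le> n" "1 / a \<le> real n" using n0 by auto
          have Rn: "r < R n" "0 < R n" "real n \<le> R n" using R(1,2)[OF n(1)] assms(11) by auto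
          have "1 / real n \<le> a" using n a by (simp add: field_simps)
          hence "1 / real n * R n powr \<alpha> \<le> a * R n powr \<alpha>" by (intro mult_right_mono) auto
          hence "exp (- c0 * R n powr \<alpha> + 1 / real n * R n powr \<alpha>) \<le> exp (- a * R n powr \<alpha>)"
            by (simp add: a_def field_simps)
          hence "R n * exp (- c0 * R n powr \<alpha> + 1 / real n * R n powr \<alpha>) \<le> R n * exp (- a * R n powr \<alpha>)"
            using Rn by (intro mult_left_mono) auto
          also have "\<dots> \<le> C' / (R n)\<^sup>2" using C'(2)[of "R n"] Rn by simp
          \<comment> \<open>Summability of the arc errors comes from
            \<open>real n \<le> R n\<close>.\<close>
          also have "\<dots> \<le> C' / (real n)\<^sup>2" using Rn n C'(1) by (intro divide_left_mono power_mono) auto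
          finally have "D * (R n * exp (- c0 * R n powr \<alpha> + 1 / real n * R n powr \<alpha>)) \<le> D * (C' / (real n)\<^sup>2)"
            using D by (intro mult_left_mono)
          moreover have "\<kappa> n = D * (R n * exp (- c0 * R n powr \<alpha> + 1 / real n * R n powr \<alpha>))"
            unfolding \<kappa>_def D_def exp_add by (simp only: mult_ac)
          moreover have "0 \<le> \<kappa> n" unfolding \<kappa>_def using K Rn angles by simp
          ultimately show "norm (\<kappa> n) \<le> D * C' * inverse (real n ^ 2)" by (simp add: divide_inverse)
        qed
      qed
    qed
    have Rtop: "filterlim R at_top sequentially"
    proof (rule filterlim_at_top_mono[OF filterlim_real_sequentially])
      show "\<forall>\<^sub>F n in sequentially. real n \<le> R n"
        using eventually_ge_at_top[of 1] by eventually_elim (rule R(2))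
    qed
    have JR: "(\<lambda>n. J (R n)) \<longlonglongrightarrow> I" by (rule filterlim_compose[OF I Rtop])
    have "(\<lambda>n. J (R n) - A n) \<longlonglongrightarrow> 0"
    proof (rule Lim_null_comparison[OF _ summable_LIMSEQ_zero[OF sum_\<kappa>]])
      show "\<forall>\<^sub>F n in sequentially. norm (J (R n) - A n) \<le> \<kappa> n"
        using eventually_ge_at_top[of 1] by eventually_elim (rule arc)
    qed
    from tendsto_diff[OF JR this] have "A \<longlonglongrightarrow> I" by simp
    hence "(\<lambda>n. (1 / (2 * of_real pi * \<i>)) *\<^sub>C A n) \<longlonglongrightarrow> (1 / (2 * of_real pi * \<i>)) *\<^sub>C I"
      by (intro scaleC.tendsto tendsto_const)
    moreover have SA: "(1 / (2 * of_real pi * \<i>)) *\<^sub>C A n = S n" for n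
      by (simp add: A_def scaleC_scaleC scaleC_one)
    ultimately have Slim: "S \<longlonglongrightarrow> (1 / (2 * of_real pi * \<i>)) *\<^sub>C I" by simp
    let ?b = "\<lambda>\<nu>. abel_block \<mu> m k e g N \<nu> (\<lambda>z. z powr of_real \<alpha>) t f"
    have partial: "(\<Sum>\<nu><n. ?b \<nu>) = S n" for n
      unfolding S_def \<Phi>_def[abs_def]
    proof (rule sum_abel_blocks[OF hol\<Phi>[unfolded \<Phi>_def[abs_def]] _ N])
      fix q \<xi> assume "1 \<le> q" "\<xi> \<in> {1..m q}"
      thus "0 < Re (\<mu> q)" using root_system_halfplane[OF ctx] root_system_index[OF compB rvs] by blast
    qed
    have sums: "?b sums ((1 / (2 * of_real pi * \<i>)) *\<^sub>C I)"
      unfolding sums_def partial by (rule Slim)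
    have "summable (\<lambda>\<nu>. norm (?b \<nu>))"
    \<comment> \<open>A block is a difference of residue sums, compared through \<open>A\<close>
      with truncated integrals: two arc errors, and the ray pieces between the circles, whose bounds
      telescope.\<close>
    proof (rule summable_comparison_test[where g = "\<lambda>\<nu>. \<kappa> (Suc \<nu>) + \<kappa> \<nu> + 2 * E * (1 / R \<nu> - 1 / R (Suc \<nu>))"])
      have "(\<lambda>n. 1 / R n) \<longlonglongrightarrow> 0"
        using tendsto_inverse_0_at_top[OF Rtop] by (simp add: inverse_eq_divide)
      hence "summable (\<lambda>n. 1 / R n - 1 / R (Suc n))" by (rule telescope_summable')
      thus "summable (\<lambda>\<nu>. \<kappa> (Suc \<nu>) + \<kappa> \<nu> + 2 * E * (1 / R \<nu> - 1 / R (Suc \<nu>)))"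
        using sum_\<kappa> by (intro summable_add summable_mult) (simp_all add: summable_Suc_iff)
      show "\<exists>M. \<forall>n\<ge>M. norm (norm (?b n)) \<le> \<kappa> (Suc n) + \<kappa> n + 2 * E * (1 / R n - 1 / R (Suc n))"
      \<comment> \<open>Stage 0 is left out because \<open>R 0\<close> is not known to exceed
        \<open>r\<close>.\<close>
      proof (intro exI[of _ 1] allI impI)
        fix n :: nat assume n: "1 \<le> n"
        have "?b n = S (Suc n) - S n" using partial[of "Suc n"] partial[of n] by (simp add: eq_diff_eq add.commute)
        also have "\<dots> = (1 / (2 * of_real pi * \<i>)) *\<^sub>C (A (Suc n) - A n)" by (simp add: scaleC.diff_right SA)
        finally have "norm (?b n) = norm (A (Suc n) - A n) / (2 * pi)" by (simp add: norm_divide norm_mult)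
        also have "\<dots> \<le> norm (A (Suc n) - A n)"
          using pi_gt3 divide_left_mono[of 1 "2 * pi" "norm (A (Suc n) - A n)"] by simp
        also have "A (Suc n) - A n = (J (R (Suc n)) - J (R n)) - (J (R (Suc n)) - A (Suc n)) + (J (R n) - A n)" by simp
        also have "norm \<dots> \<le> norm (J (R (Suc n)) - J (R n)) + norm (J (R (Suc n)) - A (Suc n)) + norm (J (R n) - A n)"
          by (intro order_trans[OF norm_triangle_ineq] add_right_mono norm_triangle_ineq4)
        also have "\<dots> \<le> 2 * E * (1 / R n - 1 / R (Suc n)) + \<kappa> (Suc n) + \<kappa> n"
          by (intro add_mono Jdiff arc R(1) R_mono) (use n in auto)
        finally show "norm (norm (?b n)) \<le> \<kappa> (Suc n) + \<kappa> n + 2 * E * (1 / R n - 1 / R (Suc n))" by simp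
      qed
    qed
    with contour sums show ?thesis by blast
  qed
  show ?thesis using N main unfolding \<psi>_def by blast
qed

end
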